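(* Let $(Q,\mathfrak{n})$ be a local ring and let $f,g\in \mathfrak{n}\smallsetminus \mathfrak{n}^2$ be such that $fg=0$. Set $R=Q/(f)$ and let $A=Q\langle y,t\mid \partial(y)=f,\ \partial(t)=gy\rangle$ be the Tate construction on $f,g$. Let $M$ be a finitely generated $R$-module and let $U$ be a minimal free resolution of $M$ over $Q$. Then: (a) $U$ has a structure of semi-free dg module over $A$ (that is, the complex of $Q$-modules $U$, with its given differential and $Q$-module structure, can be endowed with an $A$-action making it a semi-free dg $A$-module). (b) Furthermore, if $\operatorname{ann}_Q(f)=(g)$ and $\operatorname{ann}_Q(g)=(f)$, then, with $U$ equipped with a semi-free dg $A$-module structure as in (a), the complex $U\otimes_A R$ is a minimal free resolution of $M$ over $R$.
   Context: Local rings are commutative and noetherian. For a complex $W$ of $Q$-modules, $W^\#$ denotes the underlying graded $Q$-module and $|w|$ the degree of a homogeneous element $w$. A dg algebra over $Q$ is a complex $(A,\partial)$ of $Q$-modules concentrated in non-negative homological degrees such that $A^\#$ is a (unital, associative) graded $Q$-algebra that is graded commutative ($ab=(-1)^{|a||b|}ba$ for homogeneous $a,b$, and $a^2=0$ when $|a|$ is odd) and $\partial(ab)=\partial(a)b+(-1)^{|a|}a\,\partial(b)$. A dg module over $A$ is a complex $(U,\partial)$ such that $U^\#$ is a graded $A^\#$-module and $\partial(au)=\partial(a)u+(-1)^{|a|}a\,\partial(u)$ for $a\in A$, $u\in U$. A bounded below dg $A$-module $U$ is semi-free if $U^\#$ is free over $A^\#$ (as a graded module, i.e. with a basis of homogeneous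 elements). The Tate construction. For $f,g\in Q$ with $fg=0$, the dg algebra $A=Q\langle y,t\mid \partial(y)=f,\ \partial(t)=gy\rangle$ is defined as follows. As a graded $Q$-module it is free with basis $\{t^{(i)},\ yt^{(i)}\}_{i\ge 0}$, where $|t^{(i)}|=2i$, $|yt^{(i)}|=2i+1$, $t^{(0)}=1$, $t=t^{(1)}$ and $y=yt^{(0)}$. The multiplication is $Q$-bilinear and determined by $y^2=0$, $t^{(i)}t^{(j)}=\frac{(i+j)!}{i!\,j!}t^{(i+j)}$, and $y\,t^{(i)}=t^{(i)}y=yt^{(i)}$. The differential is determined by $\partial(y)=f$ and $\partial(t^{(i)})=g\,yt^{(i-1)}$ for $i\ge1$ together with the Leibniz rule, so $\partial(yt^{(i)})=f\,t^{(i)}$. Thus $A$ is the complex $\cdots\to Q\xrightarrow{f}Q\xrightarrow{g}Q\xrightarrow{f}Q\to 0$, and $H_0(A)=Q/(f)=R$. The ring $R$, viewed as a complex concentrated in degree $0$, is a dg $A$-module via the augmentation $A\to H_0(A)=R$; the tensor product $U\otimes_A R$ is formed using this and the dg $A$-module structure on $U$. *)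

theory Defs
  imports "HOL-Algebra.Algebra"
begin

section \<open>Commutative algebra\<close>

locale noetherian_local_ring = cring R + noetherian_ring R for R (structure) +
  fixes \<mm> :: "'a set"
  assumes maximal: "maximalideal \<mm> R"
    and unique_maximal: "maximalideal J R \<Longrightarrow> J = \<mm>"

definition annihilator :: "('a, 'x) ring_scheme \<Rightarrow> 'a \<Rightarrow> 'a set"
  where "annihilator R a = {r \<in> carrier R. r \<otimes>\<^bsub>R\<^esub> a = \<zero>\<^bsub>R\<^esub>}"

definition module_hom ::
    "('a, 'x) ring_scheme \<Rightarrow> ('a, 'b) module \<Rightarrow> ('a, 'c) module \<Rightarrow> ('b \<Rightarrow> 'c) set"
  where "module_hom R M N =
    {h \<in> carrier M \<rightarrow> carrier N.
       (\<forall>x\<in>carrier M. \<forall>y\<in>carrier M. h (x \<oplus>\<^bsub>M\<^esub> y) = h x \<oplus>\<^bsub>N\<^esub> h y) \<and>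
       (\<forall>r\<in>carrier R. \<forall>x\<in>carrier M. h (r \<odot>\<^bsub>M\<^esub> x) = r \<odot>\<^bsub>N\<^esub> h x)}"

definition submodule_generated ::
    "('a, 'x) ring_scheme \<Rightarrow> ('a, 'b) module \<Rightarrow> 'b set \<Rightarrow> 'b set"
  where "submodule_generated R M S = \<Inter>{N. submodule N R M \<and> S \<subseteq> N}"

definition finitely_generated_module :: "('a, 'x) ring_scheme \<Rightarrow> ('a, 'b) module \<Rightarrow> bool"
  where "finitely_generated_module R M \<longleftrightarrow>
    (\<exists>S. finite S \<and> S \<subseteq> carrier M \<and> submodule_generated R M S = carrier M)"

definition ideal_times_module ::
    "('a, 'x) ring_scheme \<Rightarrow> 'a set \<Rightarrow> ('a, 'b) module \<Rightarrow> 'b set"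
  where "ideal_times_module R I M =
    submodule_generated R M {r \<odot>\<^bsub>M\<^esub> x | r x. r \<in> I \<and> x \<in> carrier M}"

definition finite_free_module :: "('a, 'x) ring_scheme \<Rightarrow> ('a, 'b) module \<Rightarrow> bool"
  where "finite_free_module R M \<longleftrightarrow>
    (\<exists>B. finite B \<and> B \<subseteq> carrier M \<and>
      (\<forall>x\<in>carrier M. \<exists>!c. c \<in> B \<rightarrow>\<^sub>E carrier R \<and> x = (\<Oplus>\<^bsub>M\<^esub>b\<in>B. c b \<odot>\<^bsub>M\<^esub> b)))"

definition restrict_scalars :: "('a \<Rightarrow> 'c) \<Rightarrow> ('c, 'b) module \<Rightarrow> ('a, 'b) module"
  where "restrict_scalars h M =
    \<lparr>carrier = carrier M, monoid.mult = monoid.mult M, monoid.one = monoid.one M, ring.zero = ring.zero M,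
     ring.add = ring.add M, smult = (\<lambda>r x. h r \<odot>\<^bsub>M\<^esub> x)\<rparr>"


section \<open>Complexes and minimal free resolutions\<close>

text \<open>Complexes are graded by the integers, homologically: \<open>bdry C n\<close> maps degree \<open>n\<close> to degree
  \<open>n - 1\<close>. A graded module is the family of its homogeneous components, so all the axioms below
  are about homogeneous elements, with their degrees as explicit arguments. The fields \<open>mult\<close>
  and \<open>one\<close> of the components, which \<^typ>\<open>('a, 'b) module\<close> inherits from rings, play no role.\<close>

record ('a, 'b) chain_complex =
  component :: "int \<Rightarrow> ('a, 'b) module"
  bdry :: "int \<Rightarrow> 'b \<Rightarrow> 'b"

locale chain_complex = R?: cring R for R :: "('a, 'x) ring_scheme" (structure) and C :: "('a, 'b) chain_complex" +
  assumes comp_module: "module R (component C n)"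
    and bdry_hom: "bdry C n \<in> module_hom R (component C n) (component C (n - 1))"
    and bdry_bdry: "x \<in> carrier (component C n) \<Longrightarrow>
      bdry C (n - 1) (bdry C n x) = \<zero>\<^bsub>component C (n - 1 - 1)\<^esub>"

definition concentrated_ge :: "int \<Rightarrow> ('a, 'b) chain_complex \<Rightarrow> bool"
  where "concentrated_ge m C \<longleftrightarrow> (\<forall>n<m. carrier (component C n) = {\<zero>\<^bsub>component C n\<^esub>})"

definition cycles :: "('a, 'b) chain_complex \<Rightarrow> int \<Rightarrow> 'b set"
  where "cycles C n = {x \<in> carrier (component C n). bdry C n x = \<zero>\<^bsub>component C (n - 1)\<^esub>}"

definition boundaries :: "('a, 'b) chain_complex \<Rightarrow> int \<Rightarrow> 'b set"
  where "boundaries C n = bdry C (n + 1) ` carrier (component C (n + 1))"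

definition free_resolution ::
    "('a, 'x) ring_scheme \<Rightarrow> ('a, 'b) chain_complex \<Rightarrow> ('a, 'c) module \<Rightarrow> bool"
  where "free_resolution R F M \<longleftrightarrow>
    chain_complex R F \<and> concentrated_ge 0 F \<and>
    (\<forall>n. finite_free_module R (component F n)) \<and>
    (\<forall>n>0. cycles F n = boundaries F n) \<and>
    (\<exists>\<epsilon>\<in>module_hom R (component F 0) M.
       \<epsilon> ` carrier (component F 0) = carrier M \<and>
       {x \<in> carrier (component F 0). \<epsilon> x = \<zero>\<^bsub>M\<^esub>} = boundaries F 0)"

text \<open>Over a local ring with maximal ideal \<open>\<mm>\<close> and for a finitely generated module, the free
  modules in a minimal free resolution have finite rank; here this is part of the definition.\<close>

definition minimal_free_resolution ::
    "('a, 'x) ring_scheme \<Rightarrow> 'a set \<Rightarrow> ('a, 'b) chain_complex \<Rightarrow> ('a, 'c) module \<Rightarrow> bool"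
  where "minimal_free_resolution R \<mm> F M \<longleftrightarrow>
    free_resolution R F M \<and>
    (\<forall>n. bdry F n ` carrier (component F n) \<subseteq> ideal_times_module R \<mm> (component F (n - 1)))"


section \<open>DG algebras and DG modules\<close>

definition signed :: "int \<Rightarrow> ('a, 'b) module \<Rightarrow> 'b \<Rightarrow> 'b"
  where "signed k M x = (if even k then x else \<ominus>\<^bsub>M\<^esub> x)"

record ('a, 'b) dg_alg = "('a, 'b) chain_complex" +
  mul :: "int \<Rightarrow> int \<Rightarrow> 'b \<Rightarrow> 'b \<Rightarrow> 'b"
  unit_elt :: 'b

definition dg_complex :: "('a, 'b) dg_alg \<Rightarrow> ('a, 'b) chain_complex"
  where "dg_complex A = \<lparr>component = component A, bdry = bdry A\<rparr>"

definition bilinear_map ::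
    "('a, 'x) ring_scheme \<Rightarrow> ('a, 'b) module \<Rightarrow> ('a, 'c) module \<Rightarrow> ('a, 'd) module \<Rightarrow>
     ('b \<Rightarrow> 'c \<Rightarrow> 'd) \<Rightarrow> bool"
  where "bilinear_map R M N P \<beta> \<longleftrightarrow>
    (\<forall>x\<in>carrier M. \<beta> x \<in> module_hom R N P) \<and>
    (\<forall>y\<in>carrier N. (\<lambda>x. \<beta> x y) \<in> module_hom R M P)"

locale dg_algebra = chain_complex R "dg_complex A"
  for R :: "('a, 'x) ring_scheme" (structure) and A :: "('a, 'b) dg_alg" +
  assumes nonneg: "concentrated_ge 0 (dg_complex A)"
    and mul_bilinear:
      "bilinear_map R (component A i) (component A j) (component A (i + j)) (mul A i j)"
    and mul_assoc:
      "\<lbrakk>a \<in> carrier (component A i); b \<in> carrier (component A j); c \<in> carrier (component A k)\<rbrakk> \<Longrightarrow>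
       mul A (i + j) k (mul A i j a b) c = mul A i (j + k) a (mul A j k b c)"
    and unit_closed: "unit_elt A \<in> carrier (component A 0)"
    and mul_unit_left: "a \<in> carrier (component A i) \<Longrightarrow> mul A 0 i (unit_elt A) a = a"
    and mul_unit_right: "a \<in> carrier (component A i) \<Longrightarrow> mul A i 0 a (unit_elt A) = a"
    and graded_commutative:
      "\<lbrakk>a \<in> carrier (component A i); b \<in> carrier (component A j)\<rbrakk> \<Longrightarrow>
       mul A i j a b = signed (i * j) (component A (i + j)) (mul A j i b a)"
    and odd_square:
      "\<lbrakk>a \<in> carrier (component A i); odd i\<rbrakk> \<Longrightarrow> mul A i i a a = \<zero>\<^bsub>component A (i + i)\<^esub>"
    and leibniz:
      "\<lbrakk>a \<in> carrier (component A i); b \<in> carrier (component A j)\<rbrakk> \<Longrightarrow>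
       bdry A (i + j) (mul A i j a b) =
         mul A (i - 1) j (bdry A i a) b
         \<oplus>\<^bsub>component A (i + j - 1)\<^esub>
         signed i (component A (i + j - 1)) (mul A i (j - 1) a (bdry A j b))"

text \<open>The DG module structure on a complex \<open>U\<close> is given by the action
  \<open>act i j :: A\<^sub>i \<times> U\<^sub>j \<rightarrow> U\<^bsub>i + j\<^esub>\<close>. Bilinearity over \<open>R\<close> and \<open>act_unit\<close> force the action to be
  compatible with the given \<open>R\<close>-module structure of \<open>U\<close>.\<close>

locale dg_module = dg_algebra R A + U: chain_complex R U
  for R :: "('a, 'x) ring_scheme" (structure) and A :: "('a, 'b) dg_alg" and U :: "('a, 'c) chain_complex" +
  fixes act :: "int \<Rightarrow> int \<Rightarrow> 'b \<Rightarrow> 'c \<Rightarrow> 'c"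
  assumes act_bilinear:
      "bilinear_map R (component A i) (component U j) (component U (i + j)) (act i j)"
    and act_assoc:
      "\<lbrakk>a \<in> carrier (component A i); b \<in> carrier (component A j); u \<in> carrier (component U k)\<rbrakk> \<Longrightarrow>
       act (i + j) k (mul A i j a b) u = act i (j + k) a (act j k b u)"
    and act_unit: "u \<in> carrier (component U j) \<Longrightarrow> act 0 j (unit_elt A) u = u"
    and act_leibniz:
      "\<lbrakk>a \<in> carrier (component A i); u \<in> carrier (component U j)\<rbrakk> \<Longrightarrow>
       bdry U (i + j) (act i j a u) =
         act (i - 1) j (bdry A i a) u
         \<oplus>\<^bsub>component U (i + j - 1)\<^esub>
         signed i (component U (i + j - 1)) (act i (j - 1) a (bdry U j u))"

text \<open>A homogeneous basis is a family \<open>E\<close> of sets of elements of degree \<open>i\<close>. Every element of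
  degree \<open>n\<close> is a unique finite sum of terms \<open>c (i, e) \<cdot> e\<close> with \<open>e \<in> E i\<close> and with
  \<open>c (i, e)\<close> in the component of \<open>A\<close> of degree \<open>n - i\<close>.\<close>

definition homogeneous_basis ::
    "('a, 'b) dg_alg \<Rightarrow> ('a, 'c) chain_complex \<Rightarrow> (int \<Rightarrow> int \<Rightarrow> 'b \<Rightarrow> 'c \<Rightarrow> 'c) \<Rightarrow>
     (int \<Rightarrow> 'c set) \<Rightarrow> bool"
  where "homogeneous_basis A U act E \<longleftrightarrow>
    (\<forall>i. E i \<subseteq> carrier (component U i)) \<and>
    (\<forall>n. \<forall>x\<in>carrier (component U n).
      \<exists>!c. c \<in> (\<Pi>\<^sub>E p\<in>Sigma UNIV E. carrier (component A (n - fst p))) \<and>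
        finite {p \<in> Sigma UNIV E. c p \<noteq> \<zero>\<^bsub>component A (n - fst p)\<^esub>} \<and>
        x = (\<Oplus>\<^bsub>component U n\<^esub>p\<in>{p \<in> Sigma UNIV E. c p \<noteq> \<zero>\<^bsub>component A (n - fst p)\<^esub>}.
               act (n - fst p) (fst p) (c p) (snd p)))"

locale semi_free_dg_module = dg_module +
  assumes bounded_below: "\<exists>m. concentrated_ge m U"
    and free: "\<exists>E. homogeneous_basis A U act E"


section \<open>Tensor products of DG modules\<close>

text \<open>The complex of \<open>S\<close>-modules \<open>U \<otimes>\<^sub>A V\<close>, for a DG \<open>A\<close>-module \<open>U\<close> and a complex of
  \<open>S\<close>-modules \<open>V\<close> with an \<open>S\<close>-linear DG \<open>A\<close>-module structure. In degree \<open>n\<close> it is the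
  free abelian group on the symbols \<open>(i, u, v)\<close> (standing for \<open>u \<otimes> v\<close>), where \<open>u\<close> has degree
  \<open>i\<close> and \<open>v\<close> has degree \<open>n - i\<close>, modulo biadditivity and \<open>ua \<otimes> v = u \<otimes> av\<close>; the right action
  on \<open>U\<close> is \<open>ua = (-1)\<^bsup>|a||u|\<^esup> au\<close>.\<close>

definition tensor_symbols ::
    "('a, 'b) chain_complex \<Rightarrow> ('s, 'c) chain_complex \<Rightarrow> int \<Rightarrow> (int \<times> 'b \<times> 'c) set"
  where "tensor_symbols U V n =
    {(i, u, v). u \<in> carrier (component U i) \<and> v \<in> carrier (component V (n - i))}"

inductive_set tensor_relators ::
    "('a, 'd) dg_alg \<Rightarrow>
     ('a, 'b) chain_complex \<Rightarrow> (int \<Rightarrow> int \<Rightarrow> 'd \<Rightarrow> 'b \<Rightarrow> 'b) \<Rightarrow>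
     ('s, 'c) chain_complex \<Rightarrow> (int \<Rightarrow> int \<Rightarrow> 'd \<Rightarrow> 'c \<Rightarrow> 'c) \<Rightarrow>
     int \<Rightarrow> ((int \<times> 'b \<times> 'c) \<Rightarrow>\<^sub>0 int) set"
  for A U actU V actV n
  where
    add_left:
      "\<lbrakk>u \<in> carrier (component U i); u' \<in> carrier (component U i); v \<in> carrier (component V (n - i))\<rbrakk> \<Longrightarrow>
       frag_of (i, u \<oplus>\<^bsub>component U i\<^esub> u', v) - frag_of (i, u, v) - frag_of (i, u', v)
         \<in> tensor_relators A U actU V actV n"
  | add_right:
      "\<lbrakk>u \<in> carrier (component U i); v \<in> carrier (component V (n - i)); v' \<in> carrier (component V (n - i))\<rbrakk> \<Longrightarrow>
       frag_of (i, u, v \<oplus>\<^bsub>component V (n - i)\<^esub> v') - frag_of (i, u, v) - frag_of (i, u, v')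
         \<in> tensor_relators A U actU V actV n"
  | balanced:
      "\<lbrakk>u \<in> carrier (component U i); a \<in> carrier (component A k); v \<in> carrier (component V (n - i - k))\<rbrakk> \<Longrightarrow>
       frag_of (k + i, signed (k * i) (component U (k + i)) (actU k i a u), v)
         - frag_of (i, u, actV k (n - i - k) a v)
         \<in> tensor_relators A U actU V actV n"

definition tensor_relations ::
    "('a, 'd) dg_alg \<Rightarrow>
     ('a, 'b) chain_complex \<Rightarrow> (int \<Rightarrow> int \<Rightarrow> 'd \<Rightarrow> 'b \<Rightarrow> 'b) \<Rightarrow>
     ('s, 'c) chain_complex \<Rightarrow> (int \<Rightarrow> int \<Rightarrow> 'd \<Rightarrow> 'c \<Rightarrow> 'c) \<Rightarrow>
     int \<Rightarrow> ((int \<times> 'b \<times> 'c) \<Rightarrow>\<^sub>0 int) set"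
  where "tensor_relations A U actU V actV n =
    generate (free_Abelian_group (tensor_symbols U V n)) (tensor_relators A U actU V actV n)"

definition tensor_group ::
    "('a, 'd) dg_alg \<Rightarrow>
     ('a, 'b) chain_complex \<Rightarrow> (int \<Rightarrow> int \<Rightarrow> 'd \<Rightarrow> 'b \<Rightarrow> 'b) \<Rightarrow>
     ('s, 'c) chain_complex \<Rightarrow> (int \<Rightarrow> int \<Rightarrow> 'd \<Rightarrow> 'c \<Rightarrow> 'c) \<Rightarrow>
     int \<Rightarrow> ((int \<times> 'b \<times> 'c) \<Rightarrow>\<^sub>0 int) set monoid"
  where "tensor_group A U actU V actV n =
    free_Abelian_group (tensor_symbols U V n) Mod tensor_relations A U actU V actV n"

definition tensor_class ::
    "('a, 'd) dg_alg \<Rightarrow>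
     ('a, 'b) chain_complex \<Rightarrow> (int \<Rightarrow> int \<Rightarrow> 'd \<Rightarrow> 'b \<Rightarrow> 'b) \<Rightarrow>
     ('s, 'c) chain_complex \<Rightarrow> (int \<Rightarrow> int \<Rightarrow> 'd \<Rightarrow> 'c \<Rightarrow> 'c) \<Rightarrow>
     int \<Rightarrow> ((int \<times> 'b \<times> 'c) \<Rightarrow>\<^sub>0 int) \<Rightarrow> ((int \<times> 'b \<times> 'c) \<Rightarrow>\<^sub>0 int) set"
  where "tensor_class A U actU V actV n x =
    tensor_relations A U actU V actV n #>\<^bsub>free_Abelian_group (tensor_symbols U V n)\<^esub> x"

text \<open>The scalar action and the differential are induced on cosets by
  \<open>s (u \<otimes> v) = u \<otimes> sv\<close> and \<open>\<partial>(u \<otimes> v) = \<partial>u \<otimes> v + (-1)\<^bsup>|u|\<^esup> u \<otimes> \<partial>v\<close>;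
  the unions are over the representatives of a coset.\<close>

definition tensor_complex ::
    "('a, 'd) dg_alg \<Rightarrow>
     ('a, 'b) chain_complex \<Rightarrow> (int \<Rightarrow> int \<Rightarrow> 'd \<Rightarrow> 'b \<Rightarrow> 'b) \<Rightarrow>
     ('s, 'c) chain_complex \<Rightarrow> (int \<Rightarrow> int \<Rightarrow> 'd \<Rightarrow> 'c \<Rightarrow> 'c) \<Rightarrow>
     ('s, ((int \<times> 'b \<times> 'c) \<Rightarrow>\<^sub>0 int) set) chain_complex"
  where "tensor_complex A U actU V actV =
    \<lparr>component = (\<lambda>n.
       \<lparr>carrier = carrier (tensor_group A U actU V actV n),
        monoid.mult = undefined, monoid.one = undefined,
        ring.zero = monoid.one (tensor_group A U actU V actV n),
        ring.add = monoid.mult (tensor_group A U actU V actV n),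
        smult = (\<lambda>s Y. \<Union>x\<in>Y. tensor_class A U actU V actV n
          (frag_extend (\<lambda>(i, u, v). frag_of (i, u, s \<odot>\<^bsub>component V (n - i)\<^esub> v)) x))\<rparr>),
     bdry = (\<lambda>n Y. \<Union>x\<in>Y. tensor_class A U actU V actV (n - 1)
       (frag_extend (\<lambda>(i, u, v).
          frag_of (i - 1, bdry U i u, v)
          + frag_cmul (if even i then 1 else -1) (frag_of (i, u, bdry V (n - i) v))) x))\<rparr>"


section \<open>The Tate construction\<close>

text \<open>For \<open>n \<ge> 0\<close> the component of degree \<open>n\<close> of \<open>Q\<langle>y, t | \<partial>y = f, \<partial>t = gy\<rangle>\<close> is free on a
  single basis element, \<open>t\<^bsup>(i)\<^esup>\<close> if \<open>n = 2i\<close> and \<open>yt\<^bsup>(i)\<^esup>\<close> if \<open>n = 2i + 1\<close>. An element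
  of degree \<open>n\<close> is represented by its coefficient in \<open>Q\<close> with respect to that basis element.
  In all products of basis elements that are not zero because of \<open>y\<^sup>2 = 0\<close>, the coefficient is
  \<open>(i + j)! / (i! j!)\<close>, that is \<open>i + j choose i\<close>.\<close>

definition tate_comp :: "('a, 'x) ring_scheme \<Rightarrow> int \<Rightarrow> ('a, 'a) module"
  where "tate_comp Q n =
    \<lparr>carrier = (if n \<ge> 0 then carrier Q else {\<zero>\<^bsub>Q\<^esub>}),
     monoid.mult = monoid.mult Q, monoid.one = monoid.one Q, ring.zero = ring.zero Q,
     ring.add = ring.add Q, smult = monoid.mult Q\<rparr>"

definition tate_bdry :: "('a, 'x) ring_scheme \<Rightarrow> 'a \<Rightarrow> 'a \<Rightarrow> int \<Rightarrow> 'a \<Rightarrow> 'a"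
  where "tate_bdry Q f g n q =
    (if n \<le> 0 then \<zero>\<^bsub>Q\<^esub> else if even n then q \<otimes>\<^bsub>Q\<^esub> g else q \<otimes>\<^bsub>Q\<^esub> f)"

definition tate_mul :: "('a, 'x) ring_scheme \<Rightarrow> int \<Rightarrow> int \<Rightarrow> 'a \<Rightarrow> 'a \<Rightarrow> 'a"
  where "tate_mul Q m n q r =
    (if m < 0 \<or> n < 0 \<or> (odd m \<and> odd n) then \<zero>\<^bsub>Q\<^esub>
     else add_pow Q ((nat (m div 2) + nat (n div 2)) choose nat (m div 2)) (q \<otimes>\<^bsub>Q\<^esub> r))"

definition tate :: "('a, 'x) ring_scheme \<Rightarrow> 'a \<Rightarrow> 'a \<Rightarrow> ('a, 'a) dg_alg"
  where "tate Q f g =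
    \<lparr>component = tate_comp Q, bdry = tate_bdry Q f g, mul = tate_mul Q, unit_elt = \<one>\<^bsub>Q\<^esub>\<rparr>"

context cring begin

lemma tate_comp_simps [simp]:
  "carrier (tate_comp R n) = (if n \<ge> 0 then carrier R else {\<zero>})"
  "monoid.mult (tate_comp R n) = (\<otimes>)"
  "ring.zero (tate_comp R n) = \<zero>"
  "ring.add (tate_comp R n) = (\<oplus>)"
  "smult (tate_comp R n) = (\<otimes>)"
  by (simp_all add: tate_comp_def)

lemma tate_simps [simp]:
  "component (tate R f g) = tate_comp R" "bdry (tate R f g) = tate_bdry R f g"
  "mul (tate R f g) = tate_mul R" "unit_elt (tate R f g) = \<one>"
  by (simp_all add: tate_def)

lemma tate_module: "module R (tate_comp R n)"
proof (rule moduleI)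
  show "cring R" by (rule is_cring)
  show "abelian_group (tate_comp R n)"
  proof (rule abelian_groupI)
    fix x assume "x \<in> carrier (tate_comp R n)"
    then show "\<exists>y\<in>carrier (tate_comp R n). y \<oplus>\<^bsub>tate_comp R n\<^esub> x = \<zero>\<^bsub>tate_comp R n\<^esub>"
      by (intro bexI[of _ "\<ominus> x"]) (auto simp: l_neg split: if_splits)
  next
    fix x y assume "x \<in> carrier (tate_comp R n)" "y \<in> carrier (tate_comp R n)"
    then show "x \<oplus>\<^bsub>tate_comp R n\<^esub> y = y \<oplus>\<^bsub>tate_comp R n\<^esub> x"
      using a_comm[of x y] by (simp split: if_splits)
  qed (auto simp: a_assoc split: if_splits)
qed (auto simp: l_distr r_distr m_assoc split: if_splits)

lemma tate_minus:
  assumes x: "x \<in> carrier (tate_comp R n)"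
  shows "\<ominus>\<^bsub>tate_comp R n\<^esub> x = \<ominus> x"
proof -
  interpret T: module R "tate_comp R n" by (rule tate_module)
  have "x \<in> carrier R" "\<ominus>\<^bsub>tate_comp R n\<^esub> x \<in> carrier R"
    using x T.a_inv_closed[OF x] by (simp_all split: if_splits)
  moreover have "\<ominus>\<^bsub>tate_comp R n\<^esub> x \<oplus> x = \<zero>" using T.l_neg[OF x] by simp
  ultimately show ?thesis by (simp add: minus_equality)
qed

lemma tate_mul_assoc:
  assumes "a \<in> carrier R" "b \<in> carrier R" "c \<in> carrier R"  "i \<ge> 0" "j \<ge> 0" "k \<ge> 0"
  shows "tate_mul R (i + j) k (tate_mul R i j a b) c = tate_mul R i (j + k) a (tate_mul R j k b c)"
proof (cases "(odd i \<and> odd j) \<or> (odd i \<and> odd k) \<or> (odd j \<and> odd k)")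
  case True
  then show ?thesis using assms by (elim disjE conjE) (simp_all add: tate_mul_def)
next
  case False
  define x y z where d: "x = nat (i div 2)" "y = nat (j div 2)" "z = nat (k div 2)"
  have 1: "nat ((i+j) div 2) = x + y" "nat ((j+k) div 2) = y + z"
  proof -
    have "(i+j) div 2 = i div 2 + j div 2" "(j+k) div 2 = j div 2 + k div 2"
      using False by presburger+
    then show "nat ((i+j) div 2) = x + y" "nat ((j+k) div 2) = y + z"
      unfolding d using assms(4-6) by (simp_all add: nat_add_distrib)
  qed
  have 2: "(x + y + z choose (x+y)) * (x + y choose x) = (x + (y + z) choose x) * (y + z choose y)"
    using choose_mult[of x "x+y" "x+y+z"] by (simp add: add.assoc)
  have z: "\<not> (i < 0 \<or> j < 0 \<or> (odd i \<and> odd j))" "\<not> (j < 0 \<or> k < 0 \<or> (odd j \<and> odd k))"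
    "\<not> (i + j < 0 \<or> k < 0 \<or> (odd (i + j) \<and> odd k))"
    "\<not> (i < 0 \<or> j + k < 0 \<or> (odd i \<and> odd (j + k)))"
    using False assms(4-6) by auto
  have "tate_mul R (i + j) k (tate_mul R i j a b) c
      = add_pow R ((x + y + z choose (x + y)) * (x + y choose x)) (a \<otimes> b \<otimes> c)"
    unfolding tate_mul_def if_not_P[OF z(1)] if_not_P[OF z(3)] 1 d[symmetric]
    using assms(1-3) by (simp add: add_pow_ldistr add.nat_pow_pow mult.commute)
  also have "\<dots> = tate_mul R i (j + k) a (tate_mul R j k b c)"
    unfolding tate_mul_def if_not_P[OF z(2)] if_not_P[OF z(4)] 1 d[symmetric] 2
    using assms(1-3) by (simp add: add_pow_rdistr add.nat_pow_pow m_assoc mult.commute)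
  finally show ?thesis .
qed

lemma tate_mul_closed: "a \<in> carrier R \<Longrightarrow> b \<in> carrier R \<Longrightarrow> tate_mul R i j a b \<in> carrier R"
  by (simp add: tate_mul_def)

lemma tate_mul_zero: "a \<in> carrier R \<Longrightarrow> tate_mul R i j a \<zero> = \<zero>"
  "a \<in> carrier R \<Longrightarrow> tate_mul R i j \<zero> a = \<zero>"
  by (simp_all add: tate_mul_def)

lemma tate_leibniz:
  assumes [simp]: "a \<in> carrier R" "b \<in> carrier R" "f \<in> carrier R" "g \<in> carrier R"
    and ij: "i \<ge> 0" "j \<ge> 0"
  shows "tate_bdry R f g (i+j) (tate_mul R i j a b) =
    tate_mul R (i-1) j (tate_bdry R f g i a) b \<oplus>
    (if even i then tate_mul R i (j-1) a (tate_bdry R f g j b)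
     else \<ominus> (tate_mul R i (j-1) a (tate_bdry R f g j b)))"
proof -
  obtain p q where pq: "i = 2 * int p \<or> i = 2 * int p + 1" "j = 2 * int q \<or> j = 2 * int q + 1"
  proof
    show "i = 2 * int (nat (i div 2)) \<or> i = 2 * int (nat (i div 2)) + 1" using ij by (simp, presburger)
    show "j = 2 * int (nat (j div 2)) \<or> j = 2 * int (nat (j div 2)) + 1" using ij by (simp, presburger)
  qed
  have m: "a \<otimes> g \<otimes> b = a \<otimes> b \<otimes> g" "a \<otimes> f \<otimes> b = a \<otimes> b \<otimes> f" "a \<otimes> (b \<otimes> f) = a \<otimes> b \<otimes> f"
    "a \<otimes> (b \<otimes> g) = a \<otimes> b \<otimes> g"
    by (simp_all add: m_ac)
  consider (ee) "i = 2 * int p" "j = 2 * int q"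
   | (oe) "i = 2 * int p + 1" "j = 2 * int q"
   | (eo) "i = 2 * int p" "j = 2 * int q + 1"
   | (oo) "i = 2 * int p + 1" "j = 2 * int q + 1" using pq by blast
  then show ?thesis
  proof cases
    case ee
    have d: "nat ((2 * int r - 1) div 2) = r - 1" for r by (cases r) auto
    show ?thesis
    proof (cases p)
      case 0 then show ?thesis using ee by (cases q) (auto simp: tate_mul_def tate_bdry_def m)
    next
      case (Suc p')
      show ?thesis
      proof (cases q)
        case 0 then show ?thesis using ee Suc by (auto simp: tate_mul_def tate_bdry_def m)
      next
        case (Suc q')
        have i: "nat (i div 2) = Suc p'" "nat ((i - 1) div 2) = p'" "i > 0" "even i"
          using ee \<open>p = Suc p'\<close> by auto
        have j: "nat (j div 2) = Suc q'" "nat ((j - 1) div 2) = q'" "j > 0" "even j"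
          using ee Suc by auto
        have "add_pow R (Suc p' + Suc q' choose Suc p') (a \<otimes> b \<otimes> g)
            = add_pow R (p' + Suc q' choose p') (a \<otimes> b \<otimes> g)
              \<oplus> add_pow R (Suc p' + q' choose Suc p') (a \<otimes> b \<otimes> g)"
          by (subst add.nat_pow_mult) simp_all
        moreover have "\<not> i + j \<le> 0" "even (i + j)" "\<not> i \<le> 0" "\<not> j \<le> 0"
          "\<not> (i < 0 \<or> j < 0 \<or> (odd i \<and> odd j))"
          "\<not> (i - 1 < 0 \<or> j < 0 \<or> (odd (i - 1) \<and> odd j))"
          "\<not> (i < 0 \<or> j - 1 < 0 \<or> (odd i \<and> odd (j - 1)))"
          using i(3,4) j(3,4) by auto
        ultimately show ?thesis
          using i(4) j(4) assms(1-4)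
          by (simp only: tate_mul_def tate_bdry_def i(1,2) j(1,2) if_True if_False
              add_pow_ldistr add_pow_rdistr m m_closed simp_thms)
      qed
    qed
  next
    case oe then show ?thesis by (auto simp: tate_mul_def tate_bdry_def m add_pow_ldistr)
  next
    case eo then show ?thesis by (auto simp: tate_mul_def tate_bdry_def m add_pow_ldistr)
  next
    case oo then show ?thesis by (auto simp: tate_mul_def tate_bdry_def m r_neg)
  qed
qed

lemma tate_dg_algebra:
  assumes "f \<in> carrier R" "g \<in> carrier R" "f \<otimes> g = \<zero>"
  shows "dg_algebra R (tate R f g)"
proof -
  have gf: "g \<otimes> f = \<zero>" using assms m_comm by simp
  have cc: "chain_complex R (dg_complex (tate R f g))"
    apply (intro chain_complex.intro chain_complex_axioms.intro is_cring)
      apply (simp add: dg_complex_def tate_module)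
    using assms gf
     apply (auto simp: dg_complex_def tate_bdry_def module_hom_def l_distr m_assoc split: if_splits)
    done
  show ?thesis
  proof (intro dg_algebra.intro cc dg_algebra_axioms.intro)
    show "concentrated_ge 0 (dg_complex (tate R f g))"
      by (auto simp: concentrated_ge_def dg_complex_def)
  next
    fix i j show "bilinear_map R (component (tate R f g) i) (component (tate R f g) j)
        (component (tate R f g) (i + j)) (mul (tate R f g) i j)"
      apply (auto simp: bilinear_map_def module_hom_def tate_mul_def l_distr r_distr
          add.nat_pow_distrib add_pow_rdistr add_pow_ldistr m_assoc split: if_splits)
      by (metis m_lcomm)+
  next
    fix a b c i j k
    assume "a \<in> carrier (component (tate R f g) i)" "b \<in> carrier (component (tate R f g) j)"
      "c \<in> carrier (component (tate R f g) k)"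
    then show "mul (tate R f g) (i + j) k (mul (tate R f g) i j a b) c =
       mul (tate R f g) i (j + k) a (mul (tate R f g) j k b c)"
      using tate_mul_assoc[of a b c i j k]
      by (auto simp: tate_mul_zero tate_mul_closed split: if_splits)
  next
    fix a i assume "a \<in> carrier (component (tate R f g) i)"
    then show "mul (tate R f g) 0 i (unit_elt (tate R f g)) a = a"
      by (auto simp: tate_mul_def split: if_splits)
  next
    fix a i assume "a \<in> carrier (component (tate R f g) i)"
    then show "mul (tate R f g) i 0 a (unit_elt (tate R f g)) = a"
      by (auto simp: tate_mul_def split: if_splits)
  next
    fix a b i j
    assume ab: "a \<in> carrier (component (tate R f g) i)" "b \<in> carrier (component (tate R f g) j)"
    have "nat (i div 2) + nat (j div 2) choose nat (i div 2) = nat (j div 2) + nat (i div 2) choose nat (j div 2)"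
      using binomial_symmetric[of "nat (i div 2)" "nat (i div 2) + nat (j div 2)"] by (simp add: add.commute)
    then have m: "mul (tate R f g) i j a b = mul (tate R f g) j i b a"
    proof (cases "i < 0 \<or> j < 0")
      case True then show ?thesis by (auto simp: tate_mul_def)
    next
      case False
      then have "a \<otimes> b = b \<otimes> a" using ab m_comm by simp
      then show ?thesis using \<open>nat (i div 2) + _ choose _ = _\<close> False
        by (simp only: tate_simps tate_mul_def conj_commute[of "odd i"] disj_left_commute[of "i < 0"])
    qed
    have z: "odd (i*j) \<Longrightarrow> mul (tate R f g) j i b a = \<zero>"
      by (simp add: tate_mul_def)
    show "mul (tate R f g) i j a b = signed (i * j) (component (tate R f g) (i + j)) (mul (tate R f g) j i b a)"
      using m z by (auto simp: signed_def tate_minus)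
  next
    fix a i assume "a \<in> carrier (component (tate R f g) i)" "odd i"
    then show "mul (tate R f g) i i a a = \<zero>\<^bsub>component (tate R f g) (i + i)\<^esub>"
      by (simp add: tate_mul_def)
  next
    fix a b i j
    assume ab: "a \<in> carrier (component (tate R f g) i)" "b \<in> carrier (component (tate R f g) j)"
    have S: "signed i (component (tate R f g) (i + j - 1)) x = (if even i then x else \<ominus> x)"
      if "x \<in> carrier (tate_comp R (i+j-1))" for x using that tate_minus by (simp add: signed_def)
    have in1: "tate_mul R i (j-1) a (tate_bdry R f g j b) \<in> carrier (tate_comp R (i+j-1))"
      using ab assms by (auto simp: tate_mul_def tate_bdry_def split: if_splits)
    show "bdry (tate R f g) (i + j) (mul (tate R f g) i j a b) =
         mul (tate R f g) (i - 1) j (bdry (tate R f g) i a) b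
         \<oplus>\<^bsub>component (tate R f g) (i + j - 1)\<^esub>
         signed i (component (tate R f g) (i + j - 1)) (mul (tate R f g) i (j - 1) a (bdry (tate R f g) j b))"
    proof (cases "i \<ge> 0 \<and> j \<ge> 0")
      case True
      then show ?thesis using S[OF in1] tate_leibniz[of a b f g i j] ab assms by simp
    next
      case False
      then have "tate_mul R i j a b = \<zero>" "tate_mul R (i-1) j (tate_bdry R f g i a) b = \<zero>"
         "tate_mul R i (j-1) a (tate_bdry R f g j b) = \<zero>" by (auto simp: tate_mul_def)
      then show ?thesis using S[OF in1] assms by (simp add: tate_bdry_def)
    qed
  qed (simp)
qed

end

definition ring_complex :: "('a, 'x) ring_scheme \<Rightarrow> ('a, 'a) chain_complex"
  where "ring_complex R =
    \<lparr>component = (\<lambda>n.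
       \<lparr>carrier = (if n = 0 then carrier R else {\<zero>\<^bsub>R\<^esub>}),
        monoid.mult = monoid.mult R, monoid.one = monoid.one R, ring.zero = ring.zero R,
        ring.add = ring.add R, smult = monoid.mult R\<rparr>),
     bdry = (\<lambda>n r. \<zero>\<^bsub>R\<^esub>)\<rparr>"

text \<open>The augmentation from the Tate construction to \<open>Q/(f)\<close>, and the resulting action on
  \<^term>\<open>ring_complex (Q Quot (PIdl\<^bsub>Q\<^esub> f))\<close>.\<close>

definition tate_augmentation ::
    "('a, 'x) ring_scheme \<Rightarrow> 'a \<Rightarrow> int \<Rightarrow> 'a \<Rightarrow> 'a set"
  where "tate_augmentation Q f k a =
    (if k = 0 then PIdl\<^bsub>Q\<^esub> f +>\<^bsub>Q\<^esub> a else \<zero>\<^bsub>Q Quot (PIdl\<^bsub>Q\<^esub> f)\<^esub>)"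

definition augmentation_act ::
    "('a, 'x) ring_scheme \<Rightarrow> 'a \<Rightarrow> int \<Rightarrow> int \<Rightarrow> 'a \<Rightarrow> 'a set \<Rightarrow> 'a set"
  where "augmentation_act Q f k j a r =
    tate_augmentation Q f k a \<otimes>\<^bsub>Q Quot (PIdl\<^bsub>Q\<^esub> f)\<^esub> r"

end

theory Submission
  imports Defs
begin

text \<open>The structure is built on the resolution \<open>U\<close> itself, one degree at a time. Suppose sets
  \<open>E i\<close> of basis elements are chosen in the degrees below \<open>n\<close>, together with a \<open>Q\<close>-basis of each of
  these \<open>U\<^sub>j\<close> whose elements play the role of \<open>t\<^bsup>(k)\<^esup> e\<close> and \<open>y t\<^bsup>(k)\<^esup> e\<close>. The Leibniz rule prescribes
  the boundaries of the products of degree \<open>n\<close> with \<open>e\<close> of degree below \<open>n\<close>. The prescribed elements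
  are cycles, and since \<open>U\<close> is exact and \<open>f M = 0\<close> they can be lifted to \<open>U\<^sub>n\<close>. Because \<open>U\<close> is minimal and \<open>f\<close>, \<open>g\<close>
  are not in \<open>\<nn>\<^sup>2\<close>, the lifts are linearly independent modulo \<open>\<nn>\<close>, so they are part of a basis of
  \<open>U\<^sub>n\<close>, and the rest of that basis is taken as \<open>E n\<close>.

  For the second part, let \<open>J\<close> be the kernel of the augmentation from the Tate construction to
  \<open>R = Q/(f)\<close>. The conditions on the annihilators say that \<open>J\<close> is acyclic, hence so is \<open>J U\<close>, by
  filtering with the degree in a semi-free basis. Therefore \<open>U\<close> and \<open>U \<otimes>\<^sub>A R = U / J U\<close> have the same
  homology.\<close>

section \<open>Linear combinations and finite free bases\<close>

text \<open>Divided powers cannot be recovered from t by division, so all elements t^(k) e and y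
  t^(k) e are chosen separately, and the action is then defined by the multiplication table of the
  Tate construction in the coordinates of these bases. Associativity and the unit law are thereby
  inherited from the Tate construction. The one law with content is the Leibniz rule, and it follows
  for all products once it holds for those with the generators e, where it is an equation for the
  boundary of a single new vector.

  The second part concerns an arbitrary semi-free structure, not the constructed one. Such a
  structure is therefore put into the same coordinates: the products of the Tate basis elements with
  a homogeneous basis serve as bases of the U_n, and the finite rank of the U_n makes them finite.
  The tensor product is given by symbols and relators, which do not show that an element is nonzero.
  This needs a homomorphism out of the free abelian group that kills every relator; the one used
  reads a coordinate at a generator modulo f.\<close>

definition lincomb :: "('a, 'b, 'd) module_scheme \<Rightarrow> ('i \<Rightarrow> 'b) \<Rightarrow> 'i set \<Rightarrow> ('i \<Rightarrow> 'a) \<Rightarrow> 'b"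
  where "lincomb M b I c = (\<Oplus>\<^bsub>M\<^esub>i\<in>I. c i \<odot>\<^bsub>M\<^esub> b i)"

text \<open>Indexed families rather than sets: the index has to remember the generator from which a
  basis element arises, and this label is what links the bases of different degrees. Coefficients
  are unrestricted off \<open>I\<close>, so uniqueness takes the form of linear
  independence.\<close>

definition free_basis :: "('a, 'x) ring_scheme \<Rightarrow> ('a, 'b, 'd) module_scheme \<Rightarrow> ('i \<Rightarrow> 'b) \<Rightarrow> 'i set \<Rightarrow> bool"
  where "free_basis R M b I \<longleftrightarrow> finite I \<and> b \<in> I \<rightarrow> carrier M \<and>
    (\<forall>x\<in>carrier M. \<exists>c\<in>I \<rightarrow> carrier R. x = lincomb M b I c) \<and>
    (\<forall>c\<in>I \<rightarrow> carrier R. lincomb M b I c = \<zero>\<^bsub>M\<^esub> \<longrightarrow> (\<forall>i\<in>I. c i = \<zero>\<^bsub>R\<^esub>))"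

text \<open>The value zero off \<open>I\<close> allows coordinate identities between different
  degrees, whose index sets differ, to be stated at every index.\<close>

definition coord :: "('a, 'x) ring_scheme \<Rightarrow> ('a, 'b, 'd) module_scheme \<Rightarrow> ('i \<Rightarrow> 'b) \<Rightarrow> 'i set \<Rightarrow> 'b \<Rightarrow> 'i \<Rightarrow> 'a"
  where "coord R M b I x i =
    (if i \<in> I then (SOME c. c \<in> I \<rightarrow> carrier R \<and> x = lincomb M b I c) i else \<zero>\<^bsub>R\<^esub>)"

context module
begin

lemma lincomb_closed [intro, simp]:
  "\<lbrakk>b \<in> I \<rightarrow> carrier M; c \<in> I \<rightarrow> carrier R\<rbrakk> \<Longrightarrow> lincomb M b I c \<in> carrier M"
  unfolding lincomb_def by (rule M.finsum_closed) (auto simp: Pi_iff)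

lemma lincomb_cong:
  assumes "b \<in> I \<rightarrow> carrier M" "c \<in> I \<rightarrow> carrier R"
    and "\<And>i. i \<in> I \<Longrightarrow> c i = c' i" "\<And>i. i \<in> I \<Longrightarrow> b i = b' i"
  shows "lincomb M b I c = lincomb M b' I c'"
proof -
  have "(\<lambda>i. c' i \<odot>\<^bsub>M\<^esub> b' i) \<in> I \<rightarrow> carrier M"
    using assms by (metis (mono_tags, lifting) Pi_I Pi_mem smult_closed)
  then show ?thesis
    unfolding lincomb_def using assms by (intro M.finsum_cong') auto
qed

lemma lincomb_add:
  "\<lbrakk>b \<in> I \<rightarrow> carrier M; c \<in> I \<rightarrow> carrier R; d \<in> I \<rightarrow> carrier R\<rbrakk> \<Longrightarrow>
   lincomb M b I (\<lambda>i. c i \<oplus> d i) = lincomb M b I c \<oplus>\<^bsub>M\<^esub> lincomb M b I d"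
  unfolding lincomb_def
  by (rule trans[OF M.finsum_cong'[OF refl] M.finsum_addf]) (auto simp: Pi_iff smult_l_distr)

lemma lincomb_smult:
  "\<lbrakk>finite I; b \<in> I \<rightarrow> carrier M; c \<in> I \<rightarrow> carrier R; r \<in> carrier R\<rbrakk> \<Longrightarrow>
   lincomb M b I (\<lambda>i. r \<otimes> c i) = r \<odot>\<^bsub>M\<^esub> lincomb M b I c"
  unfolding lincomb_def
  by (subst finsum_smult_ldistr) (auto simp: Pi_iff smult_assoc1 intro!: M.finsum_cong')

lemma lincomb_empty [simp]: "lincomb M b {} c = \<zero>\<^bsub>M\<^esub>"
  by (simp add: lincomb_def)

lemma lincomb_insert:
  "\<lbrakk>finite I; i \<notin> I; b \<in> insert i I \<rightarrow> carrier M; c \<in> insert i I \<rightarrow> carrier R\<rbrakk> \<Longrightarrow>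
   lincomb M b (insert i I) c = c i \<odot>\<^bsub>M\<^esub> b i \<oplus>\<^bsub>M\<^esub> lincomb M b I c"
  unfolding lincomb_def by (subst M.finsum_insert) (auto simp: Pi_iff)

lemma lincomb_zero:
  "\<lbrakk>b \<in> I \<rightarrow> carrier M; \<And>i. i \<in> I \<Longrightarrow> c i = \<zero>\<rbrakk> \<Longrightarrow> lincomb M b I c = \<zero>\<^bsub>M\<^esub>"
  unfolding lincomb_def by (rule M.add.finprod_one_eqI) (auto simp: Pi_iff)

lemma lincomb_mono_neutral:
  assumes "finite I" "J \<subseteq> I" "b \<in> I \<rightarrow> carrier M" "c \<in> I \<rightarrow> carrier R"
    and "\<And>i. i \<in> I - J \<Longrightarrow> c i = \<zero>"
  shows "lincomb M b J c = lincomb M b I c"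
  unfolding lincomb_def using assms
  by (intro M.add.finprod_mono_neutral_cong_left) (auto simp: Pi_iff)

lemma lincomb_single:
  assumes "finite I" "i \<in> I" "b \<in> I \<rightarrow> carrier M" "r \<in> carrier R"
  shows "lincomb M b I (\<lambda>j. if j = i then r else \<zero>) = r \<odot>\<^bsub>M\<^esub> b i"
proof -
  have "lincomb M b {i} (\<lambda>j. if j = i then r else \<zero>) = lincomb M b I (\<lambda>j. if j = i then r else \<zero>)"
    using assms by (intro lincomb_mono_neutral) auto
  moreover have "lincomb M b {i} (\<lambda>j. if j = i then r else \<zero>) = r \<odot>\<^bsub>M\<^esub> b i"
    using assms by (subst lincomb_insert) (auto simp: Pi_iff)
  ultimately show ?thesis by simp
qed

lemma lincomb_induct:
  assumes "finite I" "b \<in> I \<rightarrow> carrier M" "c \<in> I \<rightarrow> carrier R"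
    and "P \<zero>\<^bsub>M\<^esub>"
    and "\<And>x y. \<lbrakk>x \<in> carrier M; y \<in> carrier M; P x; P y\<rbrakk> \<Longrightarrow> P (x \<oplus>\<^bsub>M\<^esub> y)"
    and "\<And>i. i \<in> I \<Longrightarrow> P (c i \<odot>\<^bsub>M\<^esub> b i)"
  shows "P (lincomb M b I c)"
  using assms(1,2,3,6)
proof (induction I rule: finite_induct)
  case empty
  then show ?case using assms(4) by simp
next
  case (insert i I)
  have "lincomb M b (insert i I) c = c i \<odot>\<^bsub>M\<^esub> b i \<oplus>\<^bsub>M\<^esub> lincomb M b I c"
    using insert by (intro lincomb_insert) auto
  moreover have "P (lincomb M b I c)" using insert by auto
  moreover have "b \<in> I \<rightarrow> carrier M" "c \<in> I \<rightarrow> carrier R" using insert by auto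
  ultimately show ?case using assms(5) insert by (auto simp: Pi_iff)
qed

context
  fixes b :: "'i \<Rightarrow> 'c" and I :: "'i set"
  assumes fb: "free_basis R M b I"
begin

lemma free_basis_finite: "finite I"
  and free_basis_closed: "b \<in> I \<rightarrow> carrier M"
  using fb by (auto simp: free_basis_def)

lemma free_basis_elt: "i \<in> I \<Longrightarrow> b i \<in> carrier M"
  using free_basis_closed by auto

lemma free_basis_inj:
  assumes "c \<in> I \<rightarrow> carrier R" "d \<in> I \<rightarrow> carrier R" "lincomb M b I c = lincomb M b I d" "i \<in> I"
  shows "c i = d i"
proof -
  have m: "(\<lambda>i. \<ominus> \<one> \<otimes> d i) \<in> I \<rightarrow> carrier R" using assms by (auto simp: Pi_iff)
  have "lincomb M b I (\<lambda>i. c i \<oplus> \<ominus> \<one> \<otimes> d i) = lincomb M b I c \<oplus>\<^bsub>M\<^esub> \<ominus> \<one> \<odot>\<^bsub>M\<^esub> lincomb M b I d"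
    using assms m free_basis_closed free_basis_finite
    by (subst lincomb_add) (auto simp: lincomb_smult)
  also have "\<dots> = \<zero>\<^bsub>M\<^esub>"
    using assms free_basis_closed by (simp add: smult_l_minus M.r_neg)
  finally have "c i \<oplus> \<ominus> \<one> \<otimes> d i = \<zero>"
    using fb assms m unfolding free_basis_def by (auto simp: Pi_iff)
  moreover have "c i \<in> carrier R" "d i \<in> carrier R" using assms by auto
  ultimately show ?thesis by (simp add: l_minus minus_equality R.minus_unique) (metis R.minus_equality R.minus_minus R.a_inv_closed R.add.m_comm)
qed

lemma coord_props:
  assumes "x \<in> carrier M"
  shows coord_closed: "coord R M b I x i \<in> carrier R"
    and lincomb_coord: "lincomb M b I (coord R M b I x) = x"
proof -
  define c where "c = (SOME c. c \<in> I \<rightarrow> carrier R \<and> x = lincomb M b I c)"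
  have "\<exists>c. c \<in> I \<rightarrow> carrier R \<and> x = lincomb M b I c"
    using fb assms unfolding free_basis_def by blast
  then have c: "c \<in> I \<rightarrow> carrier R \<and> x = lincomb M b I c"
    unfolding c_def by (rule someI_ex)
  have co: "coord R M b I x i = (if i \<in> I then c i else \<zero>)" for i
    by (simp add: coord_def c_def)
  show "coord R M b I x i \<in> carrier R" using conjunct1[OF c] unfolding co by auto
  have "lincomb M b I (coord R M b I x) = lincomb M b I c"
    using free_basis_closed conjunct1[OF c] by (intro lincomb_cong) (auto simp: co)
  then show "lincomb M b I (coord R M b I x) = x" using c by simp
qed

lemma coord_outside [simp]: "i \<notin> I \<Longrightarrow> coord R M b I x i = \<zero>"
  by (simp add: coord_def)

lemma coord_lincomb:
  assumes "c \<in> I \<rightarrow> carrier R"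
  shows "coord R M b I (lincomb M b I c) i = (if i \<in> I then c i else \<zero>)"
proof (cases "i \<in> I")
  case True
  have x: "lincomb M b I c \<in> carrier M" using assms free_basis_closed by auto
  then show ?thesis
    using free_basis_inj[OF _ assms lincomb_coord[OF x] True] coord_closed[OF x] True by auto
qed simp

lemma coord_eqI:
  assumes "x \<in> carrier M" "y \<in> carrier M" "\<And>i. i \<in> I \<Longrightarrow> coord R M b I x i = coord R M b I y i"
  shows "x = y"
proof -
  have "lincomb M b I (coord R M b I x) = lincomb M b I (coord R M b I y)"
    using assms free_basis_closed coord_closed[of x] by (intro lincomb_cong) auto
  then show ?thesis using assms lincomb_coord by simp
qed

lemma coord_add:
  assumes "x \<in> carrier M" "y \<in> carrier M"
  shows "coord R M b I (x \<oplus>\<^bsub>M\<^esub> y) i = coord R M b I x i \<oplus> coord R M b I y i"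
proof -
  have "x \<oplus>\<^bsub>M\<^esub> y = lincomb M b I (\<lambda>i. coord R M b I x i \<oplus> coord R M b I y i)"
    using assms free_basis_closed coord_closed by (simp add: lincomb_add lincomb_coord)
  then show ?thesis using assms coord_closed by (simp add: coord_lincomb)
qed

lemma coord_smult:
  assumes "x \<in> carrier M" "r \<in> carrier R"
  shows "coord R M b I (r \<odot>\<^bsub>M\<^esub> x) i = r \<otimes> coord R M b I x i"
proof -
  have "r \<odot>\<^bsub>M\<^esub> x = lincomb M b I (\<lambda>i. r \<otimes> coord R M b I x i)"
    using assms free_basis_closed free_basis_finite coord_closed by (simp add: lincomb_smult lincomb_coord)
  then show ?thesis using assms coord_closed by (simp add: coord_lincomb)
qed

lemma coord_zero [simp]: "coord R M b I \<zero>\<^bsub>M\<^esub> i = \<zero>"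
  using coord_smult[of "\<zero>\<^bsub>M\<^esub>" \<zero>] coord_closed by simp

lemma coord_minus:
  assumes "x \<in> carrier M"
  shows "coord R M b I (\<ominus>\<^bsub>M\<^esub> x) i = \<ominus> coord R M b I x i"
  using coord_smult[OF assms, of "\<ominus> \<one>" i] assms coord_closed[OF assms] by (simp add: smult_l_minus l_minus)

lemma coord_basis:
  assumes "j \<in> I"
  shows "coord R M b I (b j) i = (if i = j then \<one> else \<zero>)"
proof -
  have "b j = lincomb M b I (\<lambda>i. if i = j then \<one> else \<zero>)"
    using assms free_basis_finite free_basis_closed free_basis_elt by (simp add: lincomb_single)
  then have "coord R M b I (b j) i = coord R M b I (lincomb M b I (\<lambda>i. if i = j then \<one> else \<zero>)) i"
    by simp
  then show ?thesis using assms by (subst (asm) coord_lincomb) auto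
qed

text \<open>The last case speaks of the coordinates of the given \<open>x\<close>, not of arbitrary
  scalars. Conditions on these coordinates, such as membership in an ideal, are therefore available
  in the induction.\<close>

lemma free_basis_induct:
  assumes "x \<in> carrier M" "P \<zero>\<^bsub>M\<^esub>"
    and "\<And>x y. \<lbrakk>x \<in> carrier M; y \<in> carrier M; P x; P y\<rbrakk> \<Longrightarrow> P (x \<oplus>\<^bsub>M\<^esub> y)"
    and "\<And>i. i \<in> I \<Longrightarrow> P (coord R M b I x i \<odot>\<^bsub>M\<^esub> b i)"
  shows "P x"
proof -
  have "P (lincomb M b I (coord R M b I x))"
    by (rule lincomb_induct[where P = P])
      (use assms(2-4) free_basis_finite free_basis_closed coord_closed[OF assms(1)] in \<open>blast+\<close>)
  then show ?thesis using assms by (simp add: lincomb_coord)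
qed

end

lemma coord_finsum:
  assumes fb: "free_basis R M b I" and "finite K" "x \<in> K \<rightarrow> carrier M"
  shows "coord R M b I (\<Oplus>\<^bsub>M\<^esub>k\<in>K. x k) i = (\<Oplus>k\<in>K. coord R M b I (x k) i)"
  using assms(2,3)
proof (induction K rule: finite_induct)
  case empty
  then show ?case using coord_zero[OF fb] by simp
next
  case (insert k K)
  then show ?case using coord_add[OF fb] coord_closed[OF fb]
    by (subst M.finsum_insert) (auto simp: Pi_iff R.finsum_insert)
qed

lemma free_basisI:
  assumes "finite I" "b \<in> I \<rightarrow> carrier M"
    and "\<And>x. x \<in> carrier M \<Longrightarrow> \<exists>c\<in>I \<rightarrow> carrier R. x = lincomb M b I c"
    and "\<And>c i. \<lbrakk>c \<in> I \<rightarrow> carrier R; lincomb M b I c = \<zero>\<^bsub>M\<^esub>; i \<in> I\<rbrakk> \<Longrightarrow> c i = \<zero>"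
  shows "free_basis R M b I"
  using assms by (auto simp: free_basis_def)

lemma free_basis_cong:
  assumes "free_basis R M b I" "\<And>i. i \<in> I \<Longrightarrow> b i = b' i"
  shows "free_basis R M b' I"
proof -
  have "lincomb M b' I c = lincomb M b I c" if "c \<in> I \<rightarrow> carrier R" for c
    using that assms free_basis_closed[OF assms(1)] lincomb_cong[of b I c c b'] by simp
  moreover have "b' \<in> I \<rightarrow> carrier M" using assms free_basis_closed[OF assms(1)] by (metis Pi_I Pi_mem)
  ultimately show ?thesis using assms(1) unfolding free_basis_def by auto
qed

lemma free_basis_reindex:
  assumes fb: "free_basis R M b I" and h: "bij_betw h J I"
  shows "free_basis R M (b \<circ> h) J"
proof -
  have hJ: "h ` J = I" "inj_on h J" using h by (auto simp: bij_betw_def)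
  have re: "lincomb M b I c = lincomb M (b \<circ> h) J (c \<circ> h)" if "c \<in> I \<rightarrow> carrier R" for c
    unfolding lincomb_def using hJ that free_basis_closed[OF fb]
    by (subst hJ(1)[symmetric], subst M.finsum_reindex) (auto simp: Pi_iff comp_def)
  let ?k = "the_inv_into J h"
  have k: "?k (h j) = j" if "j \<in> J" for j using hJ that by (simp add: the_inv_into_f_f)
  show ?thesis
  proof (rule free_basisI)
    show "finite J" using free_basis_finite[OF fb] hJ by (metis finite_imageD)
    show bh: "b \<circ> h \<in> J \<rightarrow> carrier M" using free_basis_closed[OF fb] hJ by auto
    show "\<exists>c\<in>J \<rightarrow> carrier R. x = lincomb M (b \<circ> h) J c" if x: "x \<in> carrier M" for x
      using x coord_closed[OF fb x] lincomb_coord[OF fb x] re[of "coord R M b I x"] hJ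
      by (intro bexI[of _ "coord R M b I x \<circ> h"]) auto
    fix c j assume c: "c \<in> J \<rightarrow> carrier R" "lincomb M (b \<circ> h) J c = \<zero>\<^bsub>M\<^esub>" "j \<in> J"
    have ck: "c \<circ> ?k \<in> I \<rightarrow> carrier R" using c hJ k by auto
    have "lincomb M (b \<circ> h) J (c \<circ> ?k \<circ> h) = lincomb M (b \<circ> h) J c"
      using c bh k by (intro lincomb_cong) auto
    then have "lincomb M b I (c \<circ> ?k) = \<zero>\<^bsub>M\<^esub>" using re[OF ck] c by simp
    then have "(c \<circ> ?k) (h j) = \<zero>" using fb ck c(3) hJ unfolding free_basis_def by blast
    then show "c j = \<zero>" using k c by simp
  qed
qed

end

lemma finite_free_module_iff:
  assumes "module R M" and "\<one>\<^bsub>R\<^esub> \<noteq> \<zero>\<^bsub>R\<^esub>"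
  shows "finite_free_module R M \<longleftrightarrow> (\<exists>B. free_basis R M (\<lambda>b. b) B)"
proof -
  interpret module R M by fact
  have *: "(\<Oplus>\<^bsub>M\<^esub>b\<in>B. c b \<odot>\<^bsub>M\<^esub> b) = lincomb M (\<lambda>b. b) B c" for B c
    by (simp add: lincomb_def)
  show ?thesis
  proof
    assume "finite_free_module R M"
    then obtain B where B0: "finite B \<and> B \<subseteq> carrier M \<and>
        (\<forall>x\<in>carrier M. \<exists>!c. c \<in> B \<rightarrow>\<^sub>E carrier R \<and> x = lincomb M (\<lambda>b. b) B c)"
      unfolding finite_free_module_def * ..
    note B = conjunct1[OF B0] conjunct1[OF conjunct2[OF B0]]
    note ex1 = bspec[OF conjunct2[OF conjunct2[OF B0]]]
    have "free_basis R M (\<lambda>b. b) B"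
    proof (rule free_basisI)
      show "\<exists>c\<in>B \<rightarrow> carrier R. x = lincomb M (\<lambda>b. b) B c" if "x \<in> carrier M" for x
        using ex1[OF that] by (elim ex1E) (auto simp: PiE_def)
      \<comment> \<open>Unique representation is applied to the zero vector: the restriction of
        \<open>c\<close> and the zero family both represent it.\<close>
      fix c i assume c: "c \<in> B \<rightarrow> carrier R" "lincomb M (\<lambda>b. b) B c = \<zero>\<^bsub>M\<^esub>" "i \<in> B"
      have "lincomb M (\<lambda>b. b) B (restrict c B) = lincomb M (\<lambda>b. b) B c"
        using c B by (intro lincomb_cong) auto
      moreover have "lincomb M (\<lambda>b. b) B (\<lambda>b\<in>B. \<zero>\<^bsub>R\<^esub>) = \<zero>\<^bsub>M\<^esub>"
        using B by (intro lincomb_zero) auto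
      moreover obtain u where u:
        "\<And>d. d \<in> B \<rightarrow>\<^sub>E carrier R \<and> \<zero>\<^bsub>M\<^esub> = lincomb M (\<lambda>b. b) B d \<Longrightarrow> d = u"
        using ex1[OF M.zero_closed] by (elim ex1E) blast
      ultimately have "restrict c B = u" "(\<lambda>b\<in>B. \<zero>\<^bsub>R\<^esub>) = u"
        using c by (intro u; auto)+
      then show "c i = \<zero>\<^bsub>R\<^esub>" using c(3) by (metis restrict_apply)
    qed (use B in auto)
    then show "\<exists>B. free_basis R M (\<lambda>b. b) B" ..
  next
    assume "\<exists>B. free_basis R M (\<lambda>b. b) B"
    then obtain B where fb: "free_basis R M (\<lambda>b. b) B" ..
    show "finite_free_module R M"
      unfolding finite_free_module_def *
    proof (intro exI[of _ B] conjI ballI)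
      show "finite B" "B \<subseteq> carrier M" using free_basis_finite[OF fb] free_basis_closed[OF fb] by auto
      fix x assume x: "x \<in> carrier M"
      show "\<exists>!c. c \<in> B \<rightarrow>\<^sub>E carrier R \<and> x = lincomb M (\<lambda>b. b) B c"
      proof (rule ex1I[of _ "restrict (coord R M (\<lambda>b. b) B x) B"])
        have "lincomb M (\<lambda>b. b) B (coord R M (\<lambda>b. b) B x) =
            lincomb M (\<lambda>b. b) B (restrict (coord R M (\<lambda>b. b) B x) B)"
          using free_basis_closed[OF fb] coord_closed[OF fb x] by (intro lincomb_cong) auto
        then have "x = lincomb M (\<lambda>b. b) B (restrict (coord R M (\<lambda>b. b) B x) B)"
          unfolding lincomb_coord[OF fb x] .
        moreover have "restrict (coord R M (\<lambda>b. b) B x) B \<in> B \<rightarrow>\<^sub>E carrier R"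
          using coord_closed[OF fb x] by auto
        ultimately show "restrict (coord R M (\<lambda>b. b) B x) B \<in> B \<rightarrow>\<^sub>E carrier R \<and>
          x = lincomb M (\<lambda>b. b) B (restrict (coord R M (\<lambda>b. b) B x) B)" by (intro conjI)
        fix c assume c: "c \<in> B \<rightarrow>\<^sub>E carrier R \<and> x = lincomb M (\<lambda>b. b) B c"
        then have "coord R M (\<lambda>b. b) B x b = c b" if "b \<in> B" for b
          using coord_lincomb[OF fb, of c b] that by (auto simp: PiE_def)
        then show "c = restrict (coord R M (\<lambda>b. b) B x) B"
          using c by (auto simp: PiE_def extensional_def)
      qed
    qed
  qed
qed

lemma free_basis_imp_finite_free:
  assumes "module R M" and "\<one>\<^bsub>R\<^esub> \<noteq> \<zero>\<^bsub>R\<^esub>" and fb: "free_basis R M b I"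
  shows "finite_free_module R M"
proof -
  interpret module R M by fact
  \<comment> \<open>\<open>finite_free_module\<close> asks for a set, so the family must not repeat
    a vector. A repeated vector would have the coordinates one and zero at the same index.\<close>
  have "inj_on b I"
  proof (rule inj_onI)
    fix i j assume ij: "i \<in> I" "j \<in> I" "b i = b j"
    then have "coord R M b I (b i) i = coord R M b I (b j) i" by simp
    then show "i = j"
      unfolding coord_basis[OF fb ij(1)] coord_basis[OF fb ij(2)] using assms(2) by (simp split: if_splits)
  qed
  then have "bij_betw (the_inv_into I b) (b ` I) I"
    by (simp add: bij_betw_the_inv_into inj_on_imp_bij_betw)
  then have "free_basis R M (b \<circ> the_inv_into I b) (b ` I)" by (rule free_basis_reindex[OF fb])
  then have "free_basis R M (\<lambda>x. x) (b ` I)"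
    using \<open>inj_on b I\<close> by (elim free_basis_cong) (auto simp: the_inv_into_f_f)
  then show ?thesis using finite_free_module_iff[OF assms(1,2)] by blast
qed

section \<open>Exchange over a local ring\<close>

context module
begin

lemma lincomb_Un_disjoint:
  assumes "finite I" "finite J" "I \<inter> J = {}" "b \<in> I \<union> J \<rightarrow> carrier M" "c \<in> I \<union> J \<rightarrow> carrier R"
  shows "lincomb M b (I \<union> J) c = lincomb M b I c \<oplus>\<^bsub>M\<^esub> lincomb M b J c"
  unfolding lincomb_def using assms by (intro M.finsum_Un_disjoint) (auto simp: Pi_iff)

lemma lincomb_remove:
  assumes "finite I" "i \<in> I" "b \<in> I \<rightarrow> carrier M" "c \<in> I \<rightarrow> carrier R"
  shows "lincomb M b I c = c i \<odot>\<^bsub>M\<^esub> b i \<oplus>\<^bsub>M\<^esub> lincomb M b (I - {i}) c"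
  using lincomb_insert[of "I - {i}" i b c] assms by (simp add: insert_absorb Pi_iff)

text \<open>Steinitz exchange. Over a ring, solving the expansion of \<open>b j\<close> for
  \<open>b i\<close> requires the coordinate at \<open>i\<close> to be invertible. All vectors are
  values of one family \<open>b\<close>, so the exchange is a mere change of the index set.\<close>

lemma free_basis_exchange:
  assumes fb: "free_basis R M b I" and j: "j \<notin> I" "b j \<in> carrier M" and i: "i \<in> I"
    and unit: "coord R M b I (b j) i \<in> Units R"
  shows "free_basis R M b (insert j (I - {i}))"
proof -
  define a where "a = coord R M b I (b j)"
  define u where "u = inv (a i)"
  let ?K = "I - {i}"
  have fin: "finite I" and b: "b \<in> I \<rightarrow> carrier M"
    using free_basis_finite[OF fb] free_basis_closed[OF fb] by auto
  have a: "a k \<in> carrier R" for k using coord_closed[OF fb j(2)] by (simp add: a_def)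
  have u: "u \<in> carrier R" "u \<otimes> a i = \<one>" using unit by (auto simp: u_def a_def)
  have bK: "b \<in> ?K \<rightarrow> carrier M" "b \<in> insert j ?K \<rightarrow> carrier M" using b j by auto
  have bj: "b j = a i \<odot>\<^bsub>M\<^esub> b i \<oplus>\<^bsub>M\<^esub> lincomb M b ?K a"
    using lincomb_remove[OF fin i b, of a] lincomb_coord[OF fb j(2)] a by (simp add: a_def)
  have bi: "b i \<in> carrier M" using b i by auto
  have LK: "lincomb M b ?K c \<in> carrier M" if "c \<in> ?K \<rightarrow> carrier R" for c using bK that by auto
  \<comment> \<open>Substituting the expansion of \<open>b j\<close> gives the passage from new to
    old coefficients. Spanning and independence both amount to its invertibility.\<close>
  have expand: "lincomb M b (insert j ?K) c
      = lincomb M b I (\<lambda>k. if k = i then c j \<otimes> a i else c j \<otimes> a k \<oplus> c k)"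
    if c: "c \<in> insert j ?K \<rightarrow> carrier R" for c
  proof -
    let ?d = "\<lambda>k. if k = i then c j \<otimes> a i else c j \<otimes> a k \<oplus> c k"
    have cc: "c j \<in> carrier R" "c \<in> ?K \<rightarrow> carrier R" using c by auto
    have d: "?d \<in> I \<rightarrow> carrier R" using c a by (auto simp: Pi_iff)
    have e: "(\<lambda>k. c j \<otimes> a k) \<in> ?K \<rightarrow> carrier R" using cc a by auto
    have "lincomb M b (insert j ?K) c = c j \<odot>\<^bsub>M\<^esub> b j \<oplus>\<^bsub>M\<^esub> lincomb M b ?K c"
      using fin j c bK by (intro lincomb_insert) auto
    also have "\<dots> = ((c j \<otimes> a i) \<odot>\<^bsub>M\<^esub> b i \<oplus>\<^bsub>M\<^esub> c j \<odot>\<^bsub>M\<^esub> lincomb M b ?K a) \<oplus>\<^bsub>M\<^esub> lincomb M b ?K c"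
      using cc a bi LK[of a] by (subst bj) (simp add: smult_r_distr smult_assoc1)
    also have "c j \<odot>\<^bsub>M\<^esub> lincomb M b ?K a = lincomb M b ?K (\<lambda>k. c j \<otimes> a k)"
      using fin bK cc a by (intro lincomb_smult[symmetric]) auto
    also have "((c j \<otimes> a i) \<odot>\<^bsub>M\<^esub> b i \<oplus>\<^bsub>M\<^esub> lincomb M b ?K (\<lambda>k. c j \<otimes> a k)) \<oplus>\<^bsub>M\<^esub> lincomb M b ?K c
        = (c j \<otimes> a i) \<odot>\<^bsub>M\<^esub> b i \<oplus>\<^bsub>M\<^esub> (lincomb M b ?K (\<lambda>k. c j \<otimes> a k) \<oplus>\<^bsub>M\<^esub> lincomb M b ?K c)"
      using cc a bi LK[OF e] LK[OF cc(2)] by (intro M.a_assoc) auto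
    also have "lincomb M b ?K (\<lambda>k. c j \<otimes> a k) \<oplus>\<^bsub>M\<^esub> lincomb M b ?K c = lincomb M b ?K (\<lambda>k. c j \<otimes> a k \<oplus> c k)"
      using bK cc e by (intro lincomb_add[symmetric]) auto
    also have "\<dots> = lincomb M b ?K ?d"
      using bK cc a by (intro lincomb_cong) (auto simp: Pi_iff)
    finally show ?thesis using lincomb_remove[OF fin i b d] by simp
  qed
  show ?thesis
  proof (rule free_basisI)
    show "finite (insert j ?K)" using fin by simp
    show "b \<in> insert j ?K \<rightarrow> carrier M" by (rule bK)
  next
    fix x assume x: "x \<in> carrier M"
    let ?d = "coord R M b I x"
    have d: "?d k \<in> carrier R" for k using coord_closed[OF fb x] .
    \<comment> \<open>The inverse substitution: the coefficient of \<open>b j\<close> is dictated by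
      the coordinate at \<open>i\<close>, and the other coordinates are corrected by its
      contribution.\<close>
    define c where "c k = (if k = j then ?d i \<otimes> u else ?d k \<oplus> \<ominus> (?d i \<otimes> u \<otimes> a k))" for k
    have c: "c \<in> insert j ?K \<rightarrow> carrier R" using d a u by (auto simp: c_def)
    have "lincomb M b (insert j ?K) c = lincomb M b I ?d"
      unfolding expand[OF c]
    proof (rule lincomb_cong[OF b])
      fix k assume k: "k \<in> I"
      have 1: "?d i \<otimes> u \<otimes> a i = ?d i" using d a u by (simp add: m_assoc)
      have "k \<noteq> j" using k j by auto
      then show "(if k = i then c j \<otimes> a i else c j \<otimes> a k \<oplus> c k) = ?d k"
        using d[of k] d[of i] a[of k] u 1
        by (auto simp: c_def R.a_comm[of "?d k"] R.a_assoc[symmetric] R.r_neg)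
    qed (use c a in \<open>auto simp: Pi_iff\<close>)
    then show "\<exists>c\<in>insert j ?K \<rightarrow> carrier R. x = lincomb M b (insert j ?K) c"
      using c lincomb_coord[OF fb x] by (intro bexI[of _ c]) simp_all
  next
    fix c k assume c: "c \<in> insert j ?K \<rightarrow> carrier R" "lincomb M b (insert j ?K) c = \<zero>\<^bsub>M\<^esub>"
      and k: "k \<in> insert j ?K"
    let ?d = "\<lambda>k. if k = i then c j \<otimes> a i else c j \<otimes> a k \<oplus> c k"
    have d: "?d \<in> I \<rightarrow> carrier R" using c a by (auto simp: Pi_iff)
    have z: "?d k = \<zero>" if "k \<in> I" for k
      using fb d c(2) that unfolding expand[OF c(1)] free_basis_def by blast
    have cj: "c j \<in> carrier R" using c by auto
    have "c j \<otimes> a i \<otimes> u = \<zero>" using z[OF i] u by simp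
    then have "c j = \<zero>" using u a cj by (simp add: m_assoc m_comm[of "a i" u])
    moreover have "c k = \<zero>" if "k \<in> ?K"
      using z[of k] that a[of k] \<open>c j = \<zero>\<close> c(1) by (auto simp: Pi_iff)
    ultimately show "c k = \<zero>" using k by auto
  qed
qed

end

section \<open>The product of an ideal and a module in coordinates\<close>

lemma submodule_generated_minimal:
  "\<lbrakk>submodule N R M; S \<subseteq> N\<rbrakk> \<Longrightarrow> submodule_generated R M S \<subseteq> N"
  by (auto simp: submodule_generated_def)

lemma ideal_times_module_minimal:
  assumes "submodule N R M" "\<And>r x. \<lbrakk>r \<in> J; x \<in> carrier M\<rbrakk> \<Longrightarrow> r \<odot>\<^bsub>M\<^esub> x \<in> N"
  shows "ideal_times_module R J M \<subseteq> N"
  unfolding ideal_times_module_def using assms by (intro submodule_generated_minimal) auto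

lemma lincomb_in_ideal_times_module:
  assumes "module R M" "finite I" "b \<in> I \<rightarrow> carrier M" "J \<subseteq> carrier R" "c \<in> I \<rightarrow> J"
  shows "lincomb M b I c \<in> ideal_times_module R J M"
proof -
  interpret module R M by fact
  show ?thesis
    unfolding ideal_times_module_def submodule_generated_def
  proof (clarify)
    fix N assume N: "submodule N R M" and sub: "{r \<odot>\<^bsub>M\<^esub> x |r x. r \<in> J \<and> x \<in> carrier M} \<subseteq> N"
    note NE = submoduleE[OF N]
    have z: "\<zero>\<^bsub>M\<^esub> \<in> N"
      using NE(2) NE(4)[of "\<zero>\<^bsub>R\<^esub>"] NE(1) by (metis R.zero_closed ex_in_conv smult_l_null subsetD)
    show "lincomb M b I c \<in> N"
      by (rule lincomb_induct[where P = "\<lambda>x. x \<in> N"]) (use assms sub z NE(5) in \<open>blast dest: Pi_mem\<close>)+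
  qed
qed

text \<open>The vectors with all coordinates in \<open>J\<close> form a submodule that contains the
  generators of the product. Minimality of a resolution thereby becomes a condition on the matrix
  entries of the differential.\<close>

lemma ideal_times_module_coord:
  assumes "module R M" "ideal J R" and fb: "free_basis R M b I" and x: "x \<in> ideal_times_module R J M"
  shows "x \<in> carrier M" and "coord R M b I x i \<in> J"
proof -
  interpret module R M by fact
  interpret J: ideal J R by fact
  let ?N = "{x \<in> carrier M. \<forall>i. coord R M b I x i \<in> J}"
  have "submodule ?N R M"
    by (rule submoduleI)
      (auto simp: coord_add[OF fb] coord_smult[OF fb] coord_minus[OF fb] coord_zero[OF fb] J.I_l_closed)
  then have "ideal_times_module R J M \<subseteq> ?N"
    by (rule ideal_times_module_minimal)
      (use J.Icarr coord_closed[OF fb] in \<open>auto simp: coord_smult[OF fb] J.I_r_closed\<close>)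
  then show "x \<in> carrier M" "coord R M b I x i \<in> J" using x by auto
qed

section \<open>Units of a local ring and extension of independent families to bases\<close>

context noetherian_local_ring
begin

lemma maximal_ideal: "ideal \<mm> R"
  using maximal by (rule maximalideal.axioms(1))

lemma one_not_in_maximal: "\<one> \<notin> \<mm>"
  using maximal maximal_ideal ideal.one_imp_carrier[of \<mm> R] maximalideal.I_notcarr[of \<mm> R] by blast

lemma one_not_zero: "\<one> \<noteq> \<zero>"
  using one_not_in_maximal maximal_ideal additive_subgroup.zero_closed[OF ideal.axioms(1)] by metis

text \<open>In a noetherian ring a nonempty chain of ideals contains its union, so Zorn's lemma
  gives an ideal that is maximal among the proper ideals over \<open>I\<close>. Uniqueness of the
  maximal ideal identifies it.\<close>

lemma proper_ideal_subset_maximal: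
  assumes "ideal I R" "I \<noteq> carrier R"
  shows "I \<subseteq> \<mm>"
proof -
  let ?A = "{J. ideal J R \<and> I \<subseteq> J \<and> J \<noteq> carrier R}"
  have "\<exists>N\<in>?A. \<forall>J\<in>?A. N \<subseteq> J \<longrightarrow> J = N"
  proof (rule subset_Zorn_nonempty)
    show "?A \<noteq> {}" using assms by auto
    fix C assume C: "C \<noteq> {}" "subset.chain ?A C"
    then have "subset.chain {J. ideal J R} C" by (auto simp: subset.chain_def)
    then have "\<Union> C \<in> C" using ideal_chain_is_trivial C by blast
    then show "\<Union> C \<in> ?A" using C(2) by (auto simp: subset.chain_def)
  qed
  then obtain N where N: "ideal N R" "I \<subseteq> N" "N \<noteq> carrier R"
    and max: "\<And>J. \<lbrakk>ideal J R; I \<subseteq> J; J \<noteq> carrier R; N \<subseteq> J\<rbrakk> \<Longrightarrow> J = N"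
    by (elim bexE) blast
  have "maximalideal N R"
    by (rule maximalidealI) (use N max in blast)+
  then show ?thesis using unique_maximal N by blast
qed

lemma not_in_maximal_unit:
  assumes "x \<in> carrier R" "x \<notin> \<mm>"
  shows "x \<in> Units R"
proof -
  have "PIdl x = carrier R"
    using proper_ideal_subset_maximal[OF cgenideal_ideal[OF assms(1)]] cgenideal_self[OF assms(1)] assms(2)
    by blast
  then obtain y where "y \<in> carrier R" "\<one> = y \<otimes> x"
    using one_closed unfolding cgenideal_def by blast
  then show ?thesis using assms m_comm unfolding Units_def by force
qed

text \<open>The vectors of \<open>J\<close> are exchanged into the basis one by one. The exchange of
  \<open>b j\<close> must not expel an earlier vector of \<open>J\<close>, so a unit coordinate is
  needed on the surviving part \<open>B'\<close> of the old basis. What survives at the end supplies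
  the new generators in the application.\<close>

lemma extend_to_basis:
  assumes M: "module R M" and fb: "free_basis R M b B" and "finite J" "J \<inter> B = {}" "b \<in> J \<rightarrow> carrier M"
    and indep: "\<And>c j. \<lbrakk>c \<in> J \<rightarrow> carrier R; lincomb M b J c \<in> ideal_times_module R \<mm> M; j \<in> J\<rbrakk> \<Longrightarrow> c j \<in> \<mm>"
  shows "\<exists>B'\<subseteq>B. free_basis R M b (J \<union> B')"
proof -
  interpret M: module R M by fact
  show ?thesis
    using assms(3-)
  proof (induction J rule: finite_induct)
    case empty
    then show ?case using fb by auto
  next
    case (insert j J)
    have bJ: "b \<in> insert j J \<rightarrow> carrier M" "b \<in> J \<rightarrow> carrier M" using insert by auto
    have "\<exists>B'\<subseteq>B. free_basis R M b (J \<union> B')"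
    proof (rule insert.IH)
      fix c i assume c: "c \<in> J \<rightarrow> carrier R" "lincomb M b J c \<in> ideal_times_module R \<mm> M" "i \<in> J"
      let ?c = "\<lambda>k. if k = j then \<zero> else c k"
      have "lincomb M b J ?c = lincomb M b (insert j J) ?c"
        using insert c bJ by (intro M.lincomb_mono_neutral) auto
      moreover have "lincomb M b J c = lincomb M b J ?c"
        using insert c bJ by (intro M.lincomb_cong) auto
      ultimately have "?c i \<in> \<mm>" using c insert.prems(3)[of ?c i] by (auto simp: Pi_iff)
      then show "c i \<in> \<mm>" using insert.hyps c by (auto split: if_splits)
    qed (use insert in auto)
    then obtain B' where B': "B' \<subseteq> B" and fb': "free_basis R M b (J \<union> B')" by auto
    have bj: "b j \<in> carrier M" using bJ by auto
    have bB: "b \<in> J \<union> B' \<rightarrow> carrier M" using M.free_basis_closed[OF fb'] .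
    have fin: "finite (J \<union> B')" using M.free_basis_finite[OF fb'] .
    define a where "a = coord R M b (J \<union> B') (b j)"
    have a: "a k \<in> carrier R" for k using M.coord_closed[OF fb' bj] by (simp add: a_def)
    \<comment> \<open>Otherwise \<open>b j\<close> minus its part along \<open>J\<close> would lie
      in the maximal ideal times the module, and independence would put the coefficient one of
      \<open>b j\<close> into \<open>\<mm>\<close>.\<close>
    have "\<exists>i\<in>B'. a i \<notin> \<mm>"
    proof (rule ccontr)
      assume "\<not> (\<exists>i\<in>B'. a i \<notin> \<mm>)"
      then have aB: "a \<in> B' \<rightarrow> \<mm>" by auto
      let ?c = "\<lambda>k. if k = j then \<one> else \<ominus> a k"
      have c: "?c \<in> insert j J \<rightarrow> carrier R" using a by auto
      have bjs: "b j = lincomb M b J a \<oplus>\<^bsub>M\<^esub> lincomb M b B' a"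
      proof -
        have "J \<inter> B' = {}" using insert.prems(1) B' by auto
        then show ?thesis
          using M.lincomb_coord[OF fb' bj] M.lincomb_Un_disjoint[of J B' b a] fin bB a
          by (simp add: a_def)
      qed
      have L: "lincomb M b J a \<in> carrier M" "lincomb M b B' a \<in> carrier M" using bB a by auto
      have "lincomb M b (insert j J) ?c = ?c j \<odot>\<^bsub>M\<^esub> b j \<oplus>\<^bsub>M\<^esub> lincomb M b J ?c"
        using insert.hyps bJ c by (intro M.lincomb_insert) auto
      also have "lincomb M b J ?c = lincomb M b J (\<lambda>k. \<ominus> \<one> \<otimes> a k)"
        using insert.hyps bJ a c by (intro M.lincomb_cong) (auto simp: l_minus)
      also have "\<dots> = \<ominus>\<^bsub>M\<^esub> lincomb M b J a"
        using insert.hyps bJ a L by (subst M.lincomb_smult) (auto simp: M.smult_l_minus)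
      also have "?c j \<odot>\<^bsub>M\<^esub> b j = lincomb M b B' a \<oplus>\<^bsub>M\<^esub> lincomb M b J a"
        using bj bjs L M.a_comm by simp
      also have "(lincomb M b B' a \<oplus>\<^bsub>M\<^esub> lincomb M b J a) \<oplus>\<^bsub>M\<^esub> (\<ominus>\<^bsub>M\<^esub> lincomb M b J a) = lincomb M b B' a"
        using L by (simp add: M.a_assoc M.r_neg)
      also have "\<dots> \<in> ideal_times_module R \<mm> M"
        using aB fin bB maximal_ideal additive_subgroup.a_subset[OF ideal.axioms(1)]
        by (intro lincomb_in_ideal_times_module[OF M]) auto
      finally have "?c j \<in> \<mm>" using insert.prems(3)[OF c] by blast
      then show False using one_not_in_maximal by simp
    qed
    then obtain i where i: "i \<in> B'" "a i \<notin> \<mm>" by auto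
    then have "a i \<in> Units R" using not_in_maximal_unit a by auto
    moreover have j: "j \<notin> J \<union> B'" using insert B' by auto
    ultimately have "free_basis R M b (insert j (J \<union> B' - {i}))"
      using i bj by (intro M.free_basis_exchange[OF fb']) (auto simp: a_def)
    moreover have "insert j (J \<union> B' - {i}) = insert j J \<union> (B' - {i})"
      using i insert.prems(1) B' by auto
    ultimately show ?case using B' by (metis Diff_subset order_trans)
  qed
qed

end

section \<open>The action of the Tate construction in coordinates\<close>

lemma module_homD:
  assumes "h \<in> module_hom R M N"
  shows "x \<in> carrier M \<Longrightarrow> h x \<in> carrier N"
    and "\<lbrakk>x \<in> carrier M; y \<in> carrier M\<rbrakk> \<Longrightarrow> h (x \<oplus>\<^bsub>M\<^esub> y) = h x \<oplus>\<^bsub>N\<^esub> h y"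
    and "\<lbrakk>r \<in> carrier R; x \<in> carrier M\<rbrakk> \<Longrightarrow> h (r \<odot>\<^bsub>M\<^esub> x) = r \<odot>\<^bsub>N\<^esub> h x"
  using assms by (auto simp: module_hom_def)

lemma module_hom_zero:
  assumes "module R M" "module R N" "h \<in> module_hom R M N"
  shows "h \<zero>\<^bsub>M\<^esub> = \<zero>\<^bsub>N\<^esub>"
proof -
  interpret M: module R M by fact
  interpret N: module R N by fact
  have "h (\<zero>\<^bsub>R\<^esub> \<odot>\<^bsub>M\<^esub> \<zero>\<^bsub>M\<^esub>) = \<zero>\<^bsub>R\<^esub> \<odot>\<^bsub>N\<^esub> h \<zero>\<^bsub>M\<^esub>"
    using assms(3) by (intro module_homD(3)) auto
  then show ?thesis using module_homD(1)[OF assms(3)] by simp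
qed

text \<open>A sign as a scalar instead of the operation \<open>signed\<close>: linear maps and
  coordinates commute with it, and the signs of several degrees multiply in the ring.\<close>

definition sgn_elt :: "('a, 'x) ring_scheme \<Rightarrow> int \<Rightarrow> 'a"
  where "sgn_elt R k = (if even k then \<one>\<^bsub>R\<^esub> else \<ominus>\<^bsub>R\<^esub> \<one>\<^bsub>R\<^esub>)"

lemma (in cring) sgn_elt_closed [simp]: "sgn_elt R k \<in> carrier R"
  by (simp add: sgn_elt_def)

lemma (in cring) sgn_elt_add: "sgn_elt R (k + l) = sgn_elt R k \<otimes> sgn_elt R l"
  by (auto simp: sgn_elt_def l_minus)

lemma signed_eq_smult:
  assumes "module R M" "x \<in> carrier M"
  shows "signed k M x = sgn_elt R k \<odot>\<^bsub>M\<^esub> x"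
proof -
  interpret module R M by fact
  show ?thesis using assms(2) by (simp add: signed_def sgn_elt_def smult_l_minus)
qed

section \<open>Linearity and degree conventions of the Tate construction\<close>

context cring
begin

lemma tate_mul_add_left:
  "\<lbrakk>a \<in> carrier R; b \<in> carrier R; c \<in> carrier R\<rbrakk> \<Longrightarrow>
   tate_mul R i j (a \<oplus> b) c = tate_mul R i j a c \<oplus> tate_mul R i j b c"
  by (simp add: tate_mul_def l_distr add.nat_pow_distrib)

lemma tate_mul_add_right:
  "\<lbrakk>a \<in> carrier R; b \<in> carrier R; c \<in> carrier R\<rbrakk> \<Longrightarrow>
   tate_mul R i j a (b \<oplus> c) = tate_mul R i j a b \<oplus> tate_mul R i j a c"
  by (simp add: tate_mul_def r_distr add.nat_pow_distrib)

lemma tate_mul_smult_left: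
  "\<lbrakk>r \<in> carrier R; a \<in> carrier R; b \<in> carrier R\<rbrakk> \<Longrightarrow>
   tate_mul R i j (r \<otimes> a) b = r \<otimes> tate_mul R i j a b"
  by (simp add: tate_mul_def add_pow_rdistr m_assoc)

lemma tate_mul_smult_right:
  "\<lbrakk>r \<in> carrier R; a \<in> carrier R; b \<in> carrier R\<rbrakk> \<Longrightarrow>
   tate_mul R i j a (r \<otimes> b) = r \<otimes> tate_mul R i j a b"
  by (simp add: tate_mul_def add_pow_rdistr m_lcomm)

lemma tate_mul_degree_zero_right:
  "\<lbrakk>a \<in> carrier R; b \<in> carrier R; i \<ge> 0\<rbrakk> \<Longrightarrow> tate_mul R i 0 a b = a \<otimes> b"
  by (simp add: tate_mul_def)

lemma tate_mul_degree_zero_left: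
  "\<lbrakk>a \<in> carrier R; b \<in> carrier R; i \<ge> 0\<rbrakk> \<Longrightarrow> tate_mul R 0 i a b = a \<otimes> b"
  by (simp add: tate_mul_def)

lemma tate_mul_neg: "i < 0 \<or> j < 0 \<Longrightarrow> tate_mul R i j a b = \<zero>"
  by (auto simp: tate_mul_def)

lemma tate_bdry_closed:
  "\<lbrakk>f \<in> carrier R; g \<in> carrier R; a \<in> carrier R\<rbrakk> \<Longrightarrow> tate_bdry R f g n a \<in> carrier R"
  by (simp add: tate_bdry_def)

lemma tate_bdry_smult:
  "\<lbrakk>f \<in> carrier R; g \<in> carrier R; a \<in> carrier R; r \<in> carrier R\<rbrakk> \<Longrightarrow>
   tate_bdry R f g n (r \<otimes> a) = r \<otimes> tate_bdry R f g n a"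
  by (simp add: tate_bdry_def m_assoc)

lemma tate_bdry_bdry:
  "\<lbrakk>f \<in> carrier R; g \<in> carrier R; f \<otimes> g = \<zero>; a \<in> carrier R\<rbrakk> \<Longrightarrow>
   tate_bdry R f g (n - 1) (tate_bdry R f g n a) = \<zero>"
  using m_comm[of f g] by (simp add: tate_bdry_def m_assoc)

end

text \<open>The Tate construction has one basis element in each degree from zero on, so every
  generator of degree \<open>i\<close> with \<open>0 \<le> i \<le> n\<close> contributes exactly one
  basis element in degree \<open>n\<close>.\<close>

definition tate_index :: "(int \<Rightarrow> 'u set) \<Rightarrow> int \<Rightarrow> (int \<times> 'u) set"
  where "tate_index E n = Sigma {0..n} E"

lemma tate_index_iff [simp]: "(i, e) \<in> tate_index E n \<longleftrightarrow> 0 \<le> i \<and> i \<le> n \<and> e \<in> E i"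
  by (auto simp: tate_index_def)

text \<open>\<open>W n (i, e)\<close> stands for \<open>t\<^bsup>(k)\<^esup> e\<close> or \<open>y t\<^bsup>(k)\<^esup> e\<close>, whichever has degree \<open>n\<close>, so in the
  coordinates of these bases the action is the multiplication of the Tate construction.\<close>

definition tate_act ::
    "('a, 'x) ring_scheme \<Rightarrow> ('a, 'u) chain_complex \<Rightarrow> (int \<Rightarrow> 'u set) \<Rightarrow> (int \<Rightarrow> int \<times> 'u \<Rightarrow> 'u) \<Rightarrow>
     int \<Rightarrow> int \<Rightarrow> 'a \<Rightarrow> 'u \<Rightarrow> 'u"
  where "tate_act R U E W m n a x =
    lincomb (component U (m + n)) (W (m + n)) (tate_index E (m + n))
      (\<lambda>p. tate_mul R m (n - fst p) a (coord R (component U n) (W n) (tate_index E n) x p))"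

text \<open>The data reach only up to degree \<open>N\<close> because the bases are built by
  induction on the degree. In negative degrees the index set is empty, so \<open>basis\<close> makes
  the components zero there. Nothing links the bases to the differential yet: the laws of the action
  other than the Leibniz rule do not involve it.\<close>

locale tate_frame = chain_complex R U
  for R :: "('a, 'x) ring_scheme" (structure) and U :: "('a, 'u) chain_complex" +
  fixes f g :: 'a and N :: int and E :: "int \<Rightarrow> 'u set" and W :: "int \<Rightarrow> int \<times> 'u \<Rightarrow> 'u"
  assumes fg: "f \<in> carrier R" "g \<in> carrier R" "f \<otimes> g = \<zero>"
    and basis: "n \<le> N \<Longrightarrow> free_basis R (component U n) (W n) (tate_index E n)"
    and W_diag: "\<lbrakk>0 \<le> i; i \<le> N; e \<in> E i\<rbrakk> \<Longrightarrow> W i (i, e) = e"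
begin

sublocale U: module R "component U n" for n
  by (rule comp_module)

abbreviation C :: "int \<Rightarrow> ('a, 'u) module"
  where "C \<equiv> component U"

abbreviation dA :: "int \<Rightarrow> 'a \<Rightarrow> 'a"
  where "dA \<equiv> tate_bdry R f g"

abbreviation cf :: "int \<Rightarrow> 'u \<Rightarrow> int \<times> 'u \<Rightarrow> 'a"
  where "cf n \<equiv> coord R (C n) (W n) (tate_index E n)"

abbreviation tact :: "int \<Rightarrow> int \<Rightarrow> 'a \<Rightarrow> 'u \<Rightarrow> 'u"
  where "tact \<equiv> tate_act R U E W"

lemma bdry_closed: "x \<in> carrier (C n) \<Longrightarrow> bdry U n x \<in> carrier (C (n - 1))"
  and bdry_add: "\<lbrakk>x \<in> carrier (C n); y \<in> carrier (C n)\<rbrakk> \<Longrightarrow>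
    bdry U n (x \<oplus>\<^bsub>C n\<^esub> y) = bdry U n x \<oplus>\<^bsub>C (n - 1)\<^esub> bdry U n y"
  and bdry_smult: "\<lbrakk>r \<in> carrier R; x \<in> carrier (C n)\<rbrakk> \<Longrightarrow>
    bdry U n (r \<odot>\<^bsub>C n\<^esub> x) = r \<odot>\<^bsub>C (n - 1)\<^esub> bdry U n x"
  and bdry_zero: "bdry U n \<zero>\<^bsub>C n\<^esub> = \<zero>\<^bsub>C (n - 1)\<^esub>"
  using module_homD[OF bdry_hom] module_hom_zero[OF comp_module comp_module bdry_hom] by auto

lemma cf_closed: "\<lbrakk>n \<le> N; x \<in> carrier (C n)\<rbrakk> \<Longrightarrow> cf n x p \<in> carrier R"
  using U.coord_closed[OF basis] .

lemma cf_outside: "p \<notin> tate_index E n \<Longrightarrow> cf n x p = \<zero>"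
  by (simp add: coord_def)

lemma W_closed: "\<lbrakk>n \<le> N; p \<in> tate_index E n\<rbrakk> \<Longrightarrow> W n p \<in> carrier (C n)"
  using U.free_basis_elt[OF basis] .

lemma E_closed: "\<lbrakk>0 \<le> i; i \<le> N; e \<in> E i\<rbrakk> \<Longrightarrow> e \<in> carrier (C i)"
  using W_closed[of i "(i, e)"] W_diag by simp

lemma cf_E: "\<lbrakk>0 \<le> i; i \<le> N; e \<in> E i\<rbrakk> \<Longrightarrow> cf i e p = (if p = (i, e) then \<one> else \<zero>)"
  using U.coord_basis[OF basis, of i "(i, e)" p] W_diag by simp

lemma tate_mul_cf_closed:
  "\<lbrakk>n \<le> N; a \<in> carrier R; x \<in> carrier (C n)\<rbrakk> \<Longrightarrow>
   tate_mul R m k a (cf n x p) \<in> carrier R"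
  using cf_closed by (simp add: tate_mul_closed)

lemma tact_closed:
  assumes "n \<le> N" "m + n \<le> N" "a \<in> carrier R" "x \<in> carrier (C n)"
  shows "tact m n a x \<in> carrier (C (m + n))"
  unfolding tate_act_def
  using U.free_basis_closed[OF basis[OF assms(2)]] tate_mul_cf_closed assms
  by (intro U.lincomb_closed) auto

text \<open>The laws of the action are checked through this identity, coefficient by coefficient in
  the Tate construction. It holds at every index: one that is missing in degree \<open>m + n\<close>
  is missing in degree \<open>n\<close> as well unless \<open>m\<close> is negative, and both sides
  vanish in either case.\<close>

lemma cf_tact:
  assumes "n \<le> N" "m + n \<le> N" "a \<in> carrier R" "x \<in> carrier (C n)"
  shows "cf (m + n) (tact m n a x) p = tate_mul R m (n - fst p) a (cf n x p)"
proof (cases "p \<in> tate_index E (m + n)")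
  case True
  then show ?thesis
    unfolding tate_act_def using tate_mul_cf_closed assms
    by (subst U.coord_lincomb[OF basis[OF assms(2)]]) auto
next
  case False
  then have "p \<notin> tate_index E n \<or> m < 0" by (cases p) auto
  then show ?thesis
    using False assms by (auto simp: cf_outside tate_mul_zero tate_mul_neg)
qed

lemma U_eqI:
  assumes "n \<le> N" "x \<in> carrier (C n)" "y \<in> carrier (C n)" "\<And>p. cf n x p = cf n y p"
  shows "x = y"
  using U.coord_eqI[OF basis] assms by blast

lemmas cf_simps = U.coord_add[OF basis] U.coord_smult[OF basis] U.coord_zero[OF basis]

lemma tact_add_left:
  assumes "n \<le> N" "m + n \<le> N" "a \<in> carrier R" "b \<in> carrier R" "x \<in> carrier (C n)"
  shows "tact m n (a \<oplus> b) x = tact m n a x \<oplus>\<^bsub>C (m + n)\<^esub> tact m n b x"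
  using assms cf_closed
  by (intro U_eqI[of "m + n"]) (auto simp: tact_closed cf_tact cf_simps tate_mul_add_left)

lemma tact_add_right:
  assumes "n \<le> N" "m + n \<le> N" "a \<in> carrier R" "x \<in> carrier (C n)" "y \<in> carrier (C n)"
  shows "tact m n a (x \<oplus>\<^bsub>C n\<^esub> y) = tact m n a x \<oplus>\<^bsub>C (m + n)\<^esub> tact m n a y"
  using assms cf_closed
  by (intro U_eqI[of "m + n"]) (auto simp: tact_closed cf_tact cf_simps tate_mul_add_right)

lemma tact_smult_left:
  assumes "n \<le> N" "m + n \<le> N" "r \<in> carrier R" "a \<in> carrier R" "x \<in> carrier (C n)"
  shows "tact m n (r \<otimes> a) x = r \<odot>\<^bsub>C (m + n)\<^esub> tact m n a x"
  using assms cf_closed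
  by (intro U_eqI[of "m + n"]) (auto simp: tact_closed cf_tact cf_simps tate_mul_smult_left)

lemma tact_smult_right:
  assumes "n \<le> N" "m + n \<le> N" "r \<in> carrier R" "a \<in> carrier R" "x \<in> carrier (C n)"
  shows "tact m n a (r \<odot>\<^bsub>C n\<^esub> x) = r \<odot>\<^bsub>C (m + n)\<^esub> tact m n a x"
  using assms cf_closed
  by (intro U_eqI[of "m + n"]) (auto simp: tact_closed cf_tact cf_simps tate_mul_smult_right)

lemma tact_zero_left:
  assumes "n \<le> N" "m + n \<le> N" "x \<in> carrier (C n)"
  shows "tact m n \<zero> x = \<zero>\<^bsub>C (m + n)\<^esub>"
  using assms cf_closed
  by (intro U_eqI[of "m + n"]) (auto simp: tact_closed cf_tact cf_simps tate_mul_zero)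

lemma tact_zero_right:
  assumes "n \<le> N" "m + n \<le> N" "a \<in> carrier R"
  shows "tact m n a \<zero>\<^bsub>C n\<^esub> = \<zero>\<^bsub>C (m + n)\<^esub>"
  using assms cf_closed
  by (intro U_eqI[of "m + n"]) (auto simp: tact_closed cf_tact cf_simps tate_mul_zero)

lemma tact_degree_zero:
  assumes "n \<le> N" "a \<in> carrier R" "x \<in> carrier (C n)"
  shows "tact 0 n a x = a \<odot>\<^bsub>C n\<^esub> x"
proof (rule U_eqI[of n])
  fix p
  have "tate_mul R 0 (n - fst p) a (cf n x p) = a \<otimes> cf n x p"
  proof (cases "p \<in> tate_index E n")
    case True
    then have "n - fst p \<ge> 0" by (cases p) auto
    then show ?thesis using assms cf_closed by (simp add: tate_mul_degree_zero_left)
  qed (use assms in \<open>simp add: cf_outside tate_mul_zero\<close>)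
  then show "cf n (tact 0 n a x) p = cf n (a \<odot>\<^bsub>C n\<^esub> x) p"
    using cf_tact[of n 0 a x p] assms by (simp add: cf_simps)
qed (use assms tact_closed[of n 0 a x] in auto)

lemma tact_assoc:
  assumes "k \<le> N" "j + k \<le> N" "i + j + k \<le> N"
    and a: "a \<in> carrier (tate_comp R i)" and b: "b \<in> carrier (tate_comp R j)"
    and x: "x \<in> carrier (C k)"
  shows "tact (i + j) k (tate_mul R i j a b) x = tact i (j + k) a (tact j k b x)"
proof -
  have ab: "a \<in> carrier R" "b \<in> carrier R" using a b by (auto split: if_splits)
  have N: "i + (j + k) \<le> N" using assms by simp
  have e: "i + (j + k) = i + j + k" by simp
  show ?thesis
  proof (rule U_eqI[OF assms(3)])
    show "tact (i + j) k (tate_mul R i j a b) x \<in> carrier (C (i + j + k))"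
      using assms ab by (intro tact_closed tate_mul_closed) auto
    show "tact i (j + k) a (tact j k b x) \<in> carrier (C (i + j + k))"
      using tact_closed[OF assms(2) N ab(1) tact_closed[OF assms(1,2) ab(2) x]] unfolding e .
    fix p
    \<comment> \<open>A coordinate at a generator of degree above \<open>k\<close> is zero, so it
      belongs to the Tate construction in degree \<open>k - fst p\<close> even if this degree is
      negative.\<close>
    have c: "cf k x p \<in> carrier (tate_comp R (k - fst p))"
      using cf_closed[OF assms(1) x] cf_outside[of p k x] by (cases p) auto
    have "cf (i + j + k) (tact i (j + k) a (tact j k b x)) p
        = tate_mul R i (j + k - fst p) a (tate_mul R j (k - fst p) b (cf k x p))"
      using cf_tact[OF assms(2) N ab(1) tact_closed[OF assms(1,2) ab(2) x]] cf_tact[OF assms(1,2) ab(2) x]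
      unfolding e by simp
    also have "\<dots> = tate_mul R (i + j) (k - fst p) (tate_mul R i j a b) (cf k x p)"
      using dg_algebra.mul_assoc[OF tate_dg_algebra[OF fg], of a i b j "cf k x p" "k - fst p"] a b c
      by (simp add: add_diff_eq)
    also have "\<dots> = cf (i + j + k) (tact (i + j) k (tate_mul R i j a b) x) p"
      using assms ab by (intro cf_tact[symmetric] tate_mul_closed) auto
    finally show "cf (i + j + k) (tact (i + j) k (tate_mul R i j a b) x) p =
        cf (i + j + k) (tact i (j + k) a (tact j k b x)) p" ..
  qed
qed

text \<open>\<open>W n (i, e)\<close> is the Tate basis element of degree \<open>n - i\<close>
  applied to \<open>e\<close>. Rewriting with this turns each term of an expansion into a product,
  to which associativity applies.\<close>

lemma smult_W:
  assumes "n \<le> N" "0 \<le> i" "i \<le> n" "e \<in> E i" "c \<in> carrier R"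
  shows "c \<odot>\<^bsub>C n\<^esub> W n (i, e) = tact (n - i) i c e"
proof -
  have e: "e \<in> carrier (C i)" using assms by (intro E_closed) auto
  have n: "n - i + i = n" by simp
  show ?thesis
  proof (rule U_eqI[OF assms(1)])
    show "tact (n - i) i c e \<in> carrier (C n)"
      using tact_closed[of i "n - i" c e] assms e by simp
    fix p
    have "cf n (tact (n - i) i c e) p = tate_mul R (n - i) (i - fst p) c (cf i e p)"
      using cf_tact[of i "n - i" c e p] assms e by simp
    also have "\<dots> = (if p = (i, e) then c else \<zero>)"
      using assms by (auto simp: cf_E tate_mul_degree_zero_right tate_mul_zero)
    also have "\<dots> = cf n (c \<odot>\<^bsub>C n\<^esub> W n (i, e)) p"
      using U.coord_basis[OF basis, of n "(i, e)" p] W_closed[of n "(i, e)"] assms by (simp add: cf_simps)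
    finally show "cf n (c \<odot>\<^bsub>C n\<^esub> W n (i, e)) p = cf n (tact (n - i) i c e) p" ..
  qed (use W_closed[of n "(i, e)"] assms in auto)
qed

end

text \<open>The Leibniz rule is imposed only on products of Tate basis elements with generators. In
  degree \<open>n\<close> it prescribes the boundary of one vector by data of lower degree, which is
  what allows an induction on the degree.\<close>

locale tate_basis = tate_frame +
  assumes bdry_W: "\<lbrakk>n \<le> N; 0 \<le> i; i < n; e \<in> E i\<rbrakk> \<Longrightarrow>
      bdry U n (W n (i, e)) =
        dA (n - i) \<one> \<odot>\<^bsub>C (n - 1)\<^esub> W (n - 1) (i, e)
        \<oplus>\<^bsub>C (n - 1)\<^esub>
        sgn_elt R (n - i) \<odot>\<^bsub>C (n - 1)\<^esub> tate_act R U E W (n - i) (i - 1) \<one> (bdry U i e)"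
begin

lemma bdry_tact_E:
  assumes k: "0 \<le> k" "k + i \<le> N" and i: "0 \<le> i" "e \<in> E i" and a: "a \<in> carrier R"
  shows "bdry U (k + i) (tact k i a e) =
    tact (k - 1) i (dA k a) e \<oplus>\<^bsub>C (k + i - 1)\<^esub>
    sgn_elt R k \<odot>\<^bsub>C (k + i - 1)\<^esub> tact k (i - 1) a (bdry U i e)"
proof -
  have iN: "i \<le> N" "i - 1 \<le> N" using k i by auto
  have e: "e \<in> carrier (C i)" using E_closed[OF i(1) iN(1) i(2)] .
  have de: "bdry U i e \<in> carrier (C (i - 1))" using bdry_closed[OF e] .
  have s: "k + (i - 1) = k + i - 1" "k - 1 + i = k + i - 1" by auto
  have tde: "tact k (i - 1) c (bdry U i e) \<in> carrier (C (k + i - 1))" if "c \<in> carrier R" for c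
    using tact_closed[of "i - 1" k c "bdry U i e"] that de k iN s by simp
  have sm: "a \<odot>\<^bsub>C (k + i - 1)\<^esub> tact k (i - 1) \<one> (bdry U i e) = tact k (i - 1) a (bdry U i e)"
    using tact_smult_left[of "i - 1" k a \<one> "bdry U i e"] de k iN s a by simp
  show ?thesis
  \<comment> \<open>For \<open>k = 0\<close> the product is a scalar multiple of \<open>e\<close>
    and \<open>bdry_W\<close> says nothing; the claim is linearity of the differential.\<close>
  proof (cases "k = 0")
    case True
    then show ?thesis
      using a e de iN bdry_smult tact_degree_zero[of i] tact_degree_zero[of "i - 1"]
        tact_zero_left[of i "-1" e] s
      by (simp add: sgn_elt_def tate_bdry_def)
  next
    case False
    then have k0: "0 \<le> k - 1" "i < k + i" using k by auto
    have W: "W (k + i - 1) (i, e) \<in> carrier (C (k + i - 1))"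
      using k k0 i by (intro W_closed) auto
    have d1: "dA k \<one> \<in> carrier R" using fg by (simp add: tate_bdry_closed)
    have "tact k i a e = a \<odot>\<^bsub>C (k + i)\<^esub> W (k + i) (i, e)"
      using smult_W[of "k + i" i e a] k i a by simp
    then have "bdry U (k + i) (tact k i a e)
        = a \<odot>\<^bsub>C (k + i - 1)\<^esub> bdry U (k + i) (W (k + i) (i, e))"
      using bdry_smult[of a "W (k + i) (i, e)" "k + i"] W_closed[of "k + i" "(i, e)"] k i a by simp
    also have "bdry U (k + i) (W (k + i) (i, e)) =
        dA k \<one> \<odot>\<^bsub>C (k + i - 1)\<^esub> W (k + i - 1) (i, e)
        \<oplus>\<^bsub>C (k + i - 1)\<^esub>
        sgn_elt R k \<odot>\<^bsub>C (k + i - 1)\<^esub> tact k (i - 1) \<one> (bdry U i e)"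
      using bdry_W[OF k(2) i(1) k0(2) i(2)] by simp
    also have "a \<odot>\<^bsub>C (k + i - 1)\<^esub> \<dots> =
        (a \<otimes> dA k \<one>) \<odot>\<^bsub>C (k + i - 1)\<^esub> W (k + i - 1) (i, e)
        \<oplus>\<^bsub>C (k + i - 1)\<^esub>
        sgn_elt R k \<odot>\<^bsub>C (k + i - 1)\<^esub> (a \<odot>\<^bsub>C (k + i - 1)\<^esub> tact k (i - 1) \<one> (bdry U i e))"
      using a d1 W tde[of \<one>]
      by (simp add: U.smult_r_distr U.smult_assoc1[symmetric] m_comm)
    also have "a \<otimes> dA k \<one> = dA k a"
      using tate_bdry_smult[of f g \<one> a k] fg a by simp
    also have "dA k a \<odot>\<^bsub>C (k + i - 1)\<^esub> W (k + i - 1) (i, e)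
        = tact (k - 1) i (dA k a) e"
      using smult_W[of "k + i - 1" i e "dA k a"] k k0 i a fg by (simp add: tate_bdry_closed)
    finally show ?thesis unfolding sm .
  qed
qed

text \<open>By additivity \<open>x\<close> may be taken of the form b e with b in the Tate
  construction and a generator e. Then a (b e) = (a b) e, and the rule for products with e, combined
  with the Leibniz rule for a b in the Tate construction, yields the rule for a acting on b
  e.\<close>

lemma tact_leibniz:
  assumes N: "j \<le> N" "m + j \<le> N" and a: "a \<in> carrier (tate_comp R m)" and x: "x \<in> carrier (C j)"
  shows "bdry U (m + j) (tact m j a x) =
    tact (m - 1) j (dA m a) x \<oplus>\<^bsub>C (m + j - 1)\<^esub>
    sgn_elt R m \<odot>\<^bsub>C (m + j - 1)\<^esub> tact m (j - 1) a (bdry U j x)" (is "?P x")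
proof -
  have aR: "a \<in> carrier R" and N1: "j - 1 \<le> N" "m + (j - 1) \<le> N" "m - 1 + j \<le> N"
    using a N by (auto split: if_splits)
  have dR: "dA m a \<in> carrier R" using fg aR by (simp add: tate_bdry_closed)
  have s: "m + (j - 1) = m + j - 1" "m - 1 + j = m + j - 1" by auto
  have A: "tact m j a y \<in> carrier (C (m + j))"
    "tact (m - 1) j (dA m a) y \<in> carrier (C (m + j - 1))"
    "tact m (j - 1) a (bdry U j y) \<in> carrier (C (m + j - 1))"
    if "y \<in> carrier (C j)" for y
    using tact_closed[OF N aR that] tact_closed[OF N(1) N1(3) dR that]
      tact_closed[OF N1(1,2) aR bdry_closed[OF that]] unfolding s by auto
  show ?thesis
  proof (cases "m < 0")
    case True
    then have a0: "a = \<zero>" using a by simp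
    then have d0: "dA m a = \<zero>" using True by (simp add: tate_bdry_def)
    show ?thesis
      unfolding d0 unfolding a0
      using tact_zero_left[OF N x] tact_zero_left[OF N(1) N1(3) x] tact_zero_left[OF N1(1,2) bdry_closed[OF x]]
        bdry_zero[of "m + j"] s by simp
  next
    case False
    show ?thesis
    proof (rule U.free_basis_induct[OF basis[OF N(1)] x, where P = ?P])
      show "?P \<zero>\<^bsub>C j\<^esub>"
        using tact_zero_right[OF N aR] tact_zero_right[OF N(1) N1(3) dR] tact_zero_right[OF N1(1,2) aR]
          bdry_zero s by simp
    next
      fix y z assume yz: "y \<in> carrier (C j)" "z \<in> carrier (C j)" "?P y" "?P z"
      have t: "tact m j a (y \<oplus>\<^bsub>C j\<^esub> z) = tact m j a y \<oplus>\<^bsub>C (m + j)\<^esub> tact m j a z"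
        "tact (m - 1) j (dA m a) (y \<oplus>\<^bsub>C j\<^esub> z) =
          tact (m - 1) j (dA m a) y \<oplus>\<^bsub>C (m + j - 1)\<^esub> tact (m - 1) j (dA m a) z"
        "tact m (j - 1) a (bdry U j y \<oplus>\<^bsub>C (j - 1)\<^esub> bdry U j z) =
          tact m (j - 1) a (bdry U j y) \<oplus>\<^bsub>C (m + j - 1)\<^esub> tact m (j - 1) a (bdry U j z)"
        using tact_add_right[OF N aR yz(1,2)] tact_add_right[OF N(1) N1(3) dR yz(1,2)]
          tact_add_right[OF N1(1,2) aR bdry_closed[OF yz(1)] bdry_closed[OF yz(2)]]
        unfolding s by auto
      show "?P (y \<oplus>\<^bsub>C j\<^esub> z)"
        using A[OF yz(1)] A[OF yz(2)] yz(3,4) bdry_add[OF yz(1,2)] bdry_add[OF A(1)[OF yz(1)] A(1)[OF yz(2)]]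
        by (simp add: t U.smult_r_distr U.M.add.m_ac)
    next
      fix p assume p: "p \<in> tate_index E j"
      obtain i e where pe: "p = (i, e)" by (cases p)
      then have i: "0 \<le> i" "i \<le> j" "e \<in> E i" using p by auto
      define k b where "k = j - i" and "b = cf j x p"
      have b: "b \<in> carrier R" using cf_closed[OF N(1) x] by (simp add: b_def)
      have k: "0 \<le> k" "0 \<le> m" "0 \<le> m + k" and j: "j = k + i" using i False by (auto simp: k_def)
      have e: "e \<in> carrier (C i)" using i N by (intro E_closed) auto
      have de: "bdry U i e \<in> carrier (C (i - 1))" by (rule bdry_closed[OF e])
      have bk: "b \<in> carrier (tate_comp R k)" and am: "a \<in> carrier (tate_comp R m)" using b a k by auto
      have db: "dA k b \<in> carrier R" "dA k b \<in> carrier (tate_comp R (k - 1))"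
        using fg b k by (auto simp: tate_bdry_closed, auto simp: tate_bdry_def)
      have da: "dA m a \<in> carrier (tate_comp R (m - 1))"
        using fg aR k by (auto simp: tate_bdry_closed, auto simp: tate_bdry_def)
      have ab: "tate_mul R m k a b \<in> carrier R" using aR b by (rule tate_mul_closed)
      have iN: "i \<le> N" "i - 1 \<le> N" "k + i \<le> N" "m + (k + i) \<le> N" "m + k + i \<le> N" "k + (i - 1) \<le> N"
        "m + k + (i - 1) \<le> N" "m - 1 + (k + i) \<le> N" "m - 1 + k + i \<le> N" "k - 1 + i \<le> N"
        "m + (k - 1) + i \<le> N" "m + (k + i - 1) \<le> N" "k + i - 1 \<le> N"
        "m + k - 1 + i \<le> N"
        using N i j k by auto
      let ?n = "m + k + i - 1"
      have ss: "m + (k + i) = m + k + i" "m + k - 1 + i = ?n" "m + k + (i - 1) = ?n" "m - 1 + k = m + k - 1"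
        "m + (k - 1) = m + k - 1" "k - 1 + i = k + i - 1" "k + (i - 1) = k + i - 1" "m + (k + i - 1) = ?n"
        "m - 1 + (k + i) = ?n"
        by auto
      have be: "b \<odot>\<^bsub>C j\<^esub> W j p = tact k i b e"
        using smult_W[of j i e b] N i b pe by (simp add: k_def)
      have beU: "tact k i b e \<in> carrier (C (k + i))"
        "tact (k - 1) i (dA k b) e \<in> carrier (C (k + i - 1))"
        "tact k (i - 1) b (bdry U i e) \<in> carrier (C (k + i - 1))"
        using tact_closed[OF iN(1,3) b e] tact_closed[OF iN(1,10) db(1) e] tact_closed[OF iN(2,6) b de]
        unfolding ss by auto
      let ?X = "tact (m - 1) (k + i) (dA m a) (tact k i b e)"
      let ?Y = "tact m (k + i - 1) a (tact (k - 1) i (dA k b) e)"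
      let ?Z = "tact m (k + i - 1) a (tact k (i - 1) b (bdry U i e))"
      have XYZ: "?X \<in> carrier (C ?n)" "?Y \<in> carrier (C ?n)" "?Z \<in> carrier (C ?n)"
        using tact_closed[OF iN(3,8) dR beU(1)] tact_closed[OF iN(13,12) aR beU(2)]
          tact_closed[OF iN(13,12) aR beU(3)] unfolding ss by auto
      have "tact m (k + i) a (tact k i b e) = tact (m + k) i (tate_mul R m k a b) e"
        by (rule tact_assoc[OF iN(1,3,5) am bk e, symmetric])
      then have "bdry U (m + k + i) (tact m (k + i) a (tact k i b e)) =
          tact (m + k - 1) i (dA (m + k) (tate_mul R m k a b)) e \<oplus>\<^bsub>C ?n\<^esub>
          sgn_elt R (m + k) \<odot>\<^bsub>C ?n\<^esub> tact (m + k) (i - 1) (tate_mul R m k a b) (bdry U i e)"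
        using bdry_tact_E[OF k(3) iN(5) i(1,3) ab] by simp
      also have "tact (m + k) (i - 1) (tate_mul R m k a b) (bdry U i e) = ?Z"
        using tact_assoc[OF iN(2,6,7) am bk de] unfolding ss .
      also have "dA (m + k) (tate_mul R m k a b) =
          tate_mul R (m - 1) k (dA m a) b \<oplus> sgn_elt R m \<otimes> tate_mul R m (k - 1) a (dA k b)"
        using tate_leibniz[OF aR b fg(1,2) k(2,1)] tate_mul_closed[OF aR db(1), of m "k - 1"]
        by (simp add: sgn_elt_def l_minus)
      also have "tact (m + k - 1) i \<dots> e =
          tact (m + k - 1) i (tate_mul R (m - 1) k (dA m a) b) e \<oplus>\<^bsub>C ?n\<^esub>
          sgn_elt R m \<odot>\<^bsub>C ?n\<^esub> tact (m + k - 1) i (tate_mul R m (k - 1) a (dA k b)) e"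
        using tact_add_left[OF iN(1,14) tate_mul_closed[OF dR b], of "sgn_elt R m \<otimes> tate_mul R m (k - 1) a (dA k b)" e "m - 1" k]
          tact_smult_left[OF iN(1,14) sgn_elt_closed tate_mul_closed[OF aR db(1)] e, of m m "k - 1"]
          e tate_mul_closed[OF aR db(1), of m "k - 1"]
        unfolding ss by simp
      also have "tact (m + k - 1) i (tate_mul R (m - 1) k (dA m a) b) e = ?X"
        using tact_assoc[OF iN(1,3,9) da bk e] unfolding ss .
      also have "tact (m + k - 1) i (tate_mul R m (k - 1) a (dA k b)) e = ?Y"
        using tact_assoc[OF iN(1,10,11) am db(2) e] unfolding ss .
      finally have L: "bdry U (m + k + i) (tact m (k + i) a (tact k i b e)) =
          (?X \<oplus>\<^bsub>C ?n\<^esub> sgn_elt R m \<odot>\<^bsub>C ?n\<^esub> ?Y) \<oplus>\<^bsub>C ?n\<^esub>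
          sgn_elt R (m + k) \<odot>\<^bsub>C ?n\<^esub> ?Z" .
      have "tact m (k + i - 1) a (bdry U (k + i) (tact k i b e)) =
          ?Y \<oplus>\<^bsub>C ?n\<^esub> sgn_elt R k \<odot>\<^bsub>C ?n\<^esub> ?Z"
        unfolding bdry_tact_E[OF k(1) iN(3) i(1,3) b]
        using tact_add_right[OF iN(13,12) aR beU(2), of "sgn_elt R k \<odot>\<^bsub>C (k + i - 1)\<^esub> tact k (i - 1) b (bdry U i e)"]
          tact_smult_right[OF iN(13,12) sgn_elt_closed aR beU(3), of k] beU(3) unfolding ss by simp
      then have "?X \<oplus>\<^bsub>C ?n\<^esub> sgn_elt R m \<odot>\<^bsub>C ?n\<^esub>
          tact m (k + i - 1) a (bdry U (k + i) (tact k i b e)) =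
          (?X \<oplus>\<^bsub>C ?n\<^esub> sgn_elt R m \<odot>\<^bsub>C ?n\<^esub> ?Y) \<oplus>\<^bsub>C ?n\<^esub>
          sgn_elt R (m + k) \<odot>\<^bsub>C ?n\<^esub> ?Z"
        using XYZ by (simp add: U.smult_r_distr U.smult_assoc1 sgn_elt_add U.M.a_assoc)
      then show "?P (cf j x p \<odot>\<^bsub>C j\<^esub> W j p)"
        using L unfolding b_def[symmetric] be unfolding j ss by simp
    qed
  qed
qed

end

section \<open>Construction of the basis on a minimal resolution\<close>

lemma module_hom_lincomb:
  assumes "module R M" "module R N" "h \<in> module_hom R M N"
    and "finite I" "b \<in> I \<rightarrow> carrier M" "c \<in> I \<rightarrow> carrier R"
  shows "h (lincomb M b I c) = lincomb N (\<lambda>i. h (b i)) I c"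
  using assms(4-6)
proof (induction I rule: finite_induct)
  case empty
  interpret M: module R M by fact
  interpret N: module R N by fact
  show ?case using module_hom_zero[OF assms(1-3)] by simp
next
  case (insert i I)
  interpret M: module R M by fact
  interpret N: module R N by fact
  note h = module_homD[OF assms(3)]
  have "lincomb M b (insert i I) c = c i \<odot>\<^bsub>M\<^esub> b i \<oplus>\<^bsub>M\<^esub> lincomb M b I c"
    using insert by (intro M.lincomb_insert) auto
  moreover have "lincomb N (\<lambda>i. h (b i)) (insert i I) c = c i \<odot>\<^bsub>N\<^esub> h (b i) \<oplus>\<^bsub>N\<^esub> lincomb N (\<lambda>i. h (b i)) I c"
    using insert h(1) by (intro N.lincomb_insert) auto
  moreover have "h (lincomb M b I c) = lincomb N (\<lambda>i. h (b i)) I c"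
    using insert by auto
  moreover have "b i \<in> carrier M" "c i \<in> carrier R" "lincomb M b I c \<in> carrier M"
    using insert by auto
  ultimately show ?case using h(2,3) by simp
qed

lemma (in ring) ideal_finsum_diff:
  assumes "ideal J R" "finite A" "t \<in> A \<rightarrow> carrier R" "(\<Oplus>a\<in>A. t a) \<in> J" "a \<in> A"
    and "\<And>b. \<lbrakk>b \<in> A; b \<noteq> a\<rbrakk> \<Longrightarrow> t b \<in> J"
  shows "t a \<in> J"
proof -
  interpret J: ideal J R by fact
  have "(\<Oplus>a\<in>insert a (A - {a}). t a) = t a \<oplus> (\<Oplus>b\<in>A - {a}. t b)"
    using assms by (intro finsum_insert) auto
  then have "(\<Oplus>a\<in>A. t a) = t a \<oplus> (\<Oplus>b\<in>A - {a}. t b)"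
    using assms(5) by (simp add: insert_absorb)
  moreover have s: "(\<Oplus>b\<in>B. t b) \<in> J" if "finite B" "B \<subseteq> A - {a}" for B
    using that
  proof (induction B rule: finite_induct)
    case (insert b B)
    then show ?case using assms by (subst finsum_insert) (auto simp: Pi_iff)
  qed simp
  ultimately have "t a = (\<Oplus>a\<in>A. t a) \<ominus> (\<Oplus>b\<in>A - {a}. t b)"
    using assms J.Icarr[OF s[of "A - {a}"]] by (simp add: minus_eq a_assoc r_neg Pi_iff)
  also have "\<dots> \<in> J"
    unfolding minus_eq using assms(2,4) s[of "A - {a}"] by auto
  finally show ?thesis .
qed

lemma (in cring) tate_mul_ideal:
  assumes "ideal J R" "a \<in> carrier R" "b \<in> J"
  shows "tate_mul R i j a b \<in> J"
proof -
  interpret J: ideal J R by fact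
  have "add_pow R k (a \<otimes> b) = (add_pow R k a) \<otimes> b" for k :: nat
    using assms J.Icarr by (simp add: add_pow_ldistr)
  then show ?thesis
    using assms by (auto simp: tate_mul_def J.I_l_closed)
qed

lemma tate_act_cong:
  assumes "\<And>j. j \<le> N \<Longrightarrow> E' j = E j \<and> W' j = W j" "n \<le> N" "m + n \<le> N"
  shows "tate_act R U E' W' m n a x = tate_act R U E W m n a x"
proof -
  have "tate_index E' j = tate_index E j" if "j \<le> N" for j
    using assms(1) that by (auto simp: tate_index_def)
  then show ?thesis using assms by (simp add: tate_act_def)
qed

text \<open>No condition up to degree \<open>N\<close> mentions a choice in a higher degree. This
  permits overwriting the data in degree \<open>N + 1\<close> and pasting the stages of the
  induction.\<close>

lemma tate_basis_cong:
  assumes "tate_basis R U f g N E W" and eq: "\<And>j. j \<le> N \<Longrightarrow> E' j = E j \<and> W' j = W j"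
  shows "tate_basis R U f g N E' W'"
proof -
  interpret tate_basis R U f g N E W by fact
  have idx: "tate_index E' j = tate_index E j" if "j \<le> N" for j
    using eq that by (auto simp: tate_index_def)
  show ?thesis
  proof unfold_locales
    fix n i e assume n: "n \<le> N" "0 \<le> i" "i < n" "e \<in> E' i"
    have "tate_act R U E' W' (n - i) (i - 1) \<one>\<^bsub>R\<^esub> (bdry U i e) =
        tate_act R U E W (n - i) (i - 1) \<one>\<^bsub>R\<^esub> (bdry U i e)"
      using n by (intro tate_act_cong[where N = N] eq) auto
    then show "bdry U n (W' n (i, e)) =
        tate_bdry R f g (n - i) \<one>\<^bsub>R\<^esub> \<odot>\<^bsub>component U (n - 1)\<^esub> W' (n - 1) (i, e)
        \<oplus>\<^bsub>component U (n - 1)\<^esub>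
        sgn_elt R (n - i) \<odot>\<^bsub>component U (n - 1)\<^esub> tate_act R U E' W' (n - i) (i - 1) \<one>\<^bsub>R\<^esub> (bdry U i e)"
      using n bdry_W[of n i e] eq by simp
  qed (use fg basis W_diag eq idx in auto)
qed

text \<open>The resolved module leaves only one trace, \<open>smult_f\<close>: since
  \<open>f\<close> annihilates the module, multiplication by \<open>f\<close> is zero on the
  homology in degree zero.\<close>

locale minimal_complex = noetherian_local_ring R \<mm> + chain_complex R U
  for R :: "('a, 'x) ring_scheme" (structure) and \<mm> and U :: "('a, 'u) chain_complex" +
  fixes f g :: 'a
  assumes f: "f \<in> \<mm> - \<mm> \<cdot> \<mm>" and g: "g \<in> \<mm> - \<mm> \<cdot> \<mm>" and f_g: "f \<otimes> g = \<zero>"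
    and finite_free: "finite_free_module R (component U n)"
    and concentrated: "concentrated_ge 0 U"
    and acyclic: "n > 0 \<Longrightarrow> cycles U n = boundaries U n"
    and smult_f: "x \<in> carrier (component U 0) \<Longrightarrow> f \<odot>\<^bsub>component U 0\<^esub> x \<in> boundaries U 0"
    and minimal: "bdry U n ` carrier (component U n) \<subseteq> ideal_times_module R \<mm> (component U (n - 1))"
begin

abbreviation C :: "int \<Rightarrow> ('a, 'u) module"
  where "C \<equiv> component U"

abbreviation dA :: "int \<Rightarrow> 'a \<Rightarrow> 'a"
  where "dA \<equiv> tate_bdry R f g"

lemma fg_closed: "f \<in> carrier R" "g \<in> carrier R"
  using f g additive_subgroup.a_Hcarr[OF ideal.axioms(1)[OF maximal_ideal]] by auto

lemma tate_bdry_one_not_in_square: "n > 0 \<Longrightarrow> dA n \<one> \<notin> \<mm> \<cdot> \<mm>"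
  using f g fg_closed by (simp add: tate_bdry_def)

lemma square_ideal: "ideal (\<mm> \<cdot> \<mm>) R"
  by (rule ideal_prod_is_ideal[OF maximal_ideal maximal_ideal])

section \<open>The passage from degree N to degree N + 1\<close>

context
  fixes N :: int and E :: "int \<Rightarrow> 'u set" and W :: "int \<Rightarrow> int \<times> 'u \<Rightarrow> 'u"
  assumes N: "N \<ge> -1" and tb: "tate_basis R U f g N E W"
begin

interpretation T: tate_basis R U f g N E W by (rule tb)

text \<open>The value that the Leibniz rule prescribes for the boundary of the product of degree
  \<open>N + 1\<close> with label \<open>p\<close>.\<close>

definition lift_target :: "int \<times> 'u \<Rightarrow> 'u"
  where "lift_target p =
    dA (N + 1 - fst p) \<one> \<odot>\<^bsub>C N\<^esub> W N p
    \<oplus>\<^bsub>C N\<^esub>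
    sgn_elt R (N + 1 - fst p) \<odot>\<^bsub>C N\<^esub>
      T.tact (N + 1 - fst p) (fst p - 1) \<one> (bdry U (fst p) (snd p))"

lemma index_cases:
  assumes "p \<in> tate_index E N"
  obtains i e where "p = (i, e)" "0 \<le> i" "i \<le> N" "e \<in> E i"
    "e \<in> carrier (C i)" "bdry U i e \<in> carrier (C (i - 1))"
  using assms T.E_closed T.bdry_closed by (cases p) (auto simp: tate_index_def)

lemma lift_target_summands_closed:
  assumes "p \<in> tate_index E N"
  shows "W N p \<in> carrier (C N)"
    and "T.tact (N + 1 - fst p) (fst p - 1) \<one> (bdry U (fst p) (snd p)) \<in> carrier (C N)"
    and "dA (N + 1 - fst p) \<one> \<in> carrier R"
proof -
  obtain i e where p: "p = (i, e)" "0 \<le> i" "i \<le> N" "e \<in> E i"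
    "e \<in> carrier (C i)" "bdry U i e \<in> carrier (C (i - 1))"
    using index_cases[OF assms] .
  show "W N p \<in> carrier (C N)" using assms by (intro T.W_closed) auto
  show "T.tact (N + 1 - fst p) (fst p - 1) \<one> (bdry U (fst p) (snd p)) \<in> carrier (C N)"
    using T.tact_closed[of "i - 1" "N + 1 - i" \<one> "bdry U i e"] p by simp
  show "dA (N + 1 - fst p) \<one> \<in> carrier R" using fg_closed by (simp add: tate_bdry_closed)
qed

lemma lift_target_closed: "p \<in> tate_index E N \<Longrightarrow> lift_target p \<in> carrier (C N)"
  using lift_target_summands_closed[of p] by (simp add: lift_target_def)

text \<open>As both differentials square to zero, each of the two summands of the target has, up to
  sign, the same boundary \<open>Z\<close>. The signs are those of \<open>k - 1\<close> and of
  \<open>k\<close>, so the terms cancel.\<close>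

lemma bdry_lift_target:
  assumes "p \<in> tate_index E N"
  shows "bdry U N (lift_target p) = \<zero>\<^bsub>C (N - 1)\<^esub>"
proof -
  obtain i e where p: "p = (i, e)" and i: "0 \<le> i" "i \<le> N" "e \<in> E i"
    and e: "e \<in> carrier (C i)" "bdry U i e \<in> carrier (C (i - 1))"
    using index_cases[OF assms] .
  define k d where "k = N + 1 - i" and "d = dA k \<one>"
  have k: "0 \<le> k - 1" "k - 1 + i \<le> N" "k + (i - 1) \<le> N" "i - 1 \<le> N" "k + (i - 1 - 1) \<le> N"
    "k - 1 + (i - 1) \<le> N" "i - 1 - 1 \<le> N" "k - 1 + (i - 1) = N - 1"
    using i by (auto simp: k_def)
  have Nk: "k - 1 + i = N" "k + (i - 1) = N" by (auto simp: k_def)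
  have d: "d \<in> carrier R" using fg_closed by (simp add: d_def tate_bdry_closed)
  have dd: "dA (k - 1) d = \<zero>"
    using tate_bdry_bdry[of f g \<one> k] fg_closed f_g by (simp add: d_def)
  define Z where "Z = T.tact (k - 1) (i - 1) d (bdry U i e)"
  have Z: "Z \<in> carrier (C (N - 1))"
    using T.tact_closed[OF k(4,6) d e(2)] unfolding Z_def k(8) .
  have 1: "bdry U N (T.tact (k - 1) i d e) = sgn_elt R (k - 1) \<odot>\<^bsub>C (N - 1)\<^esub> Z"
    using T.bdry_tact_E[OF k(1,2) i(1,3) d] T.tact_zero_left[of i "k - 1 - 1" e] i e Z k(2)
    unfolding dd Nk Z_def[symmetric] by (simp add: k_def)
  have 2: "bdry U N (T.tact k (i - 1) \<one> (bdry U i e)) = Z"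
    using T.tact_leibniz[OF k(4,3) _ e(2), of \<one>] T.tact_zero_right[OF k(7,5) one_closed] bdry_bdry[OF e(1)] k(1) Z
    unfolding Nk d_def[symmetric] Z_def[symmetric] by (simp add: k_def)
  have 3: "T.tact (k - 1) i d e \<in> carrier (C N)"
    "T.tact k (i - 1) \<one> (bdry U i e) \<in> carrier (C N)"
    using T.tact_closed[OF _ k(2) d e(1)] T.tact_closed[OF k(4,3) one_closed e(2)] i unfolding Nk by auto
  have "d \<odot>\<^bsub>C N\<^esub> W N (i, e) = T.tact (k - 1) i d e"
    using T.smult_W[of N i e d] i d by (simp add: k_def)
  then have "lift_target p = T.tact (k - 1) i d e \<oplus>\<^bsub>C N\<^esub>
      sgn_elt R k \<odot>\<^bsub>C N\<^esub> T.tact k (i - 1) \<one> (bdry U i e)"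
    unfolding lift_target_def p by (simp add: k_def[symmetric] d_def[symmetric])
  also have "bdry U N \<dots> = sgn_elt R (k - 1) \<odot>\<^bsub>C (N - 1)\<^esub> Z \<oplus>\<^bsub>C (N - 1)\<^esub>
      sgn_elt R k \<odot>\<^bsub>C (N - 1)\<^esub> Z"
    using 3 by (simp add: T.bdry_add T.bdry_smult 1 2)
  also have "\<dots> = \<zero>\<^bsub>C (N - 1)\<^esub>"
    using Z by (auto simp: sgn_elt_def T.U.smult_l_minus T.U.M.l_neg T.U.M.r_neg)
  finally show ?thesis .
qed

text \<open>Exactness settles positive \<open>N\<close>. Otherwise the existence of an index forces
  \<open>N = 0\<close> and \<open>i = 0\<close>, where being a cycle is not enough. The target is
  then \<open>f\<close> times a generator, because the boundary of the generator lies in a zero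
  module, and \<open>smult_f\<close> applies.\<close>

lemma lift_target_boundary:
  assumes "p \<in> tate_index E N"
  shows "lift_target p \<in> boundaries U N"
proof (cases "N > 0")
  case True
  then show ?thesis
    using lift_target_closed[OF assms] bdry_lift_target[OF assms] acyclic[of N] by (auto simp: cycles_def)
next
  case False
  obtain i e where p: "p = (i, e)" and i: "0 \<le> i" "i \<le> N" "e \<in> E i"
    and e: "e \<in> carrier (C i)" "bdry U i e \<in> carrier (C (i - 1))"
    using index_cases[OF assms] .
  have N0: "N = 0" "i = 0" using False i N by auto
  have "bdry U i e = \<zero>\<^bsub>C (i - 1)\<^esub>"
    using e(2) N0 concentrated by (auto simp: concentrated_ge_def)
  then have "T.tact (N + 1 - i) (i - 1) \<one> (bdry U i e) = \<zero>\<^bsub>C N\<^esub>"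
    using T.tact_zero_right[of "i - 1" "N + 1 - i" \<one>] N0 by simp
  then have "lift_target p = f \<odot>\<^bsub>C 0\<^esub> e"
    using T.W_diag[of i e] i e N0 fg_closed unfolding lift_target_def p by (simp add: tate_bdry_def)
  then show ?thesis using smult_f[of e] e N0 by simp
qed

lemma cf_bdry_in_maximal: "x \<in> carrier (C n) \<Longrightarrow> n - 1 \<le> N \<Longrightarrow> T.cf (n - 1) (bdry U n x) p \<in> \<mm>"
  using minimal[of n] by (intro ideal_times_module_coord(2)[OF comp_module maximal_ideal T.basis]) auto

text \<open>Minimality puts one factor of the maximal ideal into the boundary, and the coefficients
  of \<open>x\<close> contribute a second one.\<close>

lemma cf_bdry_in_square:
  assumes "x \<in> ideal_times_module R \<mm> (C (N + 1))"
  shows "T.cf N (bdry U (N + 1) x) p \<in> \<mm> \<cdot> \<mm>"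
proof -
  interpret S: ideal "\<mm> \<cdot> \<mm>" R by (rule square_ideal)
  let ?K = "{x \<in> carrier (C (N + 1)). \<forall>p. T.cf N (bdry U (N + 1) x) p \<in> \<mm> \<cdot> \<mm>}"
  have m: "r \<in> carrier R" if "r \<in> \<mm>" for r
    using that by (rule ideal.Icarr[OF maximal_ideal])
  have bd: "bdry U (N + 1) x \<in> carrier (C N)" if "x \<in> carrier (C (N + 1))" for x
    using T.bdry_closed[OF that] by simp
  have s: "bdry U (N + 1) (x \<oplus>\<^bsub>C (N + 1)\<^esub> y) = bdry U (N + 1) x \<oplus>\<^bsub>C N\<^esub> bdry U (N + 1) y"
    if "x \<in> carrier (C (N + 1))" "y \<in> carrier (C (N + 1))" for x y
    using T.bdry_add[OF that] by simp
  have r: "bdry U (N + 1) (r \<odot>\<^bsub>C (N + 1)\<^esub> x) = r \<odot>\<^bsub>C N\<^esub> bdry U (N + 1) x"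
    if "r \<in> carrier R" "x \<in> carrier (C (N + 1))" for r x
    using T.bdry_smult[OF that] by simp
  have closed: "r \<odot>\<^bsub>C (N + 1)\<^esub> x \<in> ?K" if "r \<in> carrier R" "x \<in> ?K" for r x
    using that bd by (auto simp: r T.cf_simps S.I_l_closed)
  have "submodule ?K R (C (N + 1))"
  proof (rule T.U.submoduleI)
    show "\<zero>\<^bsub>C (N + 1)\<^esub> \<in> ?K" using T.bdry_zero[of "N + 1"] by (simp add: T.cf_simps)
    show "\<ominus>\<^bsub>C (N + 1)\<^esub> a \<in> ?K" if "a \<in> ?K" for a
      using closed[of "\<ominus> \<one>" a] that by (simp add: T.U.smult_l_minus)
    show "a \<oplus>\<^bsub>C (N + 1)\<^esub> b \<in> ?K" if "a \<in> ?K" "b \<in> ?K" for a b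
      using that bd by (auto simp: s T.cf_simps)
  qed (use closed in auto)
  then have "ideal_times_module R \<mm> (C (N + 1)) \<subseteq> ?K"
  proof (rule ideal_times_module_minimal)
    fix r x assume rx: "r \<in> \<mm>" "x \<in> carrier (C (N + 1))"
    then show "r \<odot>\<^bsub>C (N + 1)\<^esub> x \<in> ?K"
      using m[OF rx(1)] bd[OF rx(2)] cf_bdry_in_maximal[of x "N + 1"]
      by (auto simp: r T.cf_simps intro: ideal_prod.prod)
  qed
  then have "x \<in> ?K" using assms by (rule subsetD)
  then show ?thesis by blast
qed

text \<open>The matrix of targets is triangular for the degree of the generators: the second term
  vanishes unless \<open>fst q < fst p\<close>, since its Tate degree is negative otherwise. The
  diagonal entries are \<open>f\<close> or \<open>g\<close>.\<close>

lemma cf_lift_target: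
  assumes "p \<in> tate_index E N"
  shows "T.cf N (lift_target p) q =
    (if q = p then dA (N + 1 - fst p) \<one> else \<zero>) \<oplus>
    sgn_elt R (N + 1 - fst p) \<otimes>
      tate_mul R (N + 1 - fst p) (fst p - 1 - fst q) \<one> (T.cf (fst p - 1) (bdry U (fst p) (snd p)) q)"
proof -
  obtain i e where p: "p = (i, e)" and i: "0 \<le> i" "i \<le> N" "e \<in> E i"
    and e: "e \<in> carrier (C i)" "bdry U i e \<in> carrier (C (i - 1))"
    using index_cases[OF assms] .
  have "T.cf N (W N p) q = (if q = p then \<one> else \<zero>)"
    using T.U.coord_basis[OF T.basis assms] by simp
  moreover have "T.cf N (T.tact (N + 1 - i) (i - 1) \<one> (bdry U i e)) q =
      tate_mul R (N + 1 - i) (i - 1 - fst q) \<one> (T.cf (i - 1) (bdry U i e) q)"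
    using T.cf_tact[of "i - 1" "N + 1 - i" \<one> "bdry U i e" q] i e by simp
  ultimately show ?thesis
    using lift_target_summands_closed[OF assms] by (simp add: lift_target_def T.cf_simps p)
qed

text \<open>Among the indices with a unit coefficient choose one, \<open>q\<close>, whose basis element of \<open>E\<close> has
  maximal degree. Modulo \<open>\<mm>\<^sup>2\<close>, the coordinate at \<open>q\<close> of the boundary of the combination is then
  that unit times \<open>f\<close> or \<open>g\<close>.\<close>

lemma lifts_independent:
  assumes w: "w \<in> tate_index E N \<rightarrow> carrier (C (N + 1))"
    and bdry_w: "\<And>p. p \<in> tate_index E N \<Longrightarrow> bdry U (N + 1) (w p) = lift_target p"
    and c: "c \<in> tate_index E N \<rightarrow> carrier R"
    and L: "lincomb (C (N + 1)) w (tate_index E N) c \<in> ideal_times_module R \<mm> (C (N + 1))"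
    and p: "p \<in> tate_index E N"
  shows "c p \<in> \<mm>"
proof (rule ccontr)
  let ?J = "tate_index E N"
  assume "c p \<notin> \<mm>"
  have fin: "finite ?J" using T.U.free_basis_finite[OF T.basis] by simp
  let ?S = "{q \<in> ?J. c q \<notin> \<mm>}"
  have "p \<in> ?S" using p \<open>c p \<notin> \<mm>\<close> by simp
  then have S: "finite ?S" "?S \<noteq> {}" using fin by (simp, blast)
  obtain q where q: "q \<in> ?J" "c q \<notin> \<mm>" and max: "\<And>r. \<lbrakk>r \<in> ?J; c r \<notin> \<mm>\<rbrakk> \<Longrightarrow> fst r \<le> fst q"
  proof -
    have "Max (fst ` ?S) \<in> fst ` ?S" using S by (intro Max_in) auto
    then obtain q where "q \<in> ?S" "fst q = Max (fst ` ?S)" by force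
    moreover have "fst r \<le> Max (fst ` ?S)" if "r \<in> ?S" for r using that S by simp
    ultimately show thesis using that[of q] by simp
  qed
  let ?t = "\<lambda>r. c r \<otimes> T.cf N (lift_target r) q"
  have lt: "lift_target r \<in> carrier (C N)" if "r \<in> ?J" for r
    using lift_target_closed that .
  have "bdry U (N + 1) (lincomb (C (N + 1)) w ?J c) =
      lincomb (C (N + 1 - 1)) (\<lambda>r. bdry U (N + 1) (w r)) ?J c"
    by (rule module_hom_lincomb[OF comp_module comp_module bdry_hom fin w c])
  also have "\<dots> = lincomb (C N) lift_target ?J c"
    using c bdry_w lt by (simp, intro T.U.lincomb_cong) auto
  finally have bd: "bdry U (N + 1) (lincomb (C (N + 1)) w ?J c) =
      (\<Oplus>\<^bsub>C N\<^esub>r\<in>?J. c r \<odot>\<^bsub>C N\<^esub> lift_target r)"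
    by (simp add: lincomb_def)
  have t: "?t r \<in> carrier R" if "r \<in> ?J" for r
    using c that by (intro m_closed T.cf_closed[OF order.refl lt[OF that]]) auto
  have "T.cf N (bdry U (N + 1) (lincomb (C (N + 1)) w ?J c)) q =
      (\<Oplus>r\<in>?J. T.cf N (c r \<odot>\<^bsub>C N\<^esub> lift_target r) q)"
    unfolding bd using fin c lt by (intro T.U.coord_finsum[OF T.basis]) auto
  also have "\<dots> = (\<Oplus>r\<in>?J. ?t r)"
    using c lt t by (intro finsum_cong') (auto simp: T.cf_simps Pi_iff)
  finally have sum_t: "(\<Oplus>r\<in>?J. ?t r) \<in> \<mm> \<cdot> \<mm>"
    using cf_bdry_in_square[OF L, of q] by simp
  have "?t q \<in> \<mm> \<cdot> \<mm>"
  proof (rule ideal_finsum_diff[where t = ?t, OF square_ideal fin _ sum_t q(1)])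
    show "?t \<in> ?J \<rightarrow> carrier R" using t by auto
    fix r assume r: "r \<in> ?J" "r \<noteq> q"
    obtain i e where re: "r = (i, e)" and i: "0 \<le> i" "i \<le> N" "e \<in> E i"
      and e: "e \<in> carrier (C i)" "bdry U i e \<in> carrier (C (i - 1))"
      using index_cases[OF r(1)] .
    have cr: "c r \<in> carrier R" using c r by auto
    let ?u = "tate_mul R (N + 1 - i) (i - 1 - fst q) \<one> (T.cf (i - 1) (bdry U i e) q)"
    have u: "?u \<in> \<mm>"
      using cf_bdry_in_maximal[OF e(1)] i by (intro tate_mul_ideal[OF maximal_ideal]) auto
    have uR: "?u \<in> carrier R" using u by (rule ideal.Icarr[OF maximal_ideal])
    have tr: "?t r = c r \<otimes> (sgn_elt R (N + 1 - i) \<otimes> ?u)"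
      using cf_lift_target[OF r(1), of q] r(2) uR unfolding re by auto
    \<comment> \<open>If \<open>c r\<close> lies in the maximal ideal, it meets an entry from the
      maximal ideal. If not, \<open>q\<close> is at least as high as \<open>r\<close>, and the entry
      is zero by triangularity.\<close>
    show "?t r \<in> \<mm> \<cdot> \<mm>"
    proof (cases "c r \<in> \<mm>")
      case True
      have "sgn_elt R (N + 1 - i) \<otimes> ?u \<in> \<mm>"
        using u by (intro ideal.I_l_closed[OF maximal_ideal]) auto
      then show ?thesis unfolding tr using True by (intro ideal_prod.prod)
    next
      case False
      then have "i \<le> fst q" using max[OF r(1)] by (simp add: re)
      then have "?u = \<zero>" by (intro tate_mul_neg) auto
      then show ?thesis unfolding tr using cr additive_subgroup.zero_closed[OF ideal.axioms(1)[OF square_ideal]] by simp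
    qed
  qed
  let ?d = "dA (N + 1 - fst q) \<one>"
  have d: "?d \<in> carrier R" using fg_closed by (simp add: tate_bdry_closed)
  have "T.cf N (lift_target q) q = ?d"
    using cf_lift_target[OF q(1), of q] d by (simp add: tate_mul_neg)
  then have cd: "c q \<otimes> ?d \<in> \<mm> \<cdot> \<mm>" using \<open>?t q \<in> \<mm> \<cdot> \<mm>\<close> by simp
  have cq: "c q \<in> Units R" using q c by (intro not_in_maximal_unit) auto
  then have "inv (c q) \<otimes> (c q \<otimes> ?d) = ?d"
    using d by (simp add: m_assoc[symmetric] Units_closed)
  then have "?d \<in> \<mm> \<cdot> \<mm>"
    using ideal.I_l_closed[OF square_ideal cd, of "inv (c q)"] cq by simp
  moreover have "fst q \<le> N" using index_cases[OF q(1)] by (metis fst_conv)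
  ultimately show False using tate_bdry_one_not_in_square[of "N + 1 - fst q"] by simp
qed

lemma tate_basis_step:
  assumes E: "\<And>i. i < 0 \<Longrightarrow> E i = {}"
  shows "\<exists>E' W'. tate_basis R U f g (N + 1) E' W' \<and> (\<forall>i<0. E' i = {}) \<and> (\<forall>j\<le>N. E' j = E j \<and> W' j = W j)"
proof -
  let ?n = "N + 1" and ?J = "tate_index E N"
  have "\<exists>x. x \<in> carrier (C ?n) \<and> bdry U ?n x = lift_target p" if "p \<in> ?J" for p
    using lift_target_boundary[OF that] by (auto simp: boundaries_def)
  then obtain w where w: "\<And>p. p \<in> ?J \<Longrightarrow> w p \<in> carrier (C ?n) \<and> bdry U ?n (w p) = lift_target p"
    by metis
  \<comment> \<open>Lifts carry the label of the product they stand for. A candidate for a new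
    generator is labelled by its degree and itself, so that \<open>snd\<close> returns the vector
    and \<open>W_diag\<close> holds by construction.\<close>
  define b where "b = (\<lambda>p. if p \<in> ?J then w p else snd p)"
  obtain B where B: "free_basis R (C ?n) (\<lambda>x. x) B"
    using finite_free[of ?n] finite_free_module_iff[OF comp_module one_not_zero] by blast
  have "bij_betw snd ({?n} \<times> B) B" by (auto simp: bij_betw_def inj_on_def image_iff)
  then have "free_basis R (C ?n) ((\<lambda>x. x) \<circ> snd) ({?n} \<times> B)"
    by (rule T.U.free_basis_reindex[OF B])
  then have fb: "free_basis R (C ?n) b ({?n} \<times> B)"
    by (rule T.U.free_basis_cong) (auto simp: b_def)
  have bJ: "lincomb (C ?n) w ?J c = lincomb (C ?n) b ?J c"
    if "c \<in> ?J \<rightarrow> carrier R" for c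
    using that w by (intro T.U.lincomb_cong) (auto simp: b_def)
  have "\<exists>B'\<subseteq>{?n} \<times> B. free_basis R (C ?n) b (?J \<union> B')"
  proof (rule extend_to_basis[OF comp_module fb])
    show "finite ?J" using T.U.free_basis_finite[OF T.basis] by simp
    show "?J \<inter> {?n} \<times> B = {}" by auto
    show "b \<in> ?J \<rightarrow> carrier (C ?n)" using w by (auto simp: b_def)
    fix c p assume c: "c \<in> ?J \<rightarrow> carrier R"
      "lincomb (C ?n) b ?J c \<in> ideal_times_module R \<mm> (C ?n)" "p \<in> ?J"
    show "c p \<in> \<mm>"
      using lifts_independent[of w c p] w c bJ[OF c(1)] by auto
  qed
  then obtain B' where B': "B' \<subseteq> {?n} \<times> B" "free_basis R (C ?n) b (?J \<union> B')" by auto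
  define E' where "E' = E(?n := snd ` B')"
  define W' where "W' = W(?n := b)"
  have eq: "E' j = E j \<and> W' j = W j" if "j \<le> N" for j
    using that by (auto simp: E'_def W'_def)
  have "?J \<union> B' = tate_index E' ?n"
  proof -
    have "B' = {?n} \<times> snd ` B'" using B'(1) by force
    then have "\<forall>i e. (i, e) \<in> ?J \<union> B' \<longleftrightarrow> (i, e) \<in> tate_index E' ?n"
      using N by (auto simp: E'_def)
    then show ?thesis unfolding set_eq_iff split_paired_All .
  qed
  then have fb': "free_basis R (C ?n) (W' ?n) (tate_index E' ?n)"
    using B' by (simp add: W'_def)
  \<comment> \<open>The update leaves all degrees up to \<open>N\<close> untouched, so only degree
    \<open>N + 1\<close> remains to be checked.\<close>
  interpret T': tate_basis R U f g N E' W' by (rule tate_basis_cong[OF tb eq])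
  have "tate_basis R U f g ?n E' W'"
  proof unfold_locales
    show "f \<in> carrier R" "g \<in> carrier R" "f \<otimes> g = \<zero>" using fg_closed f_g by auto
    show "free_basis R (C n) (W' n) (tate_index E' n)" if "n \<le> ?n" for n
      using T'.basis[of n] fb' that by (cases "n = ?n") auto
    show "W' i (i, e) = e" if "0 \<le> i" "i \<le> ?n" "e \<in> E' i" for i e
      using T'.W_diag[of i e] that by (cases "i = ?n") (auto simp: W'_def b_def)
    fix n i e assume n: "n \<le> ?n" "0 \<le> i" "i < n" "e \<in> E' i"
    show "bdry U n (W' n (i, e)) =
        dA (n - i) \<one> \<odot>\<^bsub>C (n - 1)\<^esub> W' (n - 1) (i, e)
        \<oplus>\<^bsub>C (n - 1)\<^esub>
        sgn_elt R (n - i) \<odot>\<^bsub>C (n - 1)\<^esub> tate_act R U E' W' (n - i) (i - 1) \<one> (bdry U i e)"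
    proof (cases "n = ?n")
      case True
      then have p: "(i, e) \<in> ?J" using n eq[of i] by auto
      have "tate_act R U E' W' (?n - i) (i - 1) \<one> (bdry U i e) = tate_act R U E W (?n - i) (i - 1) \<one> (bdry U i e)"
        using n True by (intro tate_act_cong[OF eq]) auto
      moreover have "W' N = W N" using eq by auto
      ultimately show ?thesis
        using w[OF p] p unfolding True by (simp add: W'_def b_def lift_target_def)
    qed (use T'.bdry_W n in auto)
  qed
  moreover have "\<forall>i<0. E' i = {}" using E N by (auto simp: E'_def)
  ultimately show ?thesis using eq by auto
qed

end

text \<open>Successive stages agree in the degrees already treated, so each degree is read off from
  the first stage that reaches it, and every finite range of degrees coincides with that of a single
  stage.\<close>

lemma tate_basis_exists:
  "\<exists>E W. (\<forall>i<0. E i = {}) \<and> (\<forall>N. tate_basis R U f g N E W)"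
proof -
  \<comment> \<open>Stage \<open>n\<close> reaches degree \<open>n - 1\<close>. Stage zero thus
    concerns only negative degrees, where \<open>U\<close> vanishes and no generators are
    needed.\<close>
  let ?P = "\<lambda>n s. tate_basis R U f g (int n - 1) (fst s) (snd s) \<and> (\<forall>i<0. fst s i = {})"
  let ?Q = "\<lambda>n s s'. \<forall>j\<le>int n - 1. fst s' j = fst s j \<and> snd s' j = snd s j"
  have "\<exists>s. \<forall>n. ?P n (s n) \<and> ?Q n (s n) (s (Suc n))"
  proof (rule dependent_nat_choice)
    have "tate_basis R U f g (-1) (\<lambda>_. {}) (\<lambda>_. snd)"
    proof unfold_locales
      show "f \<in> carrier R" "g \<in> carrier R" "f \<otimes> g = \<zero>" using fg_closed f_g by auto
      show "free_basis R (C n) snd (tate_index (\<lambda>_. {}) n)" if "n \<le> -1" for n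
      proof -
        interpret module R "C n" by (rule comp_module)
        have "carrier (C n) = {\<zero>\<^bsub>C n\<^esub>}"
          using concentrated that by (auto simp: concentrated_ge_def)
        then show ?thesis by (auto simp: tate_index_def free_basis_def)
      qed
    qed auto
    then show "\<exists>s. ?P 0 s" by (intro exI[of _ "(\<lambda>_. {}, \<lambda>_. snd)"]) simp
  next
    fix s n assume s: "?P n s"
    then obtain E' W' where "tate_basis R U f g (int n - 1 + 1) E' W'" "\<forall>i<0. E' i = {}"
      "\<forall>j\<le>int n - 1. E' j = fst s j \<and> W' j = snd s j"
      using tate_basis_step[of "int n - 1" "fst s" "snd s"] by force
    then show "\<exists>s'. ?P (Suc n) s' \<and> ?Q n s s'"
      by (intro exI[of _ "(E', W')"]) simp
  qed
  then obtain s where P: "\<And>n. ?P n (s n)" and Q: "\<And>n. ?Q n (s n) (s (Suc n))" by blast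
  have stable: "fst (s (n + d)) j = fst (s n) j \<and> snd (s (n + d)) j = snd (s n) j" if "j \<le> int n - 1" for n d j
    using that
  proof (induction d)
    case (Suc d)
    then show ?case using Q[of "n + d"] by auto
  qed simp
  define E where "E j = fst (s (nat (j + 1))) j" for j
  define W where "W j = snd (s (nat (j + 1))) j" for j
  have "tate_basis R U f g N E W" for N
  proof (cases "N \<ge> -1")
    case True
    show ?thesis
    proof (rule tate_basis_cong)
      show "tate_basis R U f g N (fst (s (nat (N + 1)))) (snd (s (nat (N + 1))))"
        using P[of "nat (N + 1)"] True by simp
      fix j assume j: "j \<le> N"
      show "E j = fst (s (nat (N + 1))) j \<and> W j = snd (s (nat (N + 1))) j"
      proof (cases "j \<ge> -1")
        case True
        have "nat (N + 1) = nat (j + 1) + nat (N - j)" using True j by simp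
        then show ?thesis using stable[of j "nat (j + 1)" "nat (N - j)"] True by (simp add: E_def W_def)
      next
        case False
        then show ?thesis using stable[of j 0 "nat (N + 1)"] by (simp add: E_def W_def)
      qed
    qed
  next
    case False
    have "tate_basis R U f g (-1) (fst (s 0)) (snd (s 0))" using P[of 0] by simp
    then interpret T: tate_basis R U f g "-1" "fst (s 0)" "snd (s 0)" .
    have "tate_basis R U f g N (fst (s 0)) (snd (s 0))"
      using False T.fg T.basis T.W_diag T.bdry_W by unfold_locales auto
    then show ?thesis using False by (rule_tac tate_basis_cong) (auto simp: E_def W_def)
  qed
  moreover have "\<forall>i<0. E i = {}" using P by (simp add: E_def)
  ultimately show ?thesis by blast
qed

end

section \<open>Semi-free structures and bases\<close>

lemma semi_free_if_tate_basis:
  assumes tb: "\<And>N. tate_basis R U f g N E W" and E: "\<And>i. i < 0 \<Longrightarrow> E i = {}" and U: "concentrated_ge 0 U"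
  shows "semi_free_dg_module R (tate R f g) U (tate_act R U E W)"
proof -
  interpret T: tate_basis R U f g N E W for N by (rule tb)
  let ?C = "component U"
  let ?A = "tate R f g" and ?act = "tate_act R U E W"
  have tc: "a \<in> carrier R" if "a \<in> carrier (tate_comp R i)" for a i
    using that by (auto split: if_splits)
  have dgm: "dg_module R ?A U ?act"
  proof (intro dg_module.intro dg_module_axioms.intro)
    show "dg_algebra R ?A" using T.fg by (rule T.tate_dg_algebra)
    show "chain_complex R U" by (rule T.chain_complex_axioms)
  next
    fix i j :: int
    \<comment> \<open>The degree \<open>i\<close> may be negative, so source and target have to be
      bounded separately.\<close>
    let ?N = "max j (i + j)"
    have N: "j \<le> ?N" "i + j \<le> ?N" by auto
    show "bilinear_map R (component ?A i) (?C j) (?C (i + j)) (?act i j)"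
      using tc T.tact_closed[OF N] T.tact_add_left[OF N] T.tact_add_right[OF N]
        T.tact_smult_left[OF N] T.tact_smult_right[OF N]
      by (simp add: bilinear_map_def module_hom_def)
  next
    fix a i b j u k
    assume "a \<in> carrier (component ?A i)" "b \<in> carrier (component ?A j)" "u \<in> carrier (?C k)"
    then show "?act (i + j) k (mul ?A i j a b) u = ?act i (j + k) a (?act j k b u)"
      using T.tact_assoc[of k "max k (max (j + k) (i + j + k))" j i a b u] by simp
  next
    fix u j assume "u \<in> carrier (?C j)"
    then show "?act 0 j (unit_elt ?A) u = u" using T.tact_degree_zero[of j j "\<one>\<^bsub>R\<^esub>" u] by simp
  next
    fix a i u j assume a: "a \<in> carrier (component ?A i)" and u: "u \<in> carrier (?C j)"
    let ?N = "max j (i + j)"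
    have "?act i (j - 1) a (bdry U j u) \<in> carrier (?C (i + (j - 1)))"
      using a tc by (intro T.tact_closed[of "j - 1" ?N i] T.bdry_closed[OF u]) auto
    then have "?act i (j - 1) a (bdry U j u) \<in> carrier (?C (i + j - 1))"
      by (simp add: add_diff_eq)
    then show "bdry U (i + j) (?act i j a u) = ?act (i - 1) j (bdry ?A i a) u
        \<oplus>\<^bsub>?C (i + j - 1)\<^esub> signed i (?C (i + j - 1)) (?act i (j - 1) a (bdry U j u))"
      using T.tact_leibniz[of j ?N i a u] a u by (simp add: signed_eq_smult[OF T.comp_module])
  qed
  have "homogeneous_basis ?A U ?act E"
    unfolding homogeneous_basis_def
  proof (intro conjI allI ballI)
    fix i show "E i \<subseteq> carrier (?C i)"
      using T.E_closed[of i i] E[of i] by (cases "i < 0") auto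
  next
    fix n x assume x: "x \<in> carrier (?C n)"
    let ?S = "Sigma UNIV E" and ?I = "tate_index E n"
    let ?P = "\<Pi>\<^sub>E p\<in>?S. carrier (tate_comp R (n - fst p))"
    let ?K = "\<lambda>c. {p \<in> ?S. c p \<noteq> \<zero>\<^bsub>R\<^esub>}"
    let ?s = "\<lambda>c. \<Oplus>\<^bsub>?C n\<^esub>p\<in>?K c. ?act (n - fst p) (fst p) (c p) (snd p)"
    have IS: "?I \<subseteq> ?S" by (auto simp: tate_index_def)
    have finI: "finite ?I" using T.U.free_basis_finite[OF T.basis[OF order.refl]] .
    have WI: "W n \<in> ?I \<rightarrow> carrier (?C n)" using T.U.free_basis_closed[OF T.basis[OF order.refl]] .
    \<comment> \<open>A coefficient at \<open>(i, e)\<close> has degree \<open>n - i\<close> and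
      vanishes if this is negative, and there are no generators of negative degree. Expansions in a
      homogeneous basis are therefore linear combinations over the finite set
      \<open>?I\<close>.\<close>
    have K: "?K c \<subseteq> ?I" and cI: "c \<in> ?I \<rightarrow> carrier R" and sum: "?s c = lincomb (?C n) (W n) ?I c"
      if c: "c \<in> ?P" for c
    proof -
      have mem: "c p \<in> carrier (tate_comp R (n - fst p))" if "p \<in> ?S" for p using c that by (rule PiE_mem)
      show K: "?K c \<subseteq> ?I"
      proof
        fix p assume p: "p \<in> ?K c"
        obtain i e where pe: "p = (i, e)" by (cases p)
        have "i \<ge> 0" using E[of i] p pe by force
        moreover have "i \<le> n" using mem[of p] p pe by (auto split: if_splits)
        ultimately show "p \<in> ?I" using p pe by simp
      qed
      show cI: "c \<in> ?I \<rightarrow> carrier R" using mem IS tc by blast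
      have "lincomb (?C n) (W n) ?I c = lincomb (?C n) (W n) (?K c) c"
        using K IS finI WI cI by (intro T.U.lincomb_mono_neutral[symmetric]) auto
      also have "\<dots> = ?s c"
        unfolding lincomb_def
      proof (rule T.U.M.finsum_cong'[OF refl, symmetric])
        show "(\<lambda>p. c p \<odot>\<^bsub>?C n\<^esub> W n p) \<in> ?K c \<rightarrow> carrier (?C n)"
          using K WI cI by (auto intro!: T.U.smult_closed)
        fix p assume p: "p \<in> ?K c"
        obtain i e where pe: "p = (i, e)" by (cases p)
        then have "0 \<le> i" "i \<le> n" "e \<in> E i" using subsetD[OF K p] by auto
        moreover have "c p \<in> carrier R" using cI K p by blast
        ultimately show "?act (n - fst p) (fst p) (c p) (snd p) = c p \<odot>\<^bsub>?C n\<^esub> W n p"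
          using T.smult_W[of n n i e "c p"] pe by simp
      qed
      finally show "?s c = lincomb (?C n) (W n) ?I c" by simp
    qed
    let ?c = "restrict (T.cf n x) ?S"
    have out: "T.cf n x p = \<zero>\<^bsub>R\<^esub>" if "p \<notin> ?I" for p using that by (rule T.cf_outside)
    have cP: "?c \<in> ?P"
    proof (rule restrict_PiE_iff[THEN iffD2], rule ballI)
      fix p assume "p \<in> ?S"
      then show "T.cf n x p \<in> carrier (tate_comp R (n - fst p))"
        using T.cf_closed[OF order.refl x, of p] out[of p] by (cases p) auto
    qed
    show "\<exists>!c. c \<in> (\<Pi>\<^sub>E p\<in>?S. carrier (component ?A (n - fst p))) \<and>
        finite {p \<in> ?S. c p \<noteq> \<zero>\<^bsub>component ?A (n - fst p)\<^esub>} \<and>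
        x = (\<Oplus>\<^bsub>?C n\<^esub>p\<in>{p \<in> ?S. c p \<noteq> \<zero>\<^bsub>component ?A (n - fst p)\<^esub>}.
              ?act (n - fst p) (fst p) (c p) (snd p))"
      unfolding T.tate_simps T.tate_comp_simps(3)
    proof (intro ex1I[of _ ?c] conjI)
      show "?c \<in> ?P" by (rule cP)
      show "finite (?K ?c)" using K[OF cP] finI by (rule finite_subset)
      have "lincomb (?C n) (W n) ?I ?c = lincomb (?C n) (W n) ?I (T.cf n x)"
        using IS WI cI[OF cP] by (intro T.U.lincomb_cong) auto
      then show "x = ?s ?c"
        unfolding sum[OF cP] T.U.lincomb_coord[OF T.basis[OF order.refl] x] by simp
      fix c assume c: "c \<in> ?P \<and> finite (?K c) \<and> x = ?s c"
      then have cP': "c \<in> ?P" by (rule conjunct1)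
      have xs: "x = ?s c" using c by (elim conjE)
      have xc: "x = lincomb (?C n) (W n) ?I c" using xs unfolding sum[OF cP'] .
      have "T.cf n x p = c p" if "p \<in> ?S" for p
      proof (cases "p \<in> ?I")
        case True
        then show ?thesis
          using T.U.coord_lincomb[OF T.basis[OF order.refl] cI[OF cP'], of p] xc by simp
      next
        case False
        then have "c p = \<zero>\<^bsub>R\<^esub>" using K[OF cP'] that by blast
        then show ?thesis using out[OF False] by simp
      qed
      then have "?c p = c p" for p
        using PiE_arb[OF cP', of p] by (auto simp: restrict_def)
      then show "c = ?c" by auto
    qed
  qed
  then show ?thesis
    using dgm U by (intro semi_free_dg_module.intro semi_free_dg_module_axioms.intro) auto
qed

lemma (in minimal_complex) semi_free_exists:
  "\<exists>act. semi_free_dg_module R (tate R f g) U act"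
  using tate_basis_exists semi_free_if_tate_basis concentrated by meson

text \<open>A homogeneous basis determines everything: its products with the Tate basis elements
  form a basis in each degree, and associativity leaves no choice for the action on them. The given
  Leibniz rule then becomes \<open>bdry_W\<close>, so that any semi-free structure has the form of
  the constructed one.\<close>

lemma tate_basis_if_semi_free:
  assumes sf: "semi_free_dg_module R (tate R f g) U act"
    and fg: "f \<in> carrier R" "g \<in> carrier R" "f \<otimes>\<^bsub>R\<^esub> g = \<zero>\<^bsub>R\<^esub>"
    and nontrivial: "\<one>\<^bsub>R\<^esub> \<noteq> \<zero>\<^bsub>R\<^esub>"
    and fin: "\<And>n. finite_free_module R (component U n)" and U: "concentrated_ge 0 U"
  shows "\<exists>E W. (\<forall>i<0. E i = {}) \<and> (\<forall>N. tate_basis R U f g N E W) \<and>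
    (\<forall>m n. \<forall>a\<in>carrier (tate_comp R m). \<forall>x\<in>carrier (component U n).
       act m n a x = tate_act R U E W m n a x)"
proof -
  interpret S: semi_free_dg_module R "tate R f g" U act by fact
  interpret M: module R "component U n" for n by (rule S.U.comp_module)
  let ?C = "component U"
  let ?A = "tate R f g"
  obtain E where hb: "homogeneous_basis ?A U act E" using S.free by blast
  have E_sub: "e \<in> carrier (?C i)" if "e \<in> E i" for e i
    using conjunct1[OF hb[unfolded homogeneous_basis_def]] that by blast
  let ?S = "Sigma UNIV E"
  let ?P = "\<lambda>n. \<Pi>\<^sub>E p\<in>?S. carrier (tate_comp R (n - fst p))"
  let ?K = "\<lambda>c. {p \<in> ?S. c p \<noteq> \<zero>\<^bsub>R\<^esub>}"
  let ?s = "\<lambda>n c. \<Oplus>\<^bsub>?C n\<^esub>p\<in>?K c. act (n - fst p) (fst p) (c p) (snd p)"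
  have ex1: "\<exists>!c. c \<in> ?P n \<and> finite (?K c) \<and> x = ?s n c" if "x \<in> carrier (?C n)" for n x
    using conjunct2[OF hb[unfolded homogeneous_basis_def], THEN spec, THEN bspec, OF that]
    unfolding S.tate_simps S.tate_comp_simps(3) .
  have bil: "(\<lambda>x. act i j x y) \<in> module_hom R (tate_comp R i) (?C (i + j))"
    if "y \<in> carrier (?C j)" for i j y
    using S.act_bilinear[of i j] that by (simp add: bilinear_map_def)
  have bir: "act i j x \<in> module_hom R (?C j) (?C (i + j))"
    if "x \<in> carrier (tate_comp R i)" for i j x
    using S.act_bilinear[of i j] that unfolding bilinear_map_def by simp
  define W where "W n p = act (n - fst p) (fst p) \<one>\<^bsub>R\<^esub> (snd p)" for n p
  define P where "P n = {p \<in> ?S. fst p \<le> n}" for n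
  have act_W: "act (n - i) i c e = c \<odot>\<^bsub>?C n\<^esub> W n (i, e)" and W_in: "W n (i, e) \<in> carrier (?C n)"
    if "i \<le> n" "e \<in> E i" "c \<in> carrier R" for n i e c
    using module_homD(3)[OF bil[OF E_sub[OF that(2)]], of c "\<one>\<^bsub>R\<^esub>" "n - i"]
      module_homD(1)[OF bil[OF E_sub[OF that(2)]], of "\<one>\<^bsub>R\<^esub>" "n - i"] that
    by (simp_all add: W_def)
  have W_P: "W n p \<in> carrier (?C n)" if "p \<in> P n" for n p
    using that W_in[of "fst p" n "snd p" "\<one>\<^bsub>R\<^esub>"] by (auto simp: P_def)
  have act_P: "act (n - fst p) (fst p) c (snd p) = c \<odot>\<^bsub>?C n\<^esub> W n p"
    if "p \<in> P n" "c \<in> carrier R" for n p c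
    using that act_W[of "fst p" n "snd p" c] by (auto simp: P_def)
  have KP: "?K c \<subseteq> P n" and cR: "c \<in> P n \<rightarrow> carrier R" if c: "c \<in> ?P n" for c n
  proof -
    have mem: "c p \<in> carrier (tate_comp R (n - fst p))" if "p \<in> ?S" for p using c that by (rule PiE_mem)
    show "?K c \<subseteq> P n"
    proof
      fix p assume p: "p \<in> ?K c"
      then show "p \<in> P n" using mem[of p] by (auto simp: P_def split: if_splits)
    qed
    show "c \<in> P n \<rightarrow> carrier R"
    proof
      fix p assume p: "p \<in> P n"
      then show "c p \<in> carrier R" using mem[of p] by (auto simp: P_def split: if_splits)
    qed
  qed
  have sum_eq: "?s n c = lincomb (?C n) (W n) T c"
    if c: "c \<in> ?P n" and T: "finite T" "?K c \<subseteq> T" "T \<subseteq> P n" for c n T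
  proof -
    have WT: "W n \<in> T \<rightarrow> carrier (?C n)" using T W_P by blast
    have cT: "c \<in> T \<rightarrow> carrier R" using cR[OF c] T by blast
    have "lincomb (?C n) (W n) T c = lincomb (?C n) (W n) (?K c) c"
      using T WT cT by (intro M.lincomb_mono_neutral[symmetric]) (auto simp: P_def)
    also have "\<dots> = ?s n c"
      unfolding lincomb_def
    proof (rule M.M.finsum_cong'[OF refl, symmetric])
      show "(\<lambda>p. c p \<odot>\<^bsub>?C n\<^esub> W n p) \<in> ?K c \<rightarrow> carrier (?C n)"
        using T WT cT by (auto intro!: M.smult_closed)
      fix p assume p: "p \<in> ?K c"
      then have "p \<in> P n" "c p \<in> carrier R" using KP[OF c] cR[OF c] by blast+
      then show "act (n - fst p) (fst p) (c p) (snd p) = c p \<odot>\<^bsub>?C n\<^esub> W n p" by (rule act_P)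
    qed
    finally show ?thesis by simp
  qed
  \<comment> \<open>Families on the finite set \<open>T\<close> are extended by zero to all of
    \<open>?S\<close>, where the uniqueness in the homogeneous basis compares them.\<close>
  have indep: "c p = d p"
    if T: "finite T" "T \<subseteq> P n" and cd: "c \<in> T \<rightarrow> carrier R" "d \<in> T \<rightarrow> carrier R"
      and eq: "lincomb (?C n) (W n) T c = lincomb (?C n) (W n) T d" and p: "p \<in> T"
    for T n c d p
  proof -
    define C where "C c = (\<lambda>p\<in>?S. if p \<in> T then c p else \<zero>\<^bsub>R\<^esub>)" for c
    have WT: "W n \<in> T \<rightarrow> carrier (?C n)" using T W_P by blast
    have TS: "T \<subseteq> ?S" using T by (auto simp: P_def)
    have C: "C c \<in> ?P n \<and> finite (?K (C c)) \<and> lincomb (?C n) (W n) T c = ?s n (C c)"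
      if c: "c \<in> T \<rightarrow> carrier R" for c
    proof -
      have 1: "C c \<in> ?P n"
      proof (unfold C_def, rule restrict_PiE_iff[THEN iffD2], rule ballI)
        fix p assume "p \<in> ?S"
        show "(if p \<in> T then c p else \<zero>\<^bsub>R\<^esub>) \<in> carrier (tate_comp R (n - fst p))"
          using c T by (auto simp: P_def)
      qed
      have 2: "?K (C c) \<subseteq> T" by (auto simp: C_def split: if_splits)
      have "lincomb (?C n) (W n) T c = lincomb (?C n) (W n) T (C c)"
        using c WT TS by (intro M.lincomb_cong) (auto simp: C_def)
      also have "\<dots> = ?s n (C c)" by (rule sum_eq[OF 1 T(1) 2 T(2), symmetric])
      finally show ?thesis using 1 2 T(1) finite_subset by blast
    qed
    let ?x = "lincomb (?C n) (W n) T c"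
    have x: "?x \<in> carrier (?C n)" using WT cd by simp
    have "C c = C d"
      using ex1[OF x] C[OF cd(1)] C[OF cd(2)] unfolding eq by blast
    then have "C c p = C d p" by simp
    then show ?thesis using p TS by (auto simp: C_def)
  qed
  have span: "\<exists>T c. finite T \<and> T \<subseteq> P n \<and> c \<in> T \<rightarrow> carrier R \<and> x = lincomb (?C n) (W n) T c"
    if x: "x \<in> carrier (?C n)" for n x
  proof -
    obtain c where c: "c \<in> ?P n \<and> finite (?K c) \<and> x = ?s n c"
      using ex1_implies_ex[OF ex1[OF x]] ..
    note c1 = conjunct1[OF c] and c2 = conjunct1[OF conjunct2[OF c]] and c3 = conjunct2[OF conjunct2[OF c]]
    have "x = lincomb (?C n) (W n) (?K c) c"
      by (rule trans[OF c3 sum_eq[OF c1 c2 order.refl KP[OF c1]]])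
    moreover have "c \<in> ?K c \<rightarrow> carrier R" using KP[OF c1] cR[OF c1] by blast
    ultimately show ?thesis using c2 KP[OF c1] by (intro exI[of _ "?K c"] exI[of _ c] conjI)
  qed
  \<comment> \<open>A generator in a degree where \<open>U\<close> is zero would have both one and
    zero as coefficients of the zero vector.\<close>
  have E_neg: "E i = {}" if "i < 0" for i
  proof (rule ccontr)
    assume "E i \<noteq> {}"
    then obtain e where e: "e \<in> E i" by blast
    have z: "y = \<zero>\<^bsub>?C i\<^esub>" if "y \<in> carrier (?C i)" for y
      using U that \<open>i < 0\<close> by (auto simp: concentrated_ge_def)
    have p: "(i, e) \<in> P i" using e by (simp add: P_def)
    have "lincomb (?C i) (W i) {(i, e)} c \<in> carrier (?C i)" if "c \<in> {(i, e)} \<rightarrow> carrier R" for c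
      using p W_P that by (intro M.lincomb_closed) auto
    then have "lincomb (?C i) (W i) {(i, e)} (\<lambda>_. \<one>\<^bsub>R\<^esub>) = \<zero>\<^bsub>?C i\<^esub>"
      "lincomb (?C i) (W i) {(i, e)} (\<lambda>_. \<zero>\<^bsub>R\<^esub>) = \<zero>\<^bsub>?C i\<^esub>"
      by (intro z; simp)+
    then have "\<one>\<^bsub>R\<^esub> = \<zero>\<^bsub>R\<^esub>"
      using p by (intro indep[of "{(i, e)}" i "\<lambda>_. \<one>\<^bsub>R\<^esub>" "\<lambda>_. \<zero>\<^bsub>R\<^esub>" "(i, e)"]) simp_all
    then show False using nontrivial by simp
  qed
  have P_eq: "P n = tate_index E n" for n
  proof -
    have "(i, e) \<in> P n \<longleftrightarrow> (i, e) \<in> tate_index E n" for i e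
      using E_neg[of i] by (cases "i < 0") (auto simp: P_def)
    then have "\<forall>i e. (i, e) \<in> P n \<longleftrightarrow> (i, e) \<in> tate_index E n" by blast
    then show ?thesis unfolding set_eq_iff split_paired_All .
  qed
  \<comment> \<open>Finitely many products suffice to express a finite basis of the component, hence
    all of it. A further product would be a combination of these, against independence.\<close>
  have finP: "finite (P n)" for n
  proof -
    obtain B where B: "free_basis R (?C n) (\<lambda>b. b) B"
      using fin[of n] finite_free_module_iff[OF S.U.comp_module nontrivial] by blast
    note Bc = M.free_basis_closed[OF B] and Bf = M.free_basis_finite[OF B]
    have "\<forall>b\<in>B. \<exists>T c. finite T \<and> T \<subseteq> P n \<and> c \<in> T \<rightarrow> carrier R \<and> b = lincomb (?C n) (W n) T c"
      using span Bc by blast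
    then obtain T where "\<forall>b\<in>B. \<exists>c. finite (T b) \<and> T b \<subseteq> P n \<and> c \<in> T b \<rightarrow> carrier R \<and>
        b = lincomb (?C n) (W n) (T b) c"
      by (rule bchoice[THEN exE])
    then have T: "finite (T b)" "T b \<subseteq> P n"
      "\<exists>c. c \<in> T b \<rightarrow> carrier R \<and> b = lincomb (?C n) (W n) (T b) c" if "b \<in> B" for b
      using that by blast+
    define V where "V = (\<Union>b\<in>B. T b)"
    have V: "finite V" "V \<subseteq> P n" using T Bf by (auto simp: V_def)
    have WV: "W n \<in> V \<rightarrow> carrier (?C n)" using V W_P by blast
    let ?in = "\<lambda>x. \<exists>c\<in>V \<rightarrow> carrier R. x = lincomb (?C n) (W n) V c"
    have extend: "lincomb (?C n) (W n) T' c = lincomb (?C n) (W n) V' (\<lambda>p. if p \<in> T' then c p else \<zero>\<^bsub>R\<^esub>)"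
      if "T' \<subseteq> V'" "c \<in> T' \<rightarrow> carrier R" "finite V'" "W n \<in> V' \<rightarrow> carrier (?C n)" for T' V' c
    proof -
      have "lincomb (?C n) (W n) T' c = lincomb (?C n) (W n) T' (\<lambda>p. if p \<in> T' then c p else \<zero>\<^bsub>R\<^esub>)"
        using that by (intro M.lincomb_cong) auto
      also have "\<dots> = lincomb (?C n) (W n) V' (\<lambda>p. if p \<in> T' then c p else \<zero>\<^bsub>R\<^esub>)"
        using that by (intro M.lincomb_mono_neutral) auto
      finally show ?thesis .
    qed
    have inB: "?in b" if b: "b \<in> B" for b
    proof -
      obtain c where c: "c \<in> T b \<rightarrow> carrier R" "b = lincomb (?C n) (W n) (T b) c" using T(3)[OF b] by blast
      have "T b \<subseteq> V" using b by (auto simp: V_def)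
      then show ?thesis
        using extend[OF _ c(1) V(1) WV] c
        by (intro bexI[of _ "\<lambda>p. if p \<in> T b then c p else \<zero>\<^bsub>R\<^esub>"]) auto
    qed
    have all: "?in x" if x: "x \<in> carrier (?C n)" for x
    proof (rule M.free_basis_induct[OF B x, where P = ?in])
      show "?in \<zero>\<^bsub>?C n\<^esub>"
        using WV by (intro bexI[of _ "\<lambda>_. \<zero>\<^bsub>R\<^esub>"]) (auto simp: M.lincomb_zero)
      show "?in (y \<oplus>\<^bsub>?C n\<^esub> z)" if "?in y" "?in z" for y z
      proof -
        obtain c d where cd: "c \<in> V \<rightarrow> carrier R" "y = lincomb (?C n) (W n) V c"
          "d \<in> V \<rightarrow> carrier R" "z = lincomb (?C n) (W n) V d" using \<open>?in y\<close> \<open>?in z\<close> by blast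
        then show ?thesis
          using WV by (intro bexI[of _ "\<lambda>i. c i \<oplus>\<^bsub>R\<^esub> d i"]) (auto simp: M.lincomb_add)
      qed
      show "?in (coord R (?C n) (\<lambda>b. b) B x b \<odot>\<^bsub>?C n\<^esub> b)" if b: "b \<in> B" for b
      proof -
        let ?r = "coord R (?C n) (\<lambda>b. b) B x b"
        have r: "?r \<in> carrier R" using M.coord_closed[OF B x] .
        obtain c where c: "c \<in> V \<rightarrow> carrier R" "b = lincomb (?C n) (W n) V c"
          using inB[OF b] by blast
        have "?r \<odot>\<^bsub>?C n\<^esub> b = lincomb (?C n) (W n) V (\<lambda>i. ?r \<otimes>\<^bsub>R\<^esub> c i)"
          using M.lincomb_smult[OF V(1) WV c(1) r] unfolding c(2)[symmetric] by simp
        moreover have "(\<lambda>i. ?r \<otimes>\<^bsub>R\<^esub> c i) \<in> V \<rightarrow> carrier R" using c(1) r by auto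
        ultimately show ?thesis by (rule_tac bexI)
      qed
    qed
    have "P n \<subseteq> V"
    proof (rule ccontr)
      assume "\<not> P n \<subseteq> V"
      then obtain p where p: "p \<in> P n" "p \<notin> V" by blast
      then obtain c where c: "c \<in> V \<rightarrow> carrier R" "W n p = lincomb (?C n) (W n) V c"
        using all W_P by blast
      let ?V = "insert p V"
      have V': "finite ?V" "?V \<subseteq> P n" "W n \<in> ?V \<rightarrow> carrier (?C n)"
        using V p WV W_P by auto
      have "lincomb (?C n) (W n) ?V (\<lambda>q. if q \<in> V then c q else \<zero>\<^bsub>R\<^esub>) = W n p"
        unfolding c(2) by (rule extend[OF subset_insertI c(1) V'(1,3), symmetric])
      moreover have "lincomb (?C n) (W n) ?V (\<lambda>q. if q = p then \<one>\<^bsub>R\<^esub> else \<zero>\<^bsub>R\<^esub>) = W n p"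
        using M.lincomb_single[of ?V p "W n" n "\<one>\<^bsub>R\<^esub>"] V' W_P[OF p(1)] by simp
      ultimately have "(if p \<in> V then c p else \<zero>\<^bsub>R\<^esub>) = (if p = p then \<one>\<^bsub>R\<^esub> else \<zero>\<^bsub>R\<^esub>)"
        using c(1) by (intro indep[OF V'(1,2)]) auto
      then show False using p nontrivial by simp
    qed
    then show ?thesis using V finite_subset by blast
  qed
  have basis: "free_basis R (?C n) (W n) (tate_index E n)" for n
    unfolding P_eq[symmetric]
  proof (rule M.free_basisI)
    show "finite (P n)" by (rule finP)
    show WP: "W n \<in> P n \<rightarrow> carrier (?C n)" using W_P by blast
    fix x assume x: "x \<in> carrier (?C n)"
    obtain T c where T: "finite T" "T \<subseteq> P n" "c \<in> T \<rightarrow> carrier R"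
      and xc: "x = lincomb (?C n) (W n) T c"
      using span[OF x] by (elim exE conjE) (rule that)
    let ?c = "\<lambda>p. if p \<in> T then c p else \<zero>\<^bsub>R\<^esub>"
    have "lincomb (?C n) (W n) T c = lincomb (?C n) (W n) T ?c"
      using T WP by (intro M.lincomb_cong) auto
    also have "\<dots> = lincomb (?C n) (W n) (P n) ?c"
      using T WP finP by (intro M.lincomb_mono_neutral) auto
    finally have "x = lincomb (?C n) (W n) (P n) ?c" unfolding xc .
    then show "\<exists>c\<in>P n \<rightarrow> carrier R. x = lincomb (?C n) (W n) (P n) c"
      by (rule bexI[where x = ?c]) (use T in auto)
  next
    fix c p assume c: "c \<in> P n \<rightarrow> carrier R" "lincomb (?C n) (W n) (P n) c = \<zero>\<^bsub>?C n\<^esub>" "p \<in> P n"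
    have "lincomb (?C n) (W n) (P n) (\<lambda>_. \<zero>\<^bsub>R\<^esub>) = \<zero>\<^bsub>?C n\<^esub>"
      using W_P by (intro M.lincomb_zero) auto
    then show "c p = \<zero>\<^bsub>R\<^esub>"
      using indep[OF finP order.refl c(1), of "\<lambda>_. \<zero>\<^bsub>R\<^esub>" p] c by simp
  qed
  have W_diag: "W i (i, e) = e" if "e \<in> E i" for i e
    using S.act_unit[OF E_sub[OF that]] by (simp add: W_def)
  interpret F: tate_frame R U f g N E W for N
    using fg basis W_diag by unfold_locales auto
  \<comment> \<open>Both actions are additive, so terms c e suffice. There associativity moves
    \<open>a\<close> into the Tate construction, where the same multiplication is used on both
    sides.\<close>
  have act_eq: "act m n a x = tate_act R U E W m n a x"
    if a: "a \<in> carrier (tate_comp R m)" and x: "x \<in> carrier (?C n)" for m n a x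
  proof -
    let ?N = "max n (m + n)"
    have N: "n \<le> ?N" "m + n \<le> ?N" by auto
    have aR: "a \<in> carrier R" using a by (auto split: if_splits)
    show ?thesis
    proof (rule M.free_basis_induct[OF basis x, where P = "\<lambda>x. act m n a x = tate_act R U E W m n a x"])
      show "act m n a \<zero>\<^bsub>?C n\<^esub> = tate_act R U E W m n a \<zero>\<^bsub>?C n\<^esub>"
        using module_hom_zero[OF S.U.comp_module S.U.comp_module bir[OF a]] F.tact_zero_right[OF N aR] by simp
      show "act m n a (y \<oplus>\<^bsub>?C n\<^esub> z) = tate_act R U E W m n a (y \<oplus>\<^bsub>?C n\<^esub> z)"
        if "y \<in> carrier (?C n)" "z \<in> carrier (?C n)"
          "act m n a y = tate_act R U E W m n a y" "act m n a z = tate_act R U E W m n a z" for y z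
        using module_homD(2)[OF bir[OF a] that(1,2)] F.tact_add_right[OF N aR that(1,2)] that(3,4) by simp
    next
      fix p assume p: "p \<in> tate_index E n"
      obtain i e where pe: "p = (i, e)" and i: "0 \<le> i" "i \<le> n" "e \<in> E i" using p by (cases p) auto
      define c where "c = F.cf n x p"
      have c: "c \<in> carrier R" unfolding c_def by (rule F.cf_closed[OF order.refl x])
      have y: "c \<odot>\<^bsub>?C n\<^esub> W n p \<in> carrier (?C n)" using c W_P p P_eq by simp
      show "act m n a (c \<odot>\<^bsub>?C n\<^esub> W n p) = tate_act R U E W m n a (c \<odot>\<^bsub>?C n\<^esub> W n p)"
      proof (cases "m < 0")
        case True
        then have a0: "a = \<zero>\<^bsub>R\<^esub>" using a by simp
        show ?thesis
          using module_hom_zero[OF S.tate_module S.U.comp_module bil[OF y], of m] F.tact_zero_left[OF N y]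
          unfolding a0 by simp
      next
        case False
        have e: "e \<in> carrier (?C i)" by (rule E_sub[OF i(3)])
        have cc: "c \<in> carrier (tate_comp R (n - i))" using c i by simp
        have t: "tate_mul R m (n - i) a c \<in> carrier R" using aR c by (rule S.tate_mul_closed)
        have s: "n - i + i = n" "m + (n - i) = m + n - i" "m + n - i + i = m + n" by auto
        have "act m n a (c \<odot>\<^bsub>?C n\<^esub> W n p) = act m n a (act (n - i) i c e)"
          using act_W[OF i(2,3) c] pe by simp
        also have "\<dots> = act (m + n - i) i (tate_mul R m (n - i) a c) e"
          using S.act_assoc[of a m c "n - i" e i] a cc e unfolding s by simp
        also have "\<dots> = tate_mul R m (n - i) a c \<odot>\<^bsub>?C (m + n)\<^esub> W (m + n) (i, e)"
          using act_W[of i "m + n" e] i False t by simp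
        also have "\<dots> = tate_act R U E W (m + n - i) i (tate_mul R m (n - i) a c) e"
          using F.smult_W[of "m + n" "m + n" i e] i False t by simp
        also have "\<dots> = tate_act R U E W m n a (tate_act R U E W (n - i) i c e)"
          using F.tact_assoc[of i ?N "n - i" m a c e] i a cc e False unfolding s by simp
        also have "\<dots> = tate_act R U E W m n a (c \<odot>\<^bsub>?C n\<^esub> W n p)"
          using F.smult_W[of n n i e c] i c pe by simp
        finally show ?thesis .
      qed
    qed
  qed
  have "tate_basis R U f g N E W" for N
  proof unfold_locales
    fix n i e assume n: "n \<le> N" "0 \<le> i" "i < n" "e \<in> E i"
    have e: "e \<in> carrier (?C i)" by (rule E_sub[OF n(4)])
    have de: "bdry U i e \<in> carrier (?C (i - 1))" by (rule F.bdry_closed[OF e])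
    have s: "n - i + i = n" "n - i - 1 = n - 1 - i" "n - i + (i - 1) = n - 1" by auto
    have one: "\<one>\<^bsub>R\<^esub> \<in> carrier (tate_comp R (n - i))" using n by simp
    have d: "tate_bdry R f g (n - i) \<one>\<^bsub>R\<^esub> \<in> carrier R" using fg by (simp add: S.tate_bdry_closed)
    have cl: "tate_act R U E W (n - i) (i - 1) \<one>\<^bsub>R\<^esub> (bdry U i e) \<in> carrier (?C (n - 1))"
      using F.tact_closed[of "i - 1" n "n - i" "\<one>\<^bsub>R\<^esub>" "bdry U i e"] n de by simp
    have "bdry U n (W n (i, e)) = act (n - i - 1) i (tate_bdry R f g (n - i) \<one>\<^bsub>R\<^esub>) e
        \<oplus>\<^bsub>?C (n - 1)\<^esub> signed (n - i) (?C (n - 1)) (act (n - i) (i - 1) \<one>\<^bsub>R\<^esub> (bdry U i e))"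
      using S.act_leibniz[of "\<one>\<^bsub>R\<^esub>" "n - i" e i] one e unfolding s W_def by simp
    also have "act (n - i - 1) i (tate_bdry R f g (n - i) \<one>\<^bsub>R\<^esub>) e =
        tate_bdry R f g (n - i) \<one>\<^bsub>R\<^esub> \<odot>\<^bsub>?C (n - 1)\<^esub> W (n - 1) (i, e)"
      using act_W[of i "n - 1" e, OF _ n(4) d] n unfolding s by simp
    also have "act (n - i) (i - 1) \<one>\<^bsub>R\<^esub> (bdry U i e) = tate_act R U E W (n - i) (i - 1) \<one>\<^bsub>R\<^esub> (bdry U i e)"
      by (rule act_eq[OF one de])
    also have "signed (n - i) (?C (n - 1)) \<dots> = sgn_elt R (n - i) \<odot>\<^bsub>?C (n - 1)\<^esub> \<dots>"
      by (rule signed_eq_smult[OF S.U.comp_module cl])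
    finally show "bdry U n (W n (i, e)) =
        tate_bdry R f g (n - i) \<one>\<^bsub>R\<^esub> \<odot>\<^bsub>?C (n - 1)\<^esub> W (n - 1) (i, e)
        \<oplus>\<^bsub>?C (n - 1)\<^esub>
        sgn_elt R (n - i) \<odot>\<^bsub>?C (n - 1)\<^esub> tate_act R U E W (n - i) (i - 1) \<one>\<^bsub>R\<^esub> (bdry U i e)" .
  qed
  then show ?thesis using E_neg act_eq by blast
qed

section \<open>The kernel of the base change\<close>

locale tate_semi_free = chain_complex R U
  for R :: "('a, 'x) ring_scheme" (structure) and U :: "('a, 'u) chain_complex" +
  fixes f g :: 'a and E :: "int \<Rightarrow> 'u set" and W :: "int \<Rightarrow> int \<times> 'u \<Rightarrow> 'u"
  assumes tate_basis: "\<And>N. tate_basis R U f g N E W"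
    and E_neg: "i < 0 \<Longrightarrow> E i = {}"
begin

sublocale tate_basis R U f g N E W for N
  by (rule tate_basis)

lemma tate_bdry_add:
  "\<lbrakk>a \<in> carrier R; b \<in> carrier R\<rbrakk> \<Longrightarrow> dA n (a \<oplus> b) = dA n a \<oplus> dA n b"
  using fg by (simp add: tate_bdry_def l_distr)

lemma tate_bdry_zero: "dA n \<zero> = \<zero>"
  using fg by (simp add: tate_bdry_def)

lemma f_ideal: "ideal (PIdl f) R"
  using fg by (intro cgenideal_ideal) auto

text \<open>The submodule \<open>JU\<close>, where \<open>J\<close> is the kernel of the augmentation from the Tate construction to
  \<open>Q/(f)\<close>: in degree zero \<open>J\<close> is \<open>(f)\<close>, and it contains everything of positive degree.\<close>

definition JU :: "int \<Rightarrow> 'u set"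
  where "JU n = {x \<in> carrier (C n). \<forall>e. cf n x (n, e) \<in> PIdl f}"

lemma JU_closed: "x \<in> JU n \<Longrightarrow> x \<in> carrier (C n)"
  by (simp add: JU_def)

lemma JU_submodule: "submodule (JU n) R (C n)"
proof -
  interpret f: ideal "PIdl f" R by (rule f_ideal)
  note s = U.coord_add[OF basis[OF order.refl]] U.coord_smult[OF basis[OF order.refl]]
    U.coord_zero[OF basis[OF order.refl]] U.coord_minus[OF basis[OF order.refl]]
  show ?thesis
    by (rule U.submoduleI) (auto simp: JU_def s f.I_l_closed)
qed

lemmas JU_add = U.submoduleE(5)[OF JU_submodule]
  and JU_smult = U.submoduleE(4)[OF JU_submodule]
  and JU_minus = U.submoduleE(3)[OF JU_submodule]

text \<open>The first summand stays at the generator \<open>e\<close>; the second comes from the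
  boundary of \<open>e\<close> and vanishes unless \<open>fst q < i\<close>. Hence the differential
  respects the filtration by the degree of the generators.\<close>

lemma cf_bdry_W:
  assumes "0 \<le> i" "i \<le> n" "e \<in> E i" "c \<in> carrier R"
  shows "cf (n - 1) (bdry U n (c \<odot>\<^bsub>C n\<^esub> W n (i, e))) q =
    tate_mul R (n - i - 1) (i - fst q) (dA (n - i) c) (if q = (i, e) then \<one> else \<zero>) \<oplus>
    sgn_elt R (n - i) \<otimes> tate_mul R (n - i) (i - 1 - fst q) c (cf (i - 1) (bdry U i e) q)"
proof -
  have s: "n - i + i = n" "n - i - 1 + i = n - 1" "n - i + (i - 1) = n - 1" by auto
  have N: "n - i - 1 + i \<le> n" "i \<le> n" "i - 1 \<le> n" "n - i + (i - 1) \<le> n" using assms by auto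
  have e: "e \<in> carrier (C i)" using E_closed[OF assms(1) order.refl assms(3)] .
  have de: "bdry U i e \<in> carrier (C (i - 1))" by (rule bdry_closed[OF e])
  have d: "dA (n - i) c \<in> carrier R" using fg assms by (simp add: tate_bdry_closed)
  have t: "tact (n - i - 1) i (dA (n - i) c) e \<in> carrier (C (n - 1))"
    "tact (n - i) (i - 1) c (bdry U i e) \<in> carrier (C (n - 1))"
    using tact_closed[OF N(2,1) d e] tact_closed[OF N(3,4) assms(4) de] unfolding s by auto
  have c: "cf (n - 1) (tact (n - i - 1) i (dA (n - i) c) e) q =
      tate_mul R (n - i - 1) (i - fst q) (dA (n - i) c) (if q = (i, e) then \<one> else \<zero>)"
    "cf (n - 1) (tact (n - i) (i - 1) c (bdry U i e)) q =
      tate_mul R (n - i) (i - 1 - fst q) c (cf (i - 1) (bdry U i e) q)"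
    using cf_tact[OF N(2,1) d e, of q] cf_tact[OF N(3,4) assms(4) de, of q]
      cf_E[OF assms(1) order.refl assms(3), of q] unfolding s by auto
  have "bdry U n (c \<odot>\<^bsub>C n\<^esub> W n (i, e)) =
      tact (n - i - 1) i (dA (n - i) c) e \<oplus>\<^bsub>C (n - 1)\<^esub>
      sgn_elt R (n - i) \<odot>\<^bsub>C (n - 1)\<^esub> tact (n - i) (i - 1) c (bdry U i e)"
    using bdry_tact_E[of "n - i" i n e c] smult_W[OF order.refl assms] assms unfolding s by simp
  then show ?thesis
    using t by (simp add: cf_simps[OF order.refl] c)
qed

text \<open>Only coordinates at generators of degree \<open>n - 1\<close> are constrained in the
  target. A generator of degree \<open>n\<close> reaches them with a coefficient from the ideal of
  \<open>f\<close>, one of degree \<open>n - 1\<close> with a multiple of \<open>f\<close> because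
  the differential of y is \<open>f\<close>, and lower generators do not reach them.\<close>

lemma bdry_JU:
  assumes x: "x \<in> JU n"
  shows "bdry U n x \<in> JU (n - 1)"
proof -
  interpret f: ideal "PIdl f" R by (rule f_ideal)
  have xc: "x \<in> carrier (C n)" using JU_closed[OF x] .
  have "cf (n - 1) (bdry U n x) (n - 1, e) \<in> PIdl f" for e
  proof (rule U.free_basis_induct[OF basis[OF order.refl] xc, where P = "\<lambda>x. cf (n - 1) (bdry U n x) (n - 1, e) \<in> PIdl f"])
    show "cf (n - 1) (bdry U n \<zero>\<^bsub>C n\<^esub>) (n - 1, e) \<in> PIdl f"
      using bdry_zero[of n] by (simp add: cf_simps[OF order.refl])
    show "cf (n - 1) (bdry U n (y \<oplus>\<^bsub>C n\<^esub> z)) (n - 1, e) \<in> PIdl f"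
      if "y \<in> carrier (C n)" "z \<in> carrier (C n)"
        "cf (n - 1) (bdry U n y) (n - 1, e) \<in> PIdl f" "cf (n - 1) (bdry U n z) (n - 1, e) \<in> PIdl f" for y z
      using that by (simp add: bdry_add bdry_closed cf_simps[OF order.refl])
  next
    fix p assume p: "p \<in> tate_index E n"
    obtain i e' where pe: "p = (i, e')" and i: "0 \<le> i" "i \<le> n" "e' \<in> E i" using p by (cases p) auto
    let ?c = "cf n x p" and ?d = "cf (i - 1) (bdry U i e') (n - 1, e)"
    have c: "?c \<in> carrier R" using cf_closed[OF order.refl xc] .
    have d: "?d \<in> carrier R"
      using cf_closed[OF order.refl bdry_closed[OF E_closed[OF i(1) order.refl i(3)]]] .
    have zd: "\<zero> \<in> PIdl f" by simp
    consider "i = n" | "i = n - 1" | "i < n - 1" using i by linarith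
    then have "tate_mul R (n - i - 1) (i - fst (n - 1, e)) (dA (n - i) ?c) (if (n - 1, e) = (i, e') then \<one> else \<zero>) \<in> PIdl f
      \<and> tate_mul R (n - i) (i - 1 - fst (n - 1, e)) ?c ?d \<in> PIdl f"
    proof cases
      case 1
      have "?c \<in> PIdl f" using x pe 1 by (simp add: JU_def)
      then show ?thesis using 1 c d f.I_r_closed by (simp add: tate_mul_neg tate_mul_degree_zero_left)
    next
      case 2
      have "?c \<otimes> f \<in> PIdl f" using c unfolding cgenideal_def by blast
      then show ?thesis using 2 c fg(1) by (simp add: tate_mul_neg tate_mul_degree_zero_left tate_bdry_def)
    next
      case 3
      then show ?thesis by (simp add: tate_mul_neg)
    qed
    then show "cf (n - 1) (bdry U n (?c \<odot>\<^bsub>C n\<^esub> W n p)) (n - 1, e) \<in> PIdl f"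
      unfolding pe cf_bdry_W[OF i c[unfolded pe]] by (auto simp: pe f.I_l_closed)
  qed
  then show ?thesis using bdry_closed[OF xc] by (simp add: JU_def)
qed

text \<open>The boundaries of generators of degree at most \<open>l\<close> are supported on
  generators of degree below \<open>l\<close>, so from level \<open>l\<close> on only the
  differential of the coefficients is left. The graded pieces of the filtration are thus sums of
  shifted copies of the Tate construction.\<close>

lemma cf_bdry_top:
  assumes x: "x \<in> carrier (C n)" and l: "\<And>p. fst p > l \<Longrightarrow> cf n x p = \<zero>" and q: "fst q \<ge> l"
  shows "cf (n - 1) (bdry U n x) q = dA (n - fst q) (cf n x q)" (is "?P x")
proof (rule U.free_basis_induct[OF basis[OF order.refl] x, where P = ?P])
  show "?P \<zero>\<^bsub>C n\<^esub>"
    using bdry_zero[of n] by (simp add: cf_simps[OF order.refl] tate_bdry_zero)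
  show "?P (y \<oplus>\<^bsub>C n\<^esub> z)"
    if "y \<in> carrier (C n)" "z \<in> carrier (C n)" "?P y" "?P z" for y z
    using that cf_closed[OF order.refl]
    by (simp add: bdry_add bdry_closed cf_simps[OF order.refl] tate_bdry_add)
next
  fix p assume p: "p \<in> tate_index E n"
  obtain i e where pe: "p = (i, e)" and i: "0 \<le> i" "i \<le> n" "e \<in> E i" using p by (cases p) auto
  let ?c = "cf n x p"
  have c: "?c \<in> carrier R" using cf_closed[OF order.refl x] .
  have W: "W n p \<in> carrier (C n)" using W_closed[OF order.refl p] .
  show "?P (?c \<odot>\<^bsub>C n\<^esub> W n p)"
  proof (cases "i > l")
    case True
    then have "?c = \<zero>" using l pe by simp
    then show ?thesis
      using W bdry_zero[of n] by (simp add: cf_simps[OF order.refl] tate_bdry_zero)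
  next
    case False
    have d: "cf (i - 1) (bdry U i e) q \<in> carrier R"
      using cf_closed[OF order.refl bdry_closed[OF E_closed[OF i(1) order.refl i(3)]]] .
    have "cf n (?c \<odot>\<^bsub>C n\<^esub> W n p) q = (if q = (i, e) then ?c else \<zero>)"
      using c W U.coord_basis[OF basis[OF order.refl] p, of q] pe by (simp add: cf_simps[OF order.refl])
    moreover have "tate_mul R (n - i) (i - 1 - fst q) ?c (cf (i - 1) (bdry U i e) q) = \<zero>"
      using False q by (simp add: tate_mul_neg)
    moreover have bc: "dA (n - i) ?c \<in> carrier R" using fg c by (simp add: tate_bdry_closed)
    have "tate_mul R (n - i - 1) (i - fst q) (dA (n - i) ?c) (if q = (i, e) then \<one> else \<zero>) =
        (if q = (i, e) then dA (n - i) ?c else \<zero>)"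
    proof (cases "i = n")
      case True
      then show ?thesis by (simp add: tate_bdry_def tate_mul_zero)
    next
      case False
      then show ?thesis using bc i by (auto simp: tate_mul_degree_zero_right tate_mul_zero)
    qed
    ultimately show ?thesis
      using cf_bdry_W[OF i c, of q] bc unfolding pe by (auto simp: tate_bdry_zero)
  qed
qed

text \<open>Acyclicity of the kernel of the augmentation. In degree zero the kernel is the ideal of
  \<open>f\<close>, the image of multiplication by \<open>f\<close>; in positive degrees the kernel
  of multiplication by one of \<open>f\<close>, \<open>g\<close> is the image of multiplication by
  the other.\<close>

lemma tate_lift:
  assumes ann: "annihilator R f = PIdl g" "annihilator R g = PIdl f"
    and a: "a \<in> carrier R" and k: "0 \<le> k" and "k = 0 \<Longrightarrow> a \<in> PIdl f" and z: "dA k a = \<zero>"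
  shows "\<exists>b\<in>carrier R. dA (k + 1) b = a"
proof -
  consider "k = 0" | "k > 0" "even k" | "k > 0" "odd k" using k by linarith
  then show ?thesis
  proof cases
    case 1
    then show ?thesis using assms(5) by (auto simp: tate_bdry_def cgenideal_def)
  next
    case 2
    then have "a \<in> annihilator R g" using z a by (simp add: annihilator_def tate_bdry_def)
    then show ?thesis using 2 ann by (auto simp: tate_bdry_def cgenideal_def)
  next
    case 3
    then have "a \<in> annihilator R f" using z a by (simp add: annihilator_def tate_bdry_def)
    then show ?thesis using 3 ann by (auto simp: tate_bdry_def cgenideal_def)
  qed
qed

text \<open>Induction on a strict bound \<open>m\<close> for the degrees of the generators that
  occur in \<open>z\<close>. By \<open>cf_bdry_top\<close> the coefficients at the highest
  generators are cycles in the kernel of the augmentation, so \<open>tate_lift\<close> makes them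
  boundaries and they can be removed within \<open>JU\<close>.\<close>

lemma JU_acyclic:
  assumes ann: "annihilator R f = PIdl g" "annihilator R g = PIdl f"
    and "z \<in> JU n" "bdry U n z = \<zero>\<^bsub>C (n - 1)\<^esub>"
  shows "\<exists>w\<in>JU (n + 1). bdry U (n + 1) w = z"
proof -
  have JUz: "\<zero>\<^bsub>C n\<^esub> \<in> JU n" for n
    using f_ideal additive_subgroup.zero_closed[OF ideal.axioms(1)] by (simp add: JU_def cf_simps[OF order.refl])
  have "\<exists>w\<in>JU (n + 1). bdry U (n + 1) w = z"
    if "z \<in> JU n" "bdry U n z = \<zero>\<^bsub>C (n - 1)\<^esub>" "\<And>p. fst p \<ge> int m \<Longrightarrow> cf n z p = \<zero>" for m z
    using that
  proof (induction m arbitrary: z)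
    case 0
    have zc: "z \<in> carrier (C n)" using JU_closed[OF 0(1)] .
    have "cf n z p = \<zero>" for p
      using 0(3)[of p] cf_outside[of p n z] by (cases p) auto
    then have "z = \<zero>\<^bsub>C n\<^esub>"
      using zc by (intro U_eqI[OF order.refl zc]) (auto simp: cf_simps[OF order.refl])
    then show ?case using bdry_zero[of "n + 1"] JUz by (intro bexI[of _ "\<zero>\<^bsub>C (n + 1)\<^esub>"]) auto
  next
    case (Suc m)
    have zc: "z \<in> carrier (C n)" using JU_closed[OF Suc(2)] .
    show ?case
    proof (cases "int m \<le> n")
      case False
      show ?thesis
      proof (rule Suc.IH[OF Suc(2,3)])
        fix p :: "int \<times> 'u" assume "fst p \<ge> int m"
        then show "cf n z p = \<zero>" using False by (intro cf_outside) (cases p, auto)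
      qed
    next
      case True
      let ?l = "int m"
      have top: "cf n z p = \<zero>" if "fst p > ?l" for p using Suc(4)[of p] that by simp
      have "\<exists>b\<in>carrier R. dA (n - ?l + 1) b = cf n z (?l, e)" for e
      proof (rule tate_lift[OF ann])
        show "cf n z (?l, e) \<in> carrier R" using cf_closed[OF order.refl zc] .
        show "0 \<le> n - ?l" using True by simp
        show "cf n z (?l, e) \<in> PIdl f" if "n - ?l = 0"
        proof -
          have "?l = n" using that by simp
          then show ?thesis using Suc(2) by (simp add: JU_def)
        qed
        have "dA (n - fst (?l, e)) (cf n z (?l, e)) = cf (n - 1) (bdry U n z) (?l, e)"
          by (rule cf_bdry_top[OF zc top, symmetric]) auto
        then show "dA (n - ?l) (cf n z (?l, e)) = \<zero>"
          using Suc(3) by (simp add: cf_simps[OF order.refl])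
      qed
      then obtain b' where b': "\<And>e. b' e \<in> carrier R \<and> dA (n - ?l + 1) (b' e) = cf n z (?l, e)"
        by metis
      \<comment> \<open>The lifts are chosen at all labels, but \<open>w\<close> has coordinates
        only at generators, so the choice is replaced by zero off \<open>E ?l\<close>.\<close>
      define b where "b e = (if e \<in> E ?l then b' e else \<zero>)" for e
      have b: "b e \<in> carrier R" "dA (n - ?l + 1) (b e) = cf n z (?l, e)" for e
        using b'[of e] cf_outside[of "(?l, e)" n z] by (auto simp: b_def tate_bdry_zero)
      let ?c = "\<lambda>p. if fst p = ?l then b (snd p) else \<zero>"
      define w where "w = lincomb (C (n + 1)) (W (n + 1)) (tate_index E (n + 1)) ?c"
      have w: "w \<in> carrier (C (n + 1))"
        unfolding w_def using b U.free_basis_closed[OF basis[OF order.refl]] by (intro U.lincomb_closed) auto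
      have cw: "cf (n + 1) w p = ?c p" for p
      proof -
        have "cf (n + 1) w p = (if p \<in> tate_index E (n + 1) then ?c p else \<zero>)"
          unfolding w_def using b by (intro U.coord_lincomb[OF basis[OF order.refl]]) auto
        then show ?thesis using True by (cases p) (auto simp: b_def)
      qed
      \<comment> \<open>The generators in \<open>w\<close> have degree \<open>?l\<close>, which is
        at most \<open>n\<close>, so the constrained coordinates in degree \<open>n + 1\<close> are
        all zero.\<close>
      have wJ: "w \<in> JU (n + 1)"
        using w True additive_subgroup.zero_closed[OF ideal.axioms(1)[OF f_ideal]] by (simp add: JU_def cw)
      have dw: "bdry U (n + 1) w \<in> JU n" using bdry_JU[OF wJ] by simp
      have dwc: "bdry U (n + 1) w \<in> carrier (C n)" using JU_closed[OF dw] .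
      have cdw: "cf n (bdry U (n + 1) w) q = cf n z q" if "fst q \<ge> ?l" for q
      proof -
        have "cf n (bdry U (n + 1) w) q = dA (n + 1 - fst q) (cf (n + 1) w q)"
          using cf_bdry_top[OF w _ that] by (simp add: cw)
        also have "\<dots> = cf n z q"
        proof (cases "fst q = ?l")
          case True
          have e: "n + 1 - fst q = n - ?l + 1" "(?l, snd q) = q" using True by (simp, cases q, simp)
          show ?thesis unfolding e(1) using b(2)[of "snd q"] True e(2) by (simp add: cw)
        next
          case False
          then show ?thesis using top[of q] that by (simp add: cw tate_bdry_zero)
        qed
        finally show ?thesis .
      qed
      \<comment> \<open>Subtracting the boundary of \<open>w\<close> clears the coordinates at
        generators of degree \<open>?l\<close> and creates none above, so the bound drops by
        one.\<close>
      define y where "y = z \<oplus>\<^bsub>C n\<^esub> \<ominus>\<^bsub>C n\<^esub> bdry U (n + 1) w"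
      have yJ: "y \<in> JU n" unfolding y_def by (intro JU_add Suc(2) JU_minus dw)
      have ddw: "bdry U n (bdry U (n + 1) w) = \<zero>\<^bsub>C (n - 1)\<^esub>"
        using bdry_bdry[OF w] by simp
      have "bdry U n (\<ominus>\<^bsub>C n\<^esub> bdry U (n + 1) w) = \<zero>\<^bsub>C (n - 1)\<^esub>"
        using bdry_smult[of "\<ominus> \<one>" "bdry U (n + 1) w" n] dwc ddw by (simp add: U.smult_l_minus)
      then have dy: "bdry U n y = \<zero>\<^bsub>C (n - 1)\<^esub>"
        unfolding y_def using zc dwc Suc(3) by (simp add: bdry_add)
      have "cf n y p = \<zero>" if "fst p \<ge> ?l" for p
        unfolding y_def using zc dwc cdw[OF that] cf_closed[OF order.refl zc, of p]
        by (simp add: cf_simps[OF order.refl] U.coord_minus[OF basis[OF order.refl]] r_neg)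
      then obtain v where v: "v \<in> JU (n + 1)" "bdry U (n + 1) v = y"
        using Suc.IH[OF yJ dy] by blast
      have "bdry U (n + 1) (w \<oplus>\<^bsub>C (n + 1)\<^esub> v) = bdry U (n + 1) w \<oplus>\<^bsub>C n\<^esub> y"
        using bdry_add[OF w JU_closed[OF v(1)]] v(2) by simp
      also have "\<dots> = z"
        unfolding y_def using zc dwc
        by (metis U.M.a_comm U.M.a_assoc U.M.r_neg U.M.r_zero U.M.a_inv_closed)
      finally show ?thesis using JU_add[OF wJ v(1)] by blast
    qed
  qed
  \<comment> \<open>Only generators of degree at most \<open>n\<close> occur in degree
    \<open>n\<close>, so \<open>n + 1\<close> is always a bound, and zero is one if \<open>n\<close>
    is negative.\<close>
  from this[of z "nat (n + 1)"] show ?thesis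
  proof
    fix p :: "int \<times> 'u" assume "fst p \<ge> int (nat (n + 1))"
    then show "cf n z p = \<zero>" by (intro cf_outside) (cases p, auto)
  qed (use assms in auto)
qed

end

section \<open>The tensor product\<close>

context ring
begin

lemma Quot_surj: "v \<in> carrier (R Quot I) \<Longrightarrow> \<exists>r\<in>carrier R. v = I +> r"
  unfolding FactRing_def A_RCOSETS_def' by simp

lemma Quot_zero: "\<zero>\<^bsub>R Quot I\<^esub> = I"
  by (simp add: FactRing_def)

lemma Quot_eq_zero_iff:
  "\<lbrakk>ideal I R; r \<in> carrier R\<rbrakk> \<Longrightarrow> I +> r = \<zero>\<^bsub>R Quot I\<^esub> \<longleftrightarrow> r \<in> I"
  unfolding Quot_zero using ideal.rcos_const_imp_mem[of I R r] a_rcos_zero[of I r] by metis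

end

text \<open>The given \<open>act\<close> is kept beside \<open>tact\<close>, because the tensor
  complex is built from it. The two are only known to agree on elements of the components.\<close>

locale tate_tensor = tate_semi_free +
  fixes act :: "int \<Rightarrow> int \<Rightarrow> 'a \<Rightarrow> 'c \<Rightarrow> 'c"
  assumes act_eq: "\<lbrakk>a \<in> carrier (tate_comp R m); x \<in> carrier (C n)\<rbrakk> \<Longrightarrow>
      act m n a x = tact m n a x"
begin

abbreviation Rq :: "'a set ring" where "Rq \<equiv> R Quot (PIdl f)"
abbreviation pr :: "'a \<Rightarrow> 'a set" where "pr \<equiv> (+>) (PIdl f)"
abbreviation V :: "('a set, 'a set) chain_complex" where "V \<equiv> ring_complex Rq"
abbreviation symbols where "symbols \<equiv> tensor_symbols U V"
abbreviation relations where "relations \<equiv> tensor_relations (tate R f g) U act V (augmentation_act R f)"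
abbreviation relators where "relators \<equiv> tensor_relators (tate R f g) U act V (augmentation_act R f)"

sublocale q: ring_hom_cring R Rq pr
  by (rule ideal.rcos_ring_hom_cring[OF f_ideal is_cring])

lemma V_simps:
  "carrier (component V k) = (if k = 0 then carrier Rq else {\<zero>\<^bsub>Rq\<^esub>})"
  "ring.zero (component V k) = \<zero>\<^bsub>Rq\<^esub>"
  "ring.add (component V k) = (\<oplus>\<^bsub>Rq\<^esub>)"
  "smult (component V k) = (\<otimes>\<^bsub>Rq\<^esub>)"
  "bdry V k v = \<zero>\<^bsub>Rq\<^esub>"
  by (simp_all add: ring_complex_def)

lemma pr_surj: "v \<in> carrier Rq \<Longrightarrow> \<exists>r\<in>carrier R. v = pr r"
  by (rule Quot_surj)

lemma pr_eq_zero_iff: "r \<in> carrier R \<Longrightarrow> pr r = \<zero>\<^bsub>Rq\<^esub> \<longleftrightarrow> r \<in> PIdl f"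
  by (rule Quot_eq_zero_iff[OF f_ideal])

lemma augmentation_simps:
  "augmentation_act R f k j a v = (if k = 0 then pr a else \<zero>\<^bsub>Rq\<^esub>) \<otimes>\<^bsub>Rq\<^esub> v"
  by (simp add: augmentation_act_def tate_augmentation_def)

lemma V_closed: "v \<in> carrier (component V k) \<Longrightarrow> v \<in> carrier Rq"
  by (auto simp: V_simps split: if_splits)

lemma V_zero_mem [simp]: "\<zero>\<^bsub>Rq\<^esub> \<in> carrier (component V k)"
  by (simp add: V_simps)

lemma symbols_iff [simp]:
  "(i, u, v) \<in> symbols n \<longleftrightarrow> u \<in> carrier (C i) \<and> v \<in> carrier (component V (n - i))"
  by (simp add: tensor_symbols_def)

lemma tate_comp_closed: "a \<in> carrier (tate_comp R k) \<Longrightarrow> a \<in> carrier R"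
  by (auto split: if_splits)

lemma act_closed:
  "\<lbrakk>a \<in> carrier (tate_comp R k); u \<in> carrier (C i)\<rbrakk> \<Longrightarrow> act k i a u \<in> carrier (C (k + i))"
  using tact_closed[of i "max i (k + i)" k a u] tate_comp_closed by (simp add: act_eq)

lemma signed_act_closed:
  "\<lbrakk>a \<in> carrier (tate_comp R k); u \<in> carrier (C i)\<rbrakk> \<Longrightarrow>
   signed l (C (k + i)) (act k i a u) \<in> carrier (C (k + i))"
  using act_closed by (simp add: signed_eq_smult[OF comp_module])

text \<open>Needed for the relators to generate a subgroup. The point is the balanced relator: the
  augmentation annihilates every \<open>a\<close> of nonzero degree, so the product with
  \<open>v\<close> stays in the required component although the quotient ring is concentrated in
  degree zero.\<close>

lemma relators_closed: "relators n \<subseteq> carrier (free_Abelian_group (symbols n))"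
proof
  fix x assume "x \<in> relators n"
  then show "x \<in> carrier (free_Abelian_group (symbols n))"
  proof cases
    case (add_left u i u' v)
    then have "(i, u \<oplus>\<^bsub>C i\<^esub> u', v) \<in> symbols n" "(i, u, v) \<in> symbols n" "(i, u', v) \<in> symbols n"
      by auto
    then show ?thesis
      unfolding add_left carrier_free_Abelian_group_iff
      by (intro order.trans[OF keys_diff] Un_least) auto
  next
    case (add_right u i v v')
    then have "v \<oplus>\<^bsub>component V (n - i)\<^esub> v' \<in> carrier (component V (n - i))"
      by (auto simp: V_simps split: if_splits)
    then have "(i, u, v \<oplus>\<^bsub>component V (n - i)\<^esub> v') \<in> symbols n" "(i, u, v) \<in> symbols n" "(i, u, v') \<in> symbols n"
      using add_right by auto
    then show ?thesis
      unfolding add_right carrier_free_Abelian_group_iff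
      by (intro order.trans[OF keys_diff] Un_least) auto
  next
    case (balanced u i a k v)
    have a: "a \<in> carrier (tate_comp R k)" using balanced by simp
    have v: "v \<in> carrier (component V (n - (k + i)))" using balanced by (simp add: algebra_simps)
    have "augmentation_act R f k (n - i - k) a v \<in> carrier (component V (n - i))"
    proof (cases "k = 0")
      case True
      then show ?thesis using v a by (auto simp: augmentation_simps V_simps split: if_splits)
    next
      case False
      then show ?thesis using V_closed[OF v] by (simp add: augmentation_simps)
    qed
    then have "(k + i, signed (k * i) (C (k + i)) (act k i a u), v) \<in> symbols n"
      "(i, u, augmentation_act R f k (n - i - k) a v) \<in> symbols n"
      using balanced(2) v signed_act_closed[OF a balanced(2)] by auto
    then show ?thesis
      unfolding balanced carrier_free_Abelian_group_iff
      by (intro order.trans[OF keys_diff] Un_least) auto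
  qed
qed

lemma relations_subgroup: "subgroup (relations n) (free_Abelian_group (symbols n))"
  unfolding tensor_relations_def using relators_closed
  by (intro group.generate_is_subgroup group_free_Abelian_group)

lemma relator_in_relations: "x \<in> relators n \<Longrightarrow> x \<in> relations n"
  unfolding tensor_relations_def by (rule generate.incl)

lemma relations_zero: "0 \<in> relations n"
  using subgroup.one_closed[OF relations_subgroup] by simp

lemma relations_add: "\<lbrakk>x \<in> relations n; y \<in> relations n\<rbrakk> \<Longrightarrow> x + y \<in> relations n"
  using subgroup.m_closed[OF relations_subgroup] by simp

lemma relations_closed: "x \<in> relations n \<Longrightarrow> Poly_Mapping.keys x \<subseteq> symbols n"
  by (drule subsetD[OF subgroup.subset[OF relations_subgroup]]) (simp only: carrier_free_Abelian_group_iff)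

lemma relations_minus: "x \<in> relations n \<Longrightarrow> - x \<in> relations n"
  using subgroup.m_inv_closed[OF relations_subgroup, of x n] relations_closed[of x n] by simp

lemma relations_diff: "\<lbrakk>x \<in> relations n; y \<in> relations n\<rbrakk> \<Longrightarrow> x - y \<in> relations n"
  using relations_add[OF _ relations_minus] by simp

definition equiv_mod :: "int \<Rightarrow> ((int \<times> 'c \<times> 'a set) \<Rightarrow>\<^sub>0 int) \<Rightarrow> ((int \<times> 'c \<times> 'a set) \<Rightarrow>\<^sub>0 int) \<Rightarrow> bool"
  where "equiv_mod n x y \<longleftrightarrow> x - y \<in> relations n"

lemma equiv_mod_refl: "equiv_mod n x x"
  by (simp add: equiv_mod_def relations_zero)

lemma equiv_mod_sym: "equiv_mod n x y \<Longrightarrow> equiv_mod n y x"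
  using relations_minus by (fastforce simp: equiv_mod_def)

lemma equiv_mod_trans [trans]: "\<lbrakk>equiv_mod n x y; equiv_mod n y z\<rbrakk> \<Longrightarrow> equiv_mod n x z"
  using relations_add[of "x - y" n "y - z"] by (simp add: equiv_mod_def)

lemma equiv_mod_add: "\<lbrakk>equiv_mod n x y; equiv_mod n x' y'\<rbrakk> \<Longrightarrow> equiv_mod n (x + x') (y + y')"
  using relations_add[of "x - y" n "x' - y'"] by (simp add: equiv_mod_def algebra_simps)

lemma equiv_mod_diff: "\<lbrakk>equiv_mod n x y; equiv_mod n x' y'\<rbrakk> \<Longrightarrow> equiv_mod n (x - x') (y - y')"
  using relations_diff[of "x - y" n "x' - y'"] by (simp add: equiv_mod_def algebra_simps)

lemma equiv_add_left:
  assumes "u \<in> carrier (C i)" "u' \<in> carrier (C i)" "v \<in> carrier (component V (n - i))"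
  shows "equiv_mod n (frag_of (i, u \<oplus>\<^bsub>C i\<^esub> u', v)) (frag_of (i, u, v) + frag_of (i, u', v))"
  using relator_in_relations[OF tensor_relators.add_left[OF assms]] by (simp add: equiv_mod_def algebra_simps)

text \<open>The relator that belongs to 0 + 0 = 0 is the negative of this symbol.\<close>

lemma equiv_zero_right:
  assumes "u \<in> carrier (C i)"
  shows "equiv_mod n (frag_of (i, u, \<zero>\<^bsub>Rq\<^esub>)) 0"
proof -
  have "frag_of (i, u, \<zero>\<^bsub>Rq\<^esub> \<oplus>\<^bsub>component V (n - i)\<^esub> \<zero>\<^bsub>Rq\<^esub>) - frag_of (i, u, \<zero>\<^bsub>Rq\<^esub>) - frag_of (i, u, \<zero>\<^bsub>Rq\<^esub>)
      \<in> relations n"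
    by (intro relator_in_relations tensor_relators.add_right assms V_zero_mem)
  then have "- frag_of (i, u, \<zero>\<^bsub>Rq\<^esub>) \<in> relations n" by (simp add: V_simps)
  then show ?thesis using relations_minus by (fastforce simp: equiv_mod_def)
qed

lemma equiv_balanced:
  assumes "u \<in> carrier (C i)" "a \<in> carrier (tate_comp R k)" "v \<in> carrier (component V (n - i - k))"
  shows "equiv_mod n (frag_of (k + i, signed (k * i) (C (k + i)) (act k i a u), v))
    (frag_of (i, u, augmentation_act R f k (n - i - k) a v))"
  unfolding equiv_mod_def
  by (intro relator_in_relations tensor_relators.balanced) (use assms in simp_all)

text \<open>The balanced relator for \<open>a\<close> of degree zero, where no sign occurs and the
  Tate construction acts by scalars.\<close>

lemma equiv_scalar:
  assumes "u \<in> carrier (C n)" "a \<in> carrier R" "r \<in> carrier R"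
  shows "equiv_mod n (frag_of (n, u, pr a \<otimes>\<^bsub>Rq\<^esub> pr r)) (frag_of (n, a \<odot>\<^bsub>C n\<^esub> u, pr r))"
  using equiv_mod_sym[OF equiv_balanced[of u n a 0 "pr r" n]] assms
    tact_degree_zero[OF order.refl assms(2,1)] act_eq[of a 0 u n]
  by (simp add: V_simps signed_def augmentation_simps)

abbreviation elt :: "int \<Rightarrow> 'c \<Rightarrow> (int \<times> 'c \<times> 'a set) \<Rightarrow>\<^sub>0 int"
  where "elt n u \<equiv> frag_of (n, u, \<one>\<^bsub>Rq\<^esub>)"

lemma one_mem_V: "\<one>\<^bsub>Rq\<^esub> \<in> carrier (component V (n - n))"
  by (simp add: V_simps)

lemma equiv_elt:
  assumes "u \<in> carrier (C n)" "r \<in> carrier R"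
  shows "equiv_mod n (frag_of (n, u, pr r)) (elt n (r \<odot>\<^bsub>C n\<^esub> u))"
  using equiv_scalar[OF assms one_closed] assms by simp

lemma elt_add:
  "\<lbrakk>u \<in> carrier (C n); u' \<in> carrier (C n)\<rbrakk> \<Longrightarrow>
   equiv_mod n (elt n (u \<oplus>\<^bsub>C n\<^esub> u')) (elt n u + elt n u')"
  by (rule equiv_add_left[OF _ _ one_mem_V])

lemma elt_zero: "equiv_mod n (elt n \<zero>\<^bsub>C n\<^esub>) 0"
proof -
  have "equiv_mod n (elt n \<zero>\<^bsub>C n\<^esub>) (elt n \<zero>\<^bsub>C n\<^esub> + elt n \<zero>\<^bsub>C n\<^esub>)"
    using elt_add[OF U.M.zero_closed U.M.zero_closed] by simp
  from equiv_mod_diff[OF this equiv_mod_refl, of "elt n \<zero>\<^bsub>C n\<^esub>"]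
  show ?thesis by (simp add: equiv_mod_sym)
qed

lemma elt_diff:
  assumes "u \<in> carrier (C n)" "u' \<in> carrier (C n)"
  shows "equiv_mod n (elt n (u \<ominus>\<^bsub>C n\<^esub> u')) (elt n u - elt n u')"
proof -
  have "(u \<ominus>\<^bsub>C n\<^esub> u') \<oplus>\<^bsub>C n\<^esub> u' = u"
    using assms by (simp add: U.M.minus_eq U.M.a_assoc U.M.l_neg)
  then have "equiv_mod n (elt n u) (elt n (u \<ominus>\<^bsub>C n\<^esub> u') + elt n u')"
    using elt_add[of "u \<ominus>\<^bsub>C n\<^esub> u'" n u'] assms by simp
  from equiv_mod_diff[OF this equiv_mod_refl, of "elt n u'"]
  show ?thesis by (simp add: equiv_mod_sym)
qed

text \<open>The terms of \<open>u\<close> are of two kinds. At a generator of degree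
  \<open>n\<close> the coefficient lies in the ideal of \<open>f\<close> and dies in the quotient
  ring. At a lower generator the term is a e with a of positive degree, and a moves across the
  tensor sign to act on one by zero.\<close>

lemma elt_JU:
  assumes u: "u \<in> JU n"
  shows "equiv_mod n (elt n u) 0"
proof (rule U.free_basis_induct[OF basis[OF order.refl] JU_closed[OF u], where P = "\<lambda>u. equiv_mod n (elt n u) 0"])
  show "equiv_mod n (elt n \<zero>\<^bsub>C n\<^esub>) 0" by (rule elt_zero)
  show "equiv_mod n (elt n (x \<oplus>\<^bsub>C n\<^esub> y)) 0"
    if "x \<in> carrier (C n)" "y \<in> carrier (C n)"
      "equiv_mod n (elt n x) 0" "equiv_mod n (elt n y) 0" for x y
    using equiv_mod_trans[OF elt_add[OF that(1,2)] equiv_mod_add[OF that(3,4)]] by simp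
next
  fix p assume p: "p \<in> tate_index E n"
  obtain i e where pe: "p = (i, e)" and i: "0 \<le> i" "i \<le> n" "e \<in> E i" using p by (cases p) auto
  let ?c = "cf n u p"
  have c: "?c \<in> carrier R" using cf_closed[OF order.refl JU_closed[OF u]] .
  have e: "e \<in> carrier (C i)" using E_closed[OF i(1) order.refl i(3)] .
  show "equiv_mod n (elt n (?c \<odot>\<^bsub>C n\<^esub> W n p)) 0"
  proof (cases "i = n")
    case True
    have "?c \<in> PIdl f" using u pe True by (simp add: JU_def)
    then have "pr ?c = \<zero>\<^bsub>Rq\<^esub>" using pr_eq_zero_iff c by simp
    then have "equiv_mod n (elt n (?c \<odot>\<^bsub>C n\<^esub> e)) (frag_of (n, e, \<zero>\<^bsub>Rq\<^esub>))"
      using equiv_mod_sym[OF equiv_elt[of e n ?c]] e c True by simp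
    then have "equiv_mod n (elt n (?c \<odot>\<^bsub>C n\<^esub> e)) 0"
      using equiv_mod_trans equiv_zero_right[of e n n] e True by blast
    then show ?thesis using W_diag[of n n e] pe i True by simp
  next
    case False
    define k where "k = n - i"
    have k: "k > 0" "k + i = n" "n - i - k = 0" using False i by (auto simp: k_def)
    \<comment> \<open>The balanced relator carries the sign of the right action. Multiplying the
      coefficient by the same sign beforehand cancels it.\<close>
    let ?s = "sgn_elt R (k * i)"
    have a: "?s \<otimes> ?c \<in> carrier (tate_comp R k)" using c k by simp
    have t: "tact k i ?c e \<in> carrier (C n)"
      using tact_closed[of i n k ?c e] c e k i by simp
    have "signed (k * i) (C n) (act k i (?s \<otimes> ?c) e) = ?s \<odot>\<^bsub>C n\<^esub> (?s \<odot>\<^bsub>C n\<^esub> tact k i ?c e)"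
      using act_eq[OF a e] tact_smult_left[of i n k ?s ?c e] c e k i t
      by (simp add: signed_eq_smult[OF comp_module])
    also have "\<dots> = (?s \<otimes> ?s) \<odot>\<^bsub>C n\<^esub> tact k i ?c e"
      using t by (simp add: U.smult_assoc1)
    also have "?s \<otimes> ?s = \<one>" by (simp add: sgn_elt_def l_minus r_minus)
    also have "\<one> \<odot>\<^bsub>C n\<^esub> tact k i ?c e = ?c \<odot>\<^bsub>C n\<^esub> W n p"
      using smult_W[OF order.refl i c] t pe by (simp add: k_def)
    finally have "equiv_mod n (elt n (?c \<odot>\<^bsub>C n\<^esub> W n p))
        (frag_of (i, e, augmentation_act R f k 0 (?s \<otimes> ?c) \<one>\<^bsub>Rq\<^esub>))"
      using equiv_balanced[OF e a, of "\<one>\<^bsub>Rq\<^esub>" n] k by (simp add: V_simps)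
    also have "augmentation_act R f k 0 (?s \<otimes> ?c) \<one>\<^bsub>Rq\<^esub> = \<zero>\<^bsub>Rq\<^esub>"
      using k by (simp add: augmentation_simps)
    also have "equiv_mod n (frag_of (i, e, \<zero>\<^bsub>Rq\<^esub>)) 0" by (rule equiv_zero_right[OF e])
    finally show ?thesis .
  qed
qed

text \<open>That a class is nonzero cannot be read from the relators. For each \<open>e\<close> the
  universal property of the free abelian group gives a homomorphism to the quotient ring that
  annihilates them and sends \<open>elt n u\<close> to the coordinate of \<open>u\<close> at
  \<open>(n, e)\<close> modulo \<open>f\<close>.\<close>

lemma JU_if_elt:
  assumes u: "u \<in> carrier (C n)" and rel: "equiv_mod n (elt n u) 0"
  shows "u \<in> JU n"
proof -
  have "cf n u (n, e) \<in> PIdl f" for e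
  proof -
    let ?F = "free_Abelian_group (symbols n)" and ?G = "add_monoid Rq"
    \<comment> \<open>A symbol whose first entry differs from \<open>n\<close> has zero as its last
      entry, because the quotient ring lives in degree zero; the value zero is therefore
      forced.\<close>
    define \<chi> where "\<chi> = (\<lambda>(i, u, v). if i = n then v \<otimes>\<^bsub>Rq\<^esub> pr (cf n u (n, e)) else \<zero>\<^bsub>Rq\<^esub>)"
    have cR: "cf n x (n, e) \<in> carrier R" if "x \<in> carrier (C n)" for x
      using cf_closed[OF order.refl that] .
    have "\<chi> ` symbols n \<subseteq> carrier ?G"
      using cR V_closed by (auto simp: \<chi>_def)
    then obtain h where h: "h \<in> hom ?F ?G" and h_of: "\<And>s. s \<in> symbols n \<Longrightarrow> h (frag_of s) = \<chi> s"
      using comm_group.free_Abelian_group_universal[OF q.S.a_comm_group] by metis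
    interpret h: group_hom ?F ?G h
      using h group_free_Abelian_group q.S.a_group by (simp add: group_hom_def group_hom_axioms_def)
    have hd: "h (x - y) = h x \<oplus>\<^bsub>Rq\<^esub> \<ominus>\<^bsub>Rq\<^esub> h y" and hc: "h x \<in> carrier Rq"
      if "Poly_Mapping.keys x \<subseteq> symbols n" "Poly_Mapping.keys y \<subseteq> symbols n" for x y
    proof -
      show "h x \<in> carrier Rq" using h.hom_closed[of x] that by simp
      have "Poly_Mapping.keys (- y) \<subseteq> symbols n" using that by (simp add: keys_minus)
      then show "h (x - y) = h x \<oplus>\<^bsub>Rq\<^esub> \<ominus>\<^bsub>Rq\<^esub> h y"
        using h.hom_mult[of x "- y"] h.hom_inv[of y] that by (simp add: a_inv_def)
    qed
    have kz: "Poly_Mapping.keys (frag_of s) \<subseteq> symbols n" if "s \<in> symbols n" for s using that by simp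
    have "relators n \<subseteq> kernel ?F ?G h"
    proof
      fix x assume x: "x \<in> relators n"
      then have xF: "x \<in> carrier ?F" using relators_closed by blast
      from x have "h x = \<zero>\<^bsub>Rq\<^esub>"
      proof cases
        case (add_left u i u' v)
        have s: "(i, u \<oplus>\<^bsub>C i\<^esub> u', v) \<in> symbols n" "(i, u, v) \<in> symbols n" "(i, u', v) \<in> symbols n"
          using add_left by auto
        have v: "v \<in> carrier Rq" using V_closed add_left by blast
        have k: "Poly_Mapping.keys (frag_of (i, u \<oplus>\<^bsub>C i\<^esub> u', v) - frag_of (i, u, v)) \<subseteq> symbols n"
          using s by (intro order.trans[OF keys_diff] Un_least) auto
        have "h x = \<chi> (i, u \<oplus>\<^bsub>C i\<^esub> u', v) \<oplus>\<^bsub>Rq\<^esub> \<ominus>\<^bsub>Rq\<^esub> \<chi> (i, u, v) \<oplus>\<^bsub>Rq\<^esub> \<ominus>\<^bsub>Rq\<^esub> \<chi> (i, u', v)"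
          unfolding add_left(1) hd(1)[OF k kz[OF s(3)]] hd(1)[OF kz[OF s(1)] kz[OF s(2)]] h_of[OF s(1)] h_of[OF s(2)] h_of[OF s(3)] ..
        also have "\<dots> = \<zero>\<^bsub>Rq\<^esub>"
        proof (cases "i = n")
          case True
          have "pr (cf n u (n, e)) \<in> carrier Rq" "pr (cf n u' (n, e)) \<in> carrier Rq"
            using add_left True cR by auto
          then show ?thesis
            using add_left True v cR
            by (simp add: \<chi>_def cf_simps[OF order.refl] q.S.r_distr)
              (simp add: q.S.a_assoc q.S.a_comm[of "v \<otimes>\<^bsub>Rq\<^esub> pr (cf n u' (n, e))"] q.S.r_neg q.S.r_neg2 q.S.r_neg1)
        qed (simp add: \<chi>_def)
        finally show ?thesis .
      next
        case (add_right u i v v')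
        have "v \<oplus>\<^bsub>component V (n - i)\<^esub> v' \<in> carrier (component V (n - i))"
          using add_right by (auto simp: V_simps split: if_splits)
        then have s: "(i, u, v \<oplus>\<^bsub>component V (n - i)\<^esub> v') \<in> symbols n" "(i, u, v) \<in> symbols n" "(i, u, v') \<in> symbols n"
          using add_right by auto
        have v: "v \<in> carrier Rq" "v' \<in> carrier Rq" using V_closed add_right by blast+
        have k: "Poly_Mapping.keys (frag_of (i, u, v \<oplus>\<^bsub>component V (n - i)\<^esub> v') - frag_of (i, u, v)) \<subseteq> symbols n"
          using s by (intro order.trans[OF keys_diff] Un_least) auto
        have "h x = \<chi> (i, u, v \<oplus>\<^bsub>component V (n - i)\<^esub> v') \<oplus>\<^bsub>Rq\<^esub> \<ominus>\<^bsub>Rq\<^esub> \<chi> (i, u, v) \<oplus>\<^bsub>Rq\<^esub> \<ominus>\<^bsub>Rq\<^esub> \<chi> (i, u, v')"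
          unfolding add_right(1) hd(1)[OF k kz[OF s(3)]] hd(1)[OF kz[OF s(1)] kz[OF s(2)]] h_of[OF s(1)] h_of[OF s(2)] h_of[OF s(3)] ..
        also have "\<dots> = \<zero>\<^bsub>Rq\<^esub>"
        proof (cases "i = n")
          case True
          have p: "pr (cf n u (n, e)) \<in> carrier Rq" using add_right True cR by auto
          then show ?thesis
            using True v
            by (simp add: \<chi>_def V_simps q.S.l_distr)
              (simp add: q.S.a_assoc q.S.a_comm[of "v' \<otimes>\<^bsub>Rq\<^esub> pr (cf n u (n, e))"] q.S.r_neg q.S.r_neg2 q.S.r_neg1)
        qed (simp add: \<chi>_def)
        finally show ?thesis .
      next
        case (balanced u i a k v)
        have a: "a \<in> carrier (tate_comp R k)" using balanced by simp
        have aR: "a \<in> carrier R" using tate_comp_closed[OF a] .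
        have v: "v \<in> carrier (component V (n - (k + i)))" using balanced by (simp add: algebra_simps)
        have vR: "v \<in> carrier Rq" using V_closed[OF v] .
        have av: "augmentation_act R f k (n - i - k) a v \<in> carrier (component V (n - i))"
        proof (cases "k = 0")
          case True
          then show ?thesis using v aR by (auto simp: augmentation_simps V_simps split: if_splits)
        next
          case False
          then show ?thesis using vR by (simp add: augmentation_simps)
        qed
        let ?y = "signed (k * i) (C (k + i)) (act k i a u)"
        have s: "(k + i, ?y, v) \<in> symbols n" "(i, u, augmentation_act R f k (n - i - k) a v) \<in> symbols n"
          using balanced(2) v av signed_act_closed[OF a balanced(2)] by auto
        have ta: "tact k i a u \<in> carrier (C (k + i))" using act_closed[OF a balanced(2)] act_eq[OF a balanced(2)] by simp
        have "\<chi> (k + i, ?y, v) = \<chi> (i, u, augmentation_act R f k (n - i - k) a v)"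
        proof (cases "k = 0")
          case True
          show ?thesis
          proof (cases "i = n")
            case in': True
            have "?y = a \<odot>\<^bsub>C n\<^esub> u"
              using True in' act_eq[OF a balanced(2)] tact_degree_zero[OF order.refl aR, of u n] balanced(2)
              by (simp add: signed_def)
            then show ?thesis
              using True in' vR aR balanced(2) cR[of u]
              by (simp add: \<chi>_def augmentation_simps cf_simps[OF order.refl] q.S.m_ac)
          qed (use True in \<open>simp add: \<chi>_def\<close>)
        next
          case False
          have R0: "\<chi> (i, u, augmentation_act R f k (n - i - k) a v) = \<zero>\<^bsub>Rq\<^esub>"
            using False vR cR[of u] balanced(2) by (auto simp: \<chi>_def augmentation_simps)
          show ?thesis
          proof (cases "k + i = n")
            case True
            have "cf n (tact k i a u) (n, e) = tate_mul R k (i - n) a (cf i u (n, e))"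
              using cf_tact[of i "max i n" k a u "(n, e)"] balanced(2) aR True by simp
            \<comment> \<open>As \<open>k + i = n\<close> and \<open>k\<close> is nonzero, either
              \<open>k\<close> or \<open>i - n\<close> is negative: multiplication by an element of
              positive degree creates no coordinate at a generator of degree
              \<open>n\<close>.\<close>
            also have "\<dots> = \<zero>" using True False by (intro tate_mul_neg) auto
            finally have "cf n ?y (n, e) = \<zero>"
              using ta True act_eq[OF a balanced(2)]
              by (simp add: signed_eq_smult[OF comp_module] cf_simps[OF order.refl])
            then show ?thesis using R0 True vR by (simp add: \<chi>_def)
          qed (simp add: R0, simp add: \<chi>_def)
        qed
        moreover have "\<chi> (k + i, ?y, v) \<in> carrier Rq"
          using hc[OF kz[OF s(1)] kz[OF s(1)]] h_of[OF s(1)] by simp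
        ultimately show ?thesis
          unfolding balanced(1) hd(1)[OF kz[OF s(1)] kz[OF s(2)]] h_of[OF s(1)] h_of[OF s(2)]
          by (simp add: q.S.r_neg)
      qed
      then show "x \<in> kernel ?F ?G h" using xF by (simp add: kernel_def)
    qed
    then have "relations n \<subseteq> kernel ?F ?G h"
      unfolding tensor_relations_def
      by (rule group.generate_subgroup_incl[OF group_free_Abelian_group _ h.subgroup_kernel])
    moreover have "elt n u \<in> relations n" using rel by (simp add: equiv_mod_def)
    ultimately have "h (elt n u) = \<zero>\<^bsub>Rq\<^esub>" by (auto simp: kernel_def)
    moreover have "h (elt n u) = pr (cf n u (n, e))"
      using h_of[of "(n, u, \<one>\<^bsub>Rq\<^esub>)"] u one_mem_V cR[OF u] by (simp add: \<chi>_def)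
    ultimately show ?thesis using pr_eq_zero_iff[OF cR[OF u]] by simp
  qed
  then show ?thesis using u by (simp add: JU_def)
qed

end

text \<open>\<open>T\<close> is not known to be a group beforehand. Each axiom is pulled back along
  the surjections \<open>\<pi>\<close> and \<open>h\<close>, which spares calculations with cosets
  of formal sums.\<close>

lemma module_image:
  assumes "module R M" "cring S" and h: "h \<in> ring_hom R S" "\<And>s. s \<in> carrier S \<Longrightarrow> \<exists>r\<in>carrier R. s = h r"
    and carrier: "carrier T = \<pi> ` carrier M"
    and add: "\<And>x y. \<lbrakk>x \<in> carrier M; y \<in> carrier M\<rbrakk> \<Longrightarrow> \<pi> x \<oplus>\<^bsub>T\<^esub> \<pi> y = \<pi> (x \<oplus>\<^bsub>M\<^esub> y)"
    and zero: "\<zero>\<^bsub>T\<^esub> = \<pi> \<zero>\<^bsub>M\<^esub>"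
    and smult: "\<And>r x. \<lbrakk>r \<in> carrier R; x \<in> carrier M\<rbrakk> \<Longrightarrow> h r \<odot>\<^bsub>T\<^esub> \<pi> x = \<pi> (r \<odot>\<^bsub>M\<^esub> x)"
  shows "module S T"
proof -
  interpret M: module R M by fact
  interpret S: cring S by fact
  have elim: "\<exists>x\<in>carrier M. t = \<pi> x" if "t \<in> carrier T" for t using that carrier by auto
  have closed: "\<pi> x \<in> carrier T" if "x \<in> carrier M" for x using that carrier by auto
  note hom = ring_hom_add[OF h(1)] ring_hom_mult[OF h(1)] ring_hom_one[OF h(1)] ring_hom_closed[OF h(1)]
  show ?thesis
  proof (rule moduleI)
    show "cring S" by fact
    show "abelian_group T"
    proof (rule abelian_groupI)
      fix s assume "s \<in> carrier T"
      then obtain x where x: "x \<in> carrier M" "s = \<pi> x" by (metis elim)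
      show "\<zero>\<^bsub>T\<^esub> \<oplus>\<^bsub>T\<^esub> s = s" using x add[of "\<zero>\<^bsub>M\<^esub>" x] by (simp add: zero)
      show "\<exists>t\<in>carrier T. t \<oplus>\<^bsub>T\<^esub> s = \<zero>\<^bsub>T\<^esub>"
        using x add[of "\<ominus>\<^bsub>M\<^esub> x" x] by (intro bexI[of _ "\<pi> (\<ominus>\<^bsub>M\<^esub> x)"]) (auto simp: zero M.M.l_neg closed)
      fix t assume "t \<in> carrier T"
      then obtain y where y: "y \<in> carrier M" "t = \<pi> y" by (metis elim)
      show "s \<oplus>\<^bsub>T\<^esub> t \<in> carrier T" using x y by (simp add: add closed)
      show "s \<oplus>\<^bsub>T\<^esub> t = t \<oplus>\<^bsub>T\<^esub> s" using x y by (simp add: add M.M.a_comm)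
      fix u assume "u \<in> carrier T"
      then obtain z where z: "z \<in> carrier M" "u = \<pi> z" by (metis elim)
      show "s \<oplus>\<^bsub>T\<^esub> t \<oplus>\<^bsub>T\<^esub> u = s \<oplus>\<^bsub>T\<^esub> (t \<oplus>\<^bsub>T\<^esub> u)" using x y z by (simp add: add M.M.a_assoc)
    qed (simp add: zero closed)
  next
    fix a s assume "a \<in> carrier S" "s \<in> carrier T"
    then obtain r x where "r \<in> carrier R" "a = h r" "x \<in> carrier M" "s = \<pi> x" by (metis elim h(2))
    then show "a \<odot>\<^bsub>T\<^esub> s \<in> carrier T" by (simp add: smult closed)
  next
    fix a b s assume "a \<in> carrier S" "b \<in> carrier S" "s \<in> carrier T"
    then obtain r r' x where *: "r \<in> carrier R" "a = h r" "r' \<in> carrier R" "b = h r'" "x \<in> carrier M" "s = \<pi> x"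
      by (metis elim h(2))
    have "(a \<oplus>\<^bsub>S\<^esub> b) \<odot>\<^bsub>T\<^esub> s = h (r \<oplus>\<^bsub>R\<^esub> r') \<odot>\<^bsub>T\<^esub> \<pi> x" using * by (simp add: hom)
    then show "(a \<oplus>\<^bsub>S\<^esub> b) \<odot>\<^bsub>T\<^esub> s = a \<odot>\<^bsub>T\<^esub> s \<oplus>\<^bsub>T\<^esub> b \<odot>\<^bsub>T\<^esub> s"
      using * smult[of "r \<oplus>\<^bsub>R\<^esub> r'" x] by (simp add: smult add M.smult_l_distr)
    have "(a \<otimes>\<^bsub>S\<^esub> b) \<odot>\<^bsub>T\<^esub> s = h (r \<otimes>\<^bsub>R\<^esub> r') \<odot>\<^bsub>T\<^esub> \<pi> x" using * by (simp add: hom)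
    then show "(a \<otimes>\<^bsub>S\<^esub> b) \<odot>\<^bsub>T\<^esub> s = a \<odot>\<^bsub>T\<^esub> (b \<odot>\<^bsub>T\<^esub> s)"
      using * smult[of "r \<otimes>\<^bsub>R\<^esub> r'" x] by (simp add: smult M.smult_assoc1)
  next
    fix a s t assume "a \<in> carrier S" "s \<in> carrier T" "t \<in> carrier T"
    then obtain r x y where "r \<in> carrier R" "a = h r" "x \<in> carrier M" "s = \<pi> x" "y \<in> carrier M" "t = \<pi> y"
      by (metis elim h(2))
    then show "a \<odot>\<^bsub>T\<^esub> (s \<oplus>\<^bsub>T\<^esub> t) = a \<odot>\<^bsub>T\<^esub> s \<oplus>\<^bsub>T\<^esub> a \<odot>\<^bsub>T\<^esub> t" by (simp add: smult add M.smult_r_distr)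
  next
    fix s assume "s \<in> carrier T"
    then obtain x where "x \<in> carrier M" "s = \<pi> x" by (metis elim)
    then show "\<one>\<^bsub>S\<^esub> \<odot>\<^bsub>T\<^esub> s = s" using smult[of "\<one>\<^bsub>R\<^esub>" x] hom(3) by simp
  qed
qed

lemma tensor_complex_simps:
  "carrier (component (tensor_complex A U actU V actV) n) = carrier (tensor_group A U actU V actV n)"
  "ring.zero (component (tensor_complex A U actU V actV) n) = monoid.one (tensor_group A U actU V actV n)"
  "ring.add (component (tensor_complex A U actU V actV) n) = monoid.mult (tensor_group A U actU V actV n)"
  "smult (component (tensor_complex A U actU V actV) n) s Y = (\<Union>x\<in>Y. tensor_class A U actU V actV n
    (frag_extend (\<lambda>(i, u, v). frag_of (i, u, s \<odot>\<^bsub>component V (n - i)\<^esub> v)) x))"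
  "bdry (tensor_complex A U actU V actV) n Y = (\<Union>x\<in>Y. tensor_class A U actU V actV (n - 1)
    (frag_extend (\<lambda>(i, u, v). frag_of (i - 1, bdry U i u, v)
      + frag_cmul (if even i then 1 else -1) (frag_of (i, u, bdry V (n - i) v))) x))"
  by (simp_all add: tensor_complex_def)

lemma tensor_group_simps:
  "carrier (tensor_group A U actU V actV n) =
    tensor_class A U actU V actV n ` carrier (free_Abelian_group (tensor_symbols U V n))"
  "monoid.one (tensor_group A U actU V actV n) = tensor_relations A U actU V actV n"
  "monoid.mult (tensor_group A U actU V actV n) = set_mult (free_Abelian_group (tensor_symbols U V n))"
  unfolding tensor_group_def tensor_class_def by (simp_all add: carrier_FactGroup)

section \<open>The tensor complex as the quotient of U by JU\<close>

context tate_tensor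
begin

lemma bdry_diff:
  assumes "u \<in> carrier (C n)" "w \<in> carrier (C n)"
  shows "bdry U n (u \<ominus>\<^bsub>C n\<^esub> w) = bdry U n u \<ominus>\<^bsub>C (n - 1)\<^esub> bdry U n w"
proof -
  have "bdry U n (\<ominus>\<^bsub>C n\<^esub> w) = \<ominus>\<^bsub>C (n - 1)\<^esub> bdry U n w"
    using bdry_smult[of "\<ominus> \<one>" w n] assms(2) bdry_closed[OF assms(2)] by (simp add: U.smult_l_minus)
  then show ?thesis using assms by (simp add: U.M.minus_eq bdry_add)
qed

definition frag_bdry :: "int \<Rightarrow> ((int \<times> 'c \<times> 'a set) \<Rightarrow>\<^sub>0 int) \<Rightarrow> ((int \<times> 'c \<times> 'a set) \<Rightarrow>\<^sub>0 int)"
  where "frag_bdry n = frag_extend (\<lambda>(i, u, v). frag_of (i - 1, bdry U i u, v)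
    + frag_cmul (if even i then 1 else -1) (frag_of (i, u, bdry V (n - i) v)))"

definition frag_smult :: "int \<Rightarrow> 'a set \<Rightarrow> ((int \<times> 'c \<times> 'a set) \<Rightarrow>\<^sub>0 int) \<Rightarrow> ((int \<times> 'c \<times> 'a set) \<Rightarrow>\<^sub>0 int)"
  where "frag_smult n s = frag_extend (\<lambda>(i, u, v). frag_of (i, u, s \<odot>\<^bsub>component V (n - i)\<^esub> v))"

text \<open>The quotient ring has zero differential, so the second summand of the formula is, up to
  sign, a symbol with last entry zero.\<close>

lemma frag_bdry_symbol:
  assumes "u \<in> carrier (C i)"
  shows "equiv_mod m (frag_bdry n (frag_of (i, u, v))) (frag_of (i - 1, bdry U i u, v))"
proof -
  let ?s = "frag_cmul (if even i then 1 else -1) (frag_of (i, u, \<zero>\<^bsub>Rq\<^esub>))"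
  have "equiv_mod m ?s 0"
    using equiv_zero_right[OF assms, of m] equiv_mod_diff[OF equiv_mod_refl equiv_zero_right[OF assms, of m], of 0]
    by auto
  from equiv_mod_add[OF equiv_mod_refl this, of "frag_of (i - 1, bdry U i u, v)"]
  show ?thesis by (simp add: frag_bdry_def V_simps)
qed

text \<open>Every tensor is equivalent to some \<open>u \<otimes> 1\<close>, compatibly with the formulas on representatives
  that define the differential and the scalar action. Together with \<open>JU_if_elt\<close> this shows that
  both are well defined, so the signs in the tensor product need no further attention.\<close>

lemma representative:
  assumes "Poly_Mapping.keys x \<subseteq> symbols n"
  shows "\<exists>u\<in>carrier (C n). equiv_mod n x (elt n u) \<and>
    equiv_mod (n - 1) (frag_bdry n x) (elt (n - 1) (bdry U n u)) \<and>
    (\<forall>r\<in>carrier R. equiv_mod n (frag_smult n (pr r) x) (elt n (r \<odot>\<^bsub>C n\<^esub> u)))"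
  using assms
proof (rule free_Abelian_group_induct)
  have "equiv_mod (n - 1) 0 (elt (n - 1) (bdry U n \<zero>\<^bsub>C n\<^esub>))"
    unfolding bdry_zero by (rule equiv_mod_sym[OF elt_zero])
  then show "\<exists>u\<in>carrier (C n). equiv_mod n 0 (elt n u) \<and>
    equiv_mod (n - 1) (frag_bdry n 0) (elt (n - 1) (bdry U n u)) \<and>
    (\<forall>r\<in>carrier R. equiv_mod n (frag_smult n (pr r) 0) (elt n (r \<odot>\<^bsub>C n\<^esub> u)))"
    using equiv_mod_sym[OF elt_zero]
    by (intro bexI[of _ "\<zero>\<^bsub>C n\<^esub>"]) (simp_all add: frag_bdry_def frag_smult_def)
next
  fix x y
  assume "\<exists>u\<in>carrier (C n). equiv_mod n x (elt n u) \<and>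
    equiv_mod (n - 1) (frag_bdry n x) (elt (n - 1) (bdry U n u)) \<and>
    (\<forall>r\<in>carrier R. equiv_mod n (frag_smult n (pr r) x) (elt n (r \<odot>\<^bsub>C n\<^esub> u)))"
  then obtain u where u: "u \<in> carrier (C n)" "equiv_mod n x (elt n u)"
    "equiv_mod (n - 1) (frag_bdry n x) (elt (n - 1) (bdry U n u))"
    "\<And>r. r \<in> carrier R \<Longrightarrow> equiv_mod n (frag_smult n (pr r) x) (elt n (r \<odot>\<^bsub>C n\<^esub> u))" by blast
  assume "\<exists>u\<in>carrier (C n). equiv_mod n y (elt n u) \<and>
    equiv_mod (n - 1) (frag_bdry n y) (elt (n - 1) (bdry U n u)) \<and>
    (\<forall>r\<in>carrier R. equiv_mod n (frag_smult n (pr r) y) (elt n (r \<odot>\<^bsub>C n\<^esub> u)))"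
  then obtain w where w: "w \<in> carrier (C n)" "equiv_mod n y (elt n w)"
    "equiv_mod (n - 1) (frag_bdry n y) (elt (n - 1) (bdry U n w))"
    "\<And>r. r \<in> carrier R \<Longrightarrow> equiv_mod n (frag_smult n (pr r) y) (elt n (r \<odot>\<^bsub>C n\<^esub> w))" by blast
  let ?z = "u \<ominus>\<^bsub>C n\<^esub> w"
  have bz: "bdry U n ?z = bdry U n u \<ominus>\<^bsub>C (n - 1)\<^esub> bdry U n w"
    using bdry_diff[OF u(1) w(1)] .
  have rz: "r \<odot>\<^bsub>C n\<^esub> ?z = r \<odot>\<^bsub>C n\<^esub> u \<ominus>\<^bsub>C n\<^esub> r \<odot>\<^bsub>C n\<^esub> w"
    if "r \<in> carrier R" for r
    using that u(1) w(1) by (simp add: U.M.minus_eq U.smult_r_distr U.smult_r_minus)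
  have "equiv_mod n (x - y) (elt n ?z)"
    using equiv_mod_trans[OF equiv_mod_diff[OF u(2) w(2)] equiv_mod_sym[OF elt_diff[OF u(1) w(1)]]] .
  moreover have "equiv_mod (n - 1) (frag_bdry n (x - y)) (elt (n - 1) (bdry U n ?z))"
    using equiv_mod_trans[OF equiv_mod_diff[OF u(3) w(3)] equiv_mod_sym[OF elt_diff[OF bdry_closed[OF u(1)] bdry_closed[OF w(1)]]]]
    by (simp add: bz frag_bdry_def frag_extend_diff)
  moreover have "equiv_mod n (frag_smult n (pr r) (x - y)) (elt n (r \<odot>\<^bsub>C n\<^esub> ?z))" if r: "r \<in> carrier R" for r
    using equiv_mod_trans[OF equiv_mod_diff[OF u(4) w(4)] equiv_mod_sym[OF elt_diff], OF r r] r u(1) w(1)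
    by (simp add: rz frag_smult_def frag_extend_diff)
  ultimately show "\<exists>u\<in>carrier (C n). equiv_mod n (x - y) (elt n u) \<and>
    equiv_mod (n - 1) (frag_bdry n (x - y)) (elt (n - 1) (bdry U n u)) \<and>
    (\<forall>r\<in>carrier R. equiv_mod n (frag_smult n (pr r) (x - y)) (elt n (r \<odot>\<^bsub>C n\<^esub> u)))"
    using u(1) w(1) by (intro bexI[of _ ?z]) auto
next
  fix s assume s: "s \<in> symbols n"
  obtain i u v where siuv: "s = (i, u, v)" by (cases s)
  then have u: "u \<in> carrier (C i)" and v: "v \<in> carrier (component V (n - i))" using s by auto
  show "\<exists>u\<in>carrier (C n). equiv_mod n (frag_of s) (elt n u) \<and>
    equiv_mod (n - 1) (frag_bdry n (frag_of s)) (elt (n - 1) (bdry U n u)) \<and>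
    (\<forall>r\<in>carrier R. equiv_mod n (frag_smult n (pr r) (frag_of s)) (elt n (r \<odot>\<^bsub>C n\<^esub> u)))"
  proof (cases "i = n")
    case True
    have un: "u \<in> carrier (C n)" using u True by simp
    obtain a where a: "a \<in> carrier R" "v = pr a" using pr_surj[OF V_closed[OF v]] by blast
    have 1: "equiv_mod n (frag_of s) (elt n (a \<odot>\<^bsub>C n\<^esub> u))"
      using equiv_elt[OF un a(1)] siuv True a by simp
    have 2: "equiv_mod (n - 1) (frag_bdry n (frag_of s)) (elt (n - 1) (bdry U n (a \<odot>\<^bsub>C n\<^esub> u)))"
      using equiv_mod_trans[OF frag_bdry_symbol[OF un, of "n - 1" n v] equiv_elt[OF bdry_closed[OF un] a(1), folded a(2)]]
        bdry_smult[OF a(1) un] siuv True by simp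
    have 3: "equiv_mod n (frag_smult n (pr r) (frag_of s)) (elt n (r \<odot>\<^bsub>C n\<^esub> (a \<odot>\<^bsub>C n\<^esub> u)))"
      if r: "r \<in> carrier R" for r
      using equiv_elt[OF un m_closed[OF r a(1)]] siuv True a r un
      by (simp add: frag_smult_def V_simps U.smult_assoc1)
    show ?thesis using 1 2 3 a(1) un by (intro bexI[of _ "a \<odot>\<^bsub>C n\<^esub> u"]) auto
  next
    case False
    then have v0: "v = \<zero>\<^bsub>Rq\<^esub>" using v by (simp add: V_simps)
    have z: "equiv_mod n (frag_of s) (elt n \<zero>\<^bsub>C n\<^esub>)"
      using equiv_mod_trans[OF equiv_zero_right[OF u] equiv_mod_sym[OF elt_zero]] siuv v0 by simp
    have 2: "equiv_mod (n - 1) (frag_bdry n (frag_of s)) (elt (n - 1) (bdry U n \<zero>\<^bsub>C n\<^esub>))"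
      using equiv_mod_trans[OF frag_bdry_symbol[OF u, of "n - 1" n v, unfolded v0]
          equiv_mod_trans[OF equiv_zero_right[OF bdry_closed[OF u]] equiv_mod_sym[OF elt_zero]]]
      by (simp add: bdry_zero siuv v0)
    have 3: "equiv_mod n (frag_smult n (pr r) (frag_of s)) (elt n (r \<odot>\<^bsub>C n\<^esub> \<zero>\<^bsub>C n\<^esub>))"
      if "r \<in> carrier R" for r
      using that z siuv v0 by (simp add: frag_smult_def V_simps)
    show ?thesis using z 2 3 by (intro bexI[of _ "\<zero>\<^bsub>C n\<^esub>"]) auto
  qed
qed

abbreviation "cls \<equiv> tensor_class (tate R f g) U act V (augmentation_act R f)"
abbreviation "TC \<equiv> tensor_complex (tate R f g) U act V (augmentation_act R f)"

lemma mem_cls: "y \<in> cls n x \<longleftrightarrow> equiv_mod n y x"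
proof
  assume "equiv_mod n y x"
  then have "y - x \<in> relations n" by (simp add: equiv_mod_def)
  then show "y \<in> cls n x"
    unfolding tensor_class_def r_coset_def by (auto intro!: bexI[of _ "y - x"])
qed (auto simp: tensor_class_def r_coset_def equiv_mod_def)

lemma cls_eq_iff: "cls n x = cls n y \<longleftrightarrow> equiv_mod n x y"
proof
  assume "cls n x = cls n y"
  then have "x \<in> cls n y" using mem_cls[of x n x] equiv_mod_refl by blast
  then show "equiv_mod n x y" by (simp add: mem_cls)
next
  assume xy: "equiv_mod n x y"
  show "cls n x = cls n y"
  proof (rule Set.set_eqI)
    fix z
    show "z \<in> cls n x \<longleftrightarrow> z \<in> cls n y"
      unfolding mem_cls using equiv_mod_trans[OF _ xy, of z] equiv_mod_trans[OF _ equiv_mod_sym[OF xy], of z] by blast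
  qed
qed

definition proj :: "int \<Rightarrow> 'c \<Rightarrow> ((int \<times> 'c \<times> 'a set) \<Rightarrow>\<^sub>0 int) set"
  where "proj n u = cls n (elt n u)"

lemma elt_keys: "u \<in> carrier (C n) \<Longrightarrow> Poly_Mapping.keys (elt n u) \<subseteq> symbols n"
  using one_mem_V by simp

text \<open>By \<open>elt_JU\<close> and \<open>JU_if_elt\<close> the elements with trivial class
  are exactly those of \<open>JU\<close>. Together with \<open>TC_carrier\<close> this identifies
  the tensor product with the quotient by \<open>JU\<close>.\<close>

lemma proj_eq_iff:
  assumes "u \<in> carrier (C n)" "w \<in> carrier (C n)"
  shows "proj n u = proj n w \<longleftrightarrow> u \<ominus>\<^bsub>C n\<^esub> w \<in> JU n"
proof -
  have uw: "u \<ominus>\<^bsub>C n\<^esub> w \<in> carrier (C n)" using assms by simp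
  have "equiv_mod n (elt n u) (elt n w) \<longleftrightarrow> equiv_mod n (elt n u - elt n w) 0"
    by (simp add: equiv_mod_def)
  also have "\<dots> \<longleftrightarrow> equiv_mod n (elt n (u \<ominus>\<^bsub>C n\<^esub> w)) 0"
    using equiv_mod_trans elt_diff[OF assms] equiv_mod_sym by blast
  also have "\<dots> \<longleftrightarrow> u \<ominus>\<^bsub>C n\<^esub> w \<in> JU n"
    using elt_JU JU_if_elt[OF uw] by blast
  finally show ?thesis by (simp add: proj_def cls_eq_iff)
qed

lemma proj_eq_zero_iff:
  assumes "u \<in> carrier (C n)"
  shows "proj n u = proj n \<zero>\<^bsub>C n\<^esub> \<longleftrightarrow> u \<in> JU n"
proof -
  have z: "\<ominus>\<^bsub>C n\<^esub> \<zero>\<^bsub>C n\<^esub> = \<zero>\<^bsub>C n\<^esub>"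
    using U.M.r_neg[OF U.M.zero_closed, of n] U.M.l_zero[OF U.M.a_inv_closed[OF U.M.zero_closed], of n] by metis
  have "u \<ominus>\<^bsub>C n\<^esub> \<zero>\<^bsub>C n\<^esub> = u"
    unfolding U.M.minus_eq z by (rule U.M.r_zero[OF assms])
  then show ?thesis using proj_eq_iff[OF assms U.M.zero_closed] by simp
qed

lemma TC_carrier: "carrier (component TC n) = proj n ` carrier (C n)"
proof -
  have c: "carrier (component TC n) = (\<lambda>x. cls n x) ` carrier (free_Abelian_group (symbols n))"
    unfolding tensor_complex_simps tensor_group_simps ..
  show ?thesis
  proof
    show "carrier (component TC n) \<subseteq> proj n ` carrier (C n)"
    proof
      fix Y assume "Y \<in> carrier (component TC n)"
      then obtain x where x: "Poly_Mapping.keys x \<subseteq> symbols n" "Y = cls n x"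
        unfolding c by (elim imageE) (simp only: carrier_free_Abelian_group_iff)
      then obtain u where u: "u \<in> carrier (C n)" "equiv_mod n x (elt n u)"
        using representative by blast
      then show "Y \<in> proj n ` carrier (C n)"
        unfolding x(2) proj_def by (intro image_eqI[of _ _ u]) (simp_all add: cls_eq_iff)
    qed
    show "proj n ` carrier (C n) \<subseteq> carrier (component TC n)"
    proof
      fix Y assume "Y \<in> proj n ` carrier (C n)"
      then obtain u where u: "u \<in> carrier (C n)" "Y = cls n (elt n u)" by (auto simp: proj_def)
      have "elt n u \<in> carrier (free_Abelian_group (symbols n))"
        using elt_keys[OF u(1)] unfolding carrier_free_Abelian_group_iff .
      then show "Y \<in> carrier (component TC n)" unfolding c u(2) by (rule imageI)
    qed
  qed
qed

lemma relations_normal: "relations n \<lhd> free_Abelian_group (symbols n)"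
  using comm_group.subgroup_imp_normal[OF abelian_free_Abelian_group relations_subgroup] .

lemma TC_add:
  assumes "u \<in> carrier (C n)" "w \<in> carrier (C n)"
  shows "proj n u \<oplus>\<^bsub>component TC n\<^esub> proj n w = proj n (u \<oplus>\<^bsub>C n\<^esub> w)"
proof -
  have "proj n u \<oplus>\<^bsub>component TC n\<^esub> proj n w = cls n (elt n u + elt n w)"
    using normal.rcos_sum[OF relations_normal, of "elt n u" n "elt n w"] elt_keys[OF assms(1)] elt_keys[OF assms(2)]
    unfolding carrier_free_Abelian_group_iff proj_def tensor_complex_simps tensor_group_simps tensor_class_def
      mult_free_Abelian_group .
  also have "\<dots> = proj n (u \<oplus>\<^bsub>C n\<^esub> w)"
    unfolding proj_def cls_eq_iff by (rule equiv_mod_sym[OF elt_add[OF assms]])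
  finally show ?thesis .
qed

lemma TC_zero: "\<zero>\<^bsub>component TC n\<^esub> = proj n \<zero>\<^bsub>C n\<^esub>"
proof -
  have "\<zero>\<^bsub>component TC n\<^esub> = relations n" unfolding tensor_complex_simps tensor_group_simps ..
  also have "\<dots> = cls n 0" by (auto simp: mem_cls equiv_mod_def)
  also have "\<dots> = proj n \<zero>\<^bsub>C n\<^esub>"
    unfolding proj_def cls_eq_iff by (rule equiv_mod_sym[OF elt_zero])
  finally show ?thesis .
qed

text \<open>The operations on cosets are unions over all representatives, so an arbitrary member
  \<open>x\<close> has to be controlled, not only \<open>elt n u\<close>. It behaves like some
  \<open>w\<close> that differs from \<open>u\<close> by an element of \<open>JU\<close>, and
  \<open>JU\<close> is stable under scalars and the differential.\<close>

lemma proj_cases: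
  assumes u: "u \<in> carrier (C n)" and x: "x \<in> proj n u"
  obtains w where "w \<in> carrier (C n)" "w \<ominus>\<^bsub>C n\<^esub> u \<in> JU n"
    "equiv_mod (n - 1) (frag_bdry n x) (elt (n - 1) (bdry U n w))"
    "\<And>r. r \<in> carrier R \<Longrightarrow> equiv_mod n (frag_smult n (pr r) x) (elt n (r \<odot>\<^bsub>C n\<^esub> w))"
proof -
  have xu: "equiv_mod n x (elt n u)" using x by (simp add: proj_def mem_cls)
  then have "Poly_Mapping.keys (x - elt n u) \<subseteq> symbols n" using relations_closed by (simp add: equiv_mod_def)
  then have "Poly_Mapping.keys ((x - elt n u) + elt n u) \<subseteq> symbols n"
    by (rule order.trans[OF Poly_Mapping.keys_add Un_least]) (rule elt_keys[OF u])
  then have "Poly_Mapping.keys x \<subseteq> symbols n" by simp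
  from representative[OF this] obtain w where w: "w \<in> carrier (C n)" and
    eqs: "equiv_mod n x (elt n w) \<and> equiv_mod (n - 1) (frag_bdry n x) (elt (n - 1) (bdry U n w)) \<and>
      (\<forall>r\<in>carrier R. equiv_mod n (frag_smult n (pr r) x) (elt n (r \<odot>\<^bsub>C n\<^esub> w)))"
    by (rule bexE)
  have "proj n w = proj n u"
    unfolding proj_def cls_eq_iff by (rule equiv_mod_trans[OF equiv_mod_sym[OF conjunct1[OF eqs]] xu])
  then have "w \<ominus>\<^bsub>C n\<^esub> u \<in> JU n" using proj_eq_iff[OF w u] by simp
  then show thesis
    using that[OF w _ conjunct1[OF conjunct2[OF eqs]]] bspec[OF conjunct2[OF conjunct2[OF eqs]]] by blast
qed

lemma TC_smult:
  assumes r: "r \<in> carrier R" and u: "u \<in> carrier (C n)"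
  shows "pr r \<odot>\<^bsub>component TC n\<^esub> proj n u = proj n (r \<odot>\<^bsub>C n\<^esub> u)"
proof -
  have "cls n (frag_smult n (pr r) x) = proj n (r \<odot>\<^bsub>C n\<^esub> u)" if x: "x \<in> proj n u" for x
  proof -
    obtain w where w: "w \<in> carrier (C n)" "w \<ominus>\<^bsub>C n\<^esub> u \<in> JU n"
      "equiv_mod n (frag_smult n (pr r) x) (elt n (r \<odot>\<^bsub>C n\<^esub> w))"
      using proj_cases[OF u x] r by metis
    have "r \<odot>\<^bsub>C n\<^esub> (w \<ominus>\<^bsub>C n\<^esub> u) = r \<odot>\<^bsub>C n\<^esub> w \<ominus>\<^bsub>C n\<^esub> r \<odot>\<^bsub>C n\<^esub> u"
      using r u w(1) by (simp add: U.M.minus_eq U.smult_r_distr U.smult_r_minus)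
    then have "proj n (r \<odot>\<^bsub>C n\<^esub> w) = proj n (r \<odot>\<^bsub>C n\<^esub> u)"
      using JU_smult[OF r w(2)] r u w(1) by (simp add: proj_eq_iff)
    moreover have "cls n (frag_smult n (pr r) x) = proj n (r \<odot>\<^bsub>C n\<^esub> w)"
      using w(3) by (simp add: proj_def cls_eq_iff)
    ultimately show ?thesis by simp
  qed
  \<comment> \<open>The coset is nonempty and all members of the union agree, so the union equals
    each of them.\<close>
  moreover have "elt n u \<in> proj n u" by (simp add: proj_def mem_cls equiv_mod_refl)
  moreover have "pr r \<odot>\<^bsub>component TC n\<^esub> proj n u = (\<Union>x\<in>proj n u. cls n (frag_smult n (pr r) x))"
    unfolding tensor_complex_simps frag_smult_def ..
  ultimately show ?thesis by blast
qed

lemma TC_bdry: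
  assumes u: "u \<in> carrier (C n)"
  shows "bdry TC n (proj n u) = proj (n - 1) (bdry U n u)"
proof -
  have "cls (n - 1) (frag_bdry n x) = proj (n - 1) (bdry U n u)" if x: "x \<in> proj n u" for x
  proof -
    obtain w where w: "w \<in> carrier (C n)" "w \<ominus>\<^bsub>C n\<^esub> u \<in> JU n"
      "equiv_mod (n - 1) (frag_bdry n x) (elt (n - 1) (bdry U n w))"
      using proj_cases[OF u x] by metis
    have "bdry U n (w \<ominus>\<^bsub>C n\<^esub> u) = bdry U n w \<ominus>\<^bsub>C (n - 1)\<^esub> bdry U n u"
      by (rule bdry_diff[OF w(1) u])
    then have "proj (n - 1) (bdry U n w) = proj (n - 1) (bdry U n u)"
      using bdry_JU[OF w(2)] u w(1) by (simp add: proj_eq_iff bdry_closed)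
    moreover have "cls (n - 1) (frag_bdry n x) = proj (n - 1) (bdry U n w)"
      using w(3) by (simp add: proj_def cls_eq_iff)
    ultimately show ?thesis by simp
  qed
  moreover have "elt n u \<in> proj n u" by (simp add: proj_def mem_cls equiv_mod_refl)
  moreover have "bdry TC n (proj n u) = (\<Union>x\<in>proj n u. cls (n - 1) (frag_bdry n x))"
    unfolding tensor_complex_simps frag_bdry_def ..
  ultimately show ?thesis by blast
qed

lemma TC_module: "module Rq (component TC n)"
  by (rule module_image[OF comp_module q.S.is_cring q.homh pr_surj TC_carrier TC_add TC_zero TC_smult])

sublocale TC: module Rq "component TC n" for n
  by (rule TC_module)

lemma proj_closed: "u \<in> carrier (C n) \<Longrightarrow> proj n u \<in> carrier (component TC n)"
  using TC_carrier by blast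

lemma TC_cases:
  assumes "Y \<in> carrier (component TC n)"
  obtains u where "u \<in> carrier (C n)" "Y = proj n u"
  using assms TC_carrier by blast

lemma TC_chain_complex: "chain_complex Rq TC"
proof (intro chain_complex.intro chain_complex_axioms.intro q.S.is_cring TC_module)
  show "bdry TC n \<in> module_hom Rq (component TC n) (component TC (n - 1))" for n
  proof -
    have "bdry TC n Y \<in> carrier (component TC (n - 1))" if "Y \<in> carrier (component TC n)" for Y
      using that by (rule TC_cases) (simp add: TC_bdry proj_closed bdry_closed)
    moreover have "bdry TC n (Y \<oplus>\<^bsub>component TC n\<^esub> Z) = bdry TC n Y \<oplus>\<^bsub>component TC (n - 1)\<^esub> bdry TC n Z"
      if YZ: "Y \<in> carrier (component TC n)" "Z \<in> carrier (component TC n)" for Y Z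
    proof -
      obtain u w where "u \<in> carrier (C n)" "Y = proj n u" "w \<in> carrier (C n)" "Z = proj n w"
        using YZ by (metis TC_cases)
      then show ?thesis by (simp add: TC_add TC_bdry bdry_add bdry_closed)
    qed
    moreover have "bdry TC n (s \<odot>\<^bsub>component TC n\<^esub> Y) = s \<odot>\<^bsub>component TC (n - 1)\<^esub> bdry TC n Y"
      if sY: "s \<in> carrier Rq" "Y \<in> carrier (component TC n)" for s Y
    proof -
      obtain r u where "r \<in> carrier R" "s = pr r" "u \<in> carrier (C n)" "Y = proj n u"
        using sY by (metis TC_cases pr_surj)
      then show ?thesis by (simp add: TC_smult TC_bdry bdry_smult bdry_closed)
    qed
    ultimately show ?thesis unfolding module_hom_def by blast
  qed
  show "bdry TC (n - 1) (bdry TC n Y) = \<zero>\<^bsub>component TC (n - 1 - 1)\<^esub>"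
    if "Y \<in> carrier (component TC n)" for Y n
    using that by (rule TC_cases) (simp add: TC_bdry bdry_closed bdry_bdry TC_zero)
qed

lemma proj_lincomb:
  assumes "finite I" "b \<in> I \<rightarrow> carrier (C n)" "c \<in> I \<rightarrow> carrier R"
  shows "proj n (lincomb (C n) b I c) = lincomb (component TC n) (\<lambda>i. proj n (b i)) I (\<lambda>i. pr (c i))"
  using assms
proof (induction I rule: finite_induct)
  case empty
  then show ?case by (simp add: TC_zero)
next
  case (insert i I)
  have m: "b \<in> I \<rightarrow> carrier (C n)" "c \<in> I \<rightarrow> carrier R" "b i \<in> carrier (C n)" "c i \<in> carrier R"
    using insert by auto
  have "proj n (lincomb (C n) b (insert i I) c) =
      proj n (c i \<odot>\<^bsub>C n\<^esub> b i \<oplus>\<^bsub>C n\<^esub> lincomb (C n) b I c)"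
    using insert by (subst U.lincomb_insert) auto
  also have "\<dots> = pr (c i) \<odot>\<^bsub>component TC n\<^esub> proj n (b i) \<oplus>\<^bsub>component TC n\<^esub> proj n (lincomb (C n) b I c)"
    using m by (simp add: TC_add TC_smult)
  also have "proj n (lincomb (C n) b I c) = lincomb (component TC n) (\<lambda>i. proj n (b i)) I (\<lambda>i. pr (c i))"
    using insert m by simp
  also have "pr (c i) \<odot>\<^bsub>component TC n\<^esub> proj n (b i) \<oplus>\<^bsub>component TC n\<^esub> \<dots> =
      lincomb (component TC n) (\<lambda>i. proj n (b i)) (insert i I) (\<lambda>i. pr (c i))"
    using insert.hyps insert.prems by (subst TC.lincomb_insert) (auto intro: proj_closed)
  finally show ?case .
qed

text \<open>Modulo \<open>JU\<close> only the generators of degree exactly \<open>n\<close> survive,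
  with coefficients modulo \<open>f\<close>.\<close>

lemma TC_basis:
  "free_basis Rq (component TC n) (\<lambda>p. proj n (W n p)) {p \<in> tate_index E n. fst p = n}"
  (is "free_basis _ _ ?b ?I")
proof (rule TC.free_basisI)
  let ?J = "tate_index E n"
  have finJ: "finite ?J" and WJ: "W n \<in> ?J \<rightarrow> carrier (C n)"
    using U.free_basis_finite[OF basis[OF order.refl]] U.free_basis_closed[OF basis[OF order.refl]] by auto
  show finI: "finite ?I" using finJ by simp
  have WI: "W n \<in> ?I \<rightarrow> carrier (C n)" using WJ by auto
  show "?b \<in> ?I \<rightarrow> carrier (component TC n)" using WI proj_closed by auto
  have cfL: "cf n (lincomb (C n) (W n) ?I c) p = (if p \<in> ?I then c p else \<zero>)"
    if c: "c \<in> ?I \<rightarrow> carrier R" for c p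
  proof -
    let ?c = "\<lambda>p. if p \<in> ?I then c p else \<zero>"
    have cJ: "?c \<in> ?J \<rightarrow> carrier R"
      by (rule Pi_I) (simp add: funcset_mem[OF c] del: split_paired_All)
    have "lincomb (C n) (W n) ?I c = lincomb (C n) (W n) ?I ?c"
      using c WI by (intro U.lincomb_cong) auto
    also have "\<dots> = lincomb (C n) (W n) ?J ?c"
      using finJ WJ cJ by (intro U.lincomb_mono_neutral) auto
    finally show ?thesis using U.coord_lincomb[OF basis[OF order.refl] cJ, of p] by auto
  qed
  fix Y assume "Y \<in> carrier (component TC n)"
  then obtain u where u: "u \<in> carrier (C n)" "Y = proj n u" by (rule TC_cases)
  have cu: "cf n u p \<in> carrier R" for p using cf_closed[OF order.refl u(1)] .
  \<comment> \<open>The part of \<open>u\<close> at generators of degree \<open>n\<close>. The rest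
    has zero coordinates there and hence lies in \<open>JU\<close>.\<close>
  let ?u = "lincomb (C n) (W n) ?I (cf n u)"
  have u': "?u \<in> carrier (C n)" using WI cu by auto
  have "u \<ominus>\<^bsub>C n\<^esub> ?u \<in> JU n"
  proof -
    have "cf n (u \<ominus>\<^bsub>C n\<^esub> ?u) (n, e) = \<zero>" for e
    proof -
      have "cf n ?u (n, e) = cf n u (n, e)"
        using cfL[of "cf n u" "(n, e)"] cu cf_outside[of "(n, e)" n u] by auto
      then show ?thesis
        using u u' cu[of "(n, e)"]
        by (simp add: U.M.minus_eq cf_simps[OF order.refl] U.coord_minus[OF basis[OF order.refl]] r_neg)
    qed
    then show ?thesis
      using u u' additive_subgroup.zero_closed[OF ideal.axioms(1)[OF f_ideal]] by (simp add: JU_def)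
  qed
  then have "Y = proj n ?u" unfolding u(2) using proj_eq_iff[OF u(1) u'] by simp
  also have "\<dots> = lincomb (component TC n) ?b ?I (\<lambda>p. pr (cf n u p))"
    using finI WI cu by (intro proj_lincomb) auto
  finally have "Y = lincomb (component TC n) ?b ?I (\<lambda>p. pr (cf n u p))" .
  then show "\<exists>c\<in>?I \<rightarrow> carrier Rq. Y = lincomb (component TC n) ?b ?I c"
    by (rule bexI[where x = "\<lambda>p. pr (cf n u p)"]) (use cu in auto)
next
  fix c p assume c: "c \<in> {p \<in> tate_index E n. fst p = n} \<rightarrow> carrier Rq"
    "lincomb (component TC n) ?b {p \<in> tate_index E n. fst p = n} c = \<zero>\<^bsub>component TC n\<^esub>"
    "p \<in> {p \<in> tate_index E n. fst p = n}"
  let ?J = "tate_index E n" and ?I = "{p \<in> tate_index E n. fst p = n}"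
  have finJ: "finite ?J" and WJ: "W n \<in> ?J \<rightarrow> carrier (C n)"
    using U.free_basis_finite[OF basis[OF order.refl]] U.free_basis_closed[OF basis[OF order.refl]] by auto
  have "\<forall>p\<in>?I. \<exists>r. r \<in> carrier R \<and> c p = pr r" using c(1) pr_surj by blast
  then obtain r where r: "\<And>p. p \<in> ?I \<Longrightarrow> r p \<in> carrier R \<and> c p = pr (r p)"
    using bchoice[of ?I "\<lambda>p r. r \<in> carrier R \<and> c p = pr r"] by blast
  \<comment> \<open>Lifts of the coefficients, extended by zero to the full basis of degree
    \<open>n\<close>, so that membership in \<open>JU\<close> can be read from coordinates.\<close>
  define d where "d p = (if p \<in> ?I then r p else \<zero>)" for p
  have d: "d \<in> ?J \<rightarrow> carrier R" using r by (auto simp: d_def)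
  have "lincomb (C n) (W n) ?I d = lincomb (C n) (W n) ?J d"
    using finJ WJ d by (intro U.lincomb_mono_neutral) (auto simp: d_def)
  moreover have "lincomb (component TC n) ?b ?I c = lincomb (component TC n) ?b ?I (\<lambda>p. pr (d p))"
    using c(1) WJ r by (intro TC.lincomb_cong) (auto intro!: proj_closed simp: d_def)
  moreover have "\<dots> = proj n (lincomb (C n) (W n) ?I d)"
    using finJ WJ d by (intro proj_lincomb[symmetric]) auto
  ultimately have "proj n (lincomb (C n) (W n) ?J d) = proj n \<zero>\<^bsub>C n\<^esub>"
    using c(2) TC_zero by simp
  moreover have L: "lincomb (C n) (W n) ?J d \<in> carrier (C n)" using WJ d by auto
  ultimately have "lincomb (C n) (W n) ?J d \<in> JU n" using proj_eq_zero_iff by blast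
  moreover have "cf n (lincomb (C n) (W n) ?J d) p = r p"
    using U.coord_lincomb[OF basis[OF order.refl] d, of p] c(3) by (simp add: d_def)
  moreover have "p = (n, snd p)" using c(3) by (cases p) auto
  ultimately have "r p \<in> PIdl f" by (metis (mono_tags, lifting) JU_def mem_Collect_eq)
  then show "c p = \<zero>\<^bsub>Rq\<^esub>" using r[OF c(3)] pr_eq_zero_iff by auto
qed

end

section \<open>Homology, augmentation and minimality of the quotient complex\<close>

lemma restrict_scalars_simps [simp]:
  "carrier (restrict_scalars h M) = carrier M"
  "ring.zero (restrict_scalars h M) = \<zero>\<^bsub>M\<^esub>"
  "ring.add (restrict_scalars h M) = (\<oplus>\<^bsub>M\<^esub>)"
  "smult (restrict_scalars h M) r x = h r \<odot>\<^bsub>M\<^esub> x"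
  by (simp_all add: restrict_scalars_def)

context tate_tensor
begin

text \<open>The diagram chase of the long exact sequence. If \<open>u\<close> represents a cycle,
  its boundary lies in \<open>JU\<close>, is a cycle there, and so is the boundary of some
  \<open>w\<close> in \<open>JU\<close>. Then u - w is a cycle of \<open>U\<close> with the same
  class as \<open>u\<close>.\<close>

lemma TC_acyclic:
  assumes ann: "annihilator R f = PIdl g" "annihilator R g = PIdl f"
    and acyclic: "cycles U n = boundaries U n"
  shows "cycles TC n = boundaries TC n"
proof
  show "boundaries TC n \<subseteq> cycles TC n"
  proof
    fix Y assume "Y \<in> boundaries TC n"
    then obtain Z where Z: "Z \<in> carrier (component TC (n + 1))" "Y = bdry TC (n + 1) Z"
      unfolding boundaries_def by (rule imageE)
    obtain u where u: "u \<in> carrier (C (n + 1))" "Z = proj (n + 1) u" by (rule TC_cases[OF Z(1)])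
    have du: "bdry U (n + 1) u \<in> carrier (C n)" using bdry_closed[OF u(1)] by simp
    have Y: "Y = proj n (bdry U (n + 1) u)" unfolding Z(2) u(2) TC_bdry[OF u(1)] by simp
    have "bdry TC n Y = \<zero>\<^bsub>component TC (n - 1)\<^esub>"
      unfolding Y TC_bdry[OF du] using bdry_bdry[OF u(1)] by (simp add: TC_zero)
    then show "Y \<in> cycles TC n" unfolding Y cycles_def using proj_closed[OF du] by simp
  qed
  show "cycles TC n \<subseteq> boundaries TC n"
  proof
    fix Y assume "Y \<in> cycles TC n"
    then have Y: "Y \<in> carrier (component TC n)" "bdry TC n Y = \<zero>\<^bsub>component TC (n - 1)\<^esub>"
      unfolding cycles_def by auto
    obtain u where u: "u \<in> carrier (C n)" "Y = proj n u" by (rule TC_cases[OF Y(1)])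
    have "proj (n - 1) (bdry U n u) = proj (n - 1) \<zero>\<^bsub>C (n - 1)\<^esub>"
      using Y(2) TC_bdry[OF u(1)] u(2) by (simp add: TC_zero)
    then have "bdry U n u \<in> JU (n - 1)" using proj_eq_zero_iff[OF bdry_closed[OF u(1)]] by simp
    then obtain w where w: "w \<in> JU n" "bdry U n w = bdry U n u"
      using JU_acyclic[OF ann, of "bdry U n u" "n - 1"] bdry_bdry[OF u(1)] by auto
    have wc: "w \<in> carrier (C n)" by (rule JU_closed[OF w(1)])
    let ?z = "u \<ominus>\<^bsub>C n\<^esub> w"
    have "bdry U n ?z = \<zero>\<^bsub>C (n - 1)\<^esub>"
      using bdry_diff[OF u(1) wc] bdry_closed[OF u(1)] by (simp add: w(2) U.M.minus_eq U.M.r_neg)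
    then have "?z \<in> boundaries U n" unfolding acyclic[symmetric] using u wc by (simp add: cycles_def)
    then obtain x where x: "x \<in> carrier (C (n + 1))" "?z = bdry U (n + 1) x"
      unfolding boundaries_def by (rule imageE)
    have "u \<ominus>\<^bsub>C n\<^esub> ?z = w"
      using u(1) wc by (simp add: U.M.minus_eq U.M.minus_add U.M.a_assoc[symmetric] U.M.r_neg)
    then have "proj n u = proj n ?z" using proj_eq_iff[OF u(1), of ?z] u(1) wc w(1) by simp
    also have "\<dots> = bdry TC (n + 1) (proj (n + 1) x)" unfolding x(2) TC_bdry[OF x(1)] by simp
    finally show "Y \<in> boundaries TC n"
      unfolding u(2) boundaries_def using proj_closed[OF x(1)] by (rule image_eqI)
  qed
qed

text \<open>The map \<open>\<epsilon>\<close> kills \<open>JU 0\<close>: there every basis element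
  occurs with a coefficient from the ideal of \<open>f\<close>, which acts on \<open>M\<close> as
  zero. It therefore factors through the quotient, with the same image and with the classes of
  boundaries as kernel.\<close>

lemma TC_augmentation:
  assumes M: "module Rq M" and \<epsilon>: "\<epsilon> \<in> module_hom R (C 0) (restrict_scalars pr M)"
    and surj: "\<epsilon> ` carrier (C 0) = carrier M"
    and ker: "{x \<in> carrier (C 0). \<epsilon> x = \<zero>\<^bsub>M\<^esub>} = boundaries U 0"
  shows "\<exists>\<epsilon>'\<in>module_hom Rq (component TC 0) M. \<epsilon>' ` carrier (component TC 0) = carrier M \<and>
    {Y \<in> carrier (component TC 0). \<epsilon>' Y = \<zero>\<^bsub>M\<^esub>} = boundaries TC 0"
proof -
  interpret M: module Rq M by (rule M)
  have eps: "\<epsilon> x \<in> carrier M" "\<epsilon> (x \<oplus>\<^bsub>C 0\<^esub> y) = \<epsilon> x \<oplus>\<^bsub>M\<^esub> \<epsilon> y"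
    "\<epsilon> (r \<odot>\<^bsub>C 0\<^esub> x) = pr r \<odot>\<^bsub>M\<^esub> \<epsilon> x"
    if "x \<in> carrier (C 0)" "y \<in> carrier (C 0)" "r \<in> carrier R" for x y r
    using that module_homD[OF \<epsilon>] by simp_all
  have eps0: "\<epsilon> \<zero>\<^bsub>C 0\<^esub> = \<zero>\<^bsub>M\<^esub>"
    using eps(3)[of "\<zero>\<^bsub>C 0\<^esub>" "\<zero>\<^bsub>C 0\<^esub>" \<zero>] eps(1)[of "\<zero>\<^bsub>C 0\<^esub>" "\<zero>\<^bsub>C 0\<^esub>" \<zero>]
    by simp
  have eps_JU: "\<epsilon> u = \<zero>\<^bsub>M\<^esub>" if u: "u \<in> JU 0" for u
  proof (rule U.free_basis_induct[OF basis[OF order.refl] JU_closed[OF u], where P = "\<lambda>u. \<epsilon> u = \<zero>\<^bsub>M\<^esub>"])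
    show "\<epsilon> (x \<oplus>\<^bsub>C 0\<^esub> y) = \<zero>\<^bsub>M\<^esub>"
      if "x \<in> carrier (C 0)" "y \<in> carrier (C 0)" "\<epsilon> x = \<zero>\<^bsub>M\<^esub>" "\<epsilon> y = \<zero>\<^bsub>M\<^esub>" for x y
      using eps(2)[OF that(1,2) zero_closed] that(3,4) by simp
    fix p assume p: "p \<in> tate_index E 0"
    then obtain e where pe: "p = (0, e)" by (cases p) auto
    have W: "W 0 p \<in> carrier (C 0)" using W_closed[OF order.refl p] .
    have c: "cf 0 u p \<in> carrier R" using cf_closed[OF order.refl JU_closed[OF u]] .
    have "cf 0 u p \<in> PIdl f" using u unfolding pe JU_def by blast
    then have "pr (cf 0 u p) = \<zero>\<^bsub>Rq\<^esub>" using pr_eq_zero_iff[OF c] by blast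
    then show "\<epsilon> (cf 0 u p \<odot>\<^bsub>C 0\<^esub> W 0 p) = \<zero>\<^bsub>M\<^esub>"
      using eps(3)[OF W W c] eps(1)[OF W W c] by simp
  qed (rule eps0)
  \<comment> \<open>A representative is chosen; two choices differ by an element of
    \<open>JU 0\<close>.\<close>
  define \<epsilon>' where "\<epsilon>' Y = \<epsilon> (SOME u. u \<in> carrier (C 0) \<and> Y = proj 0 u)" for Y
  have eps': "\<epsilon>' (proj 0 u) = \<epsilon> u" if u: "u \<in> carrier (C 0)" for u
  proof -
    define w where "w = (SOME w. w \<in> carrier (C 0) \<and> proj 0 u = proj 0 w)"
    have w: "w \<in> carrier (C 0)" "proj 0 w = proj 0 u"
      unfolding w_def by (rule someI2[of _ u]; use u in simp)+
    have "w = (w \<ominus>\<^bsub>C 0\<^esub> u) \<oplus>\<^bsub>C 0\<^esub> u"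
      using u w(1) by (simp add: U.M.minus_eq U.M.a_assoc U.M.l_neg)
    moreover have "w \<ominus>\<^bsub>C 0\<^esub> u \<in> JU 0" using proj_eq_iff[OF w(1) u] w(2) by simp
    ultimately have "\<epsilon> w = \<zero>\<^bsub>M\<^esub> \<oplus>\<^bsub>M\<^esub> \<epsilon> u"
      using eps(2)[OF JU_closed u zero_closed] eps_JU by metis
    then show ?thesis using eps(1)[OF u u zero_closed] by (simp add: \<epsilon>'_def w_def)
  qed
  show ?thesis
  proof (intro bexI[of _ \<epsilon>'] conjI)
    show "\<epsilon>' ` carrier (component TC 0) = carrier M"
      unfolding TC_carrier image_image surj[symmetric] by (rule image_cong) (simp_all add: eps')
    show "{Y \<in> carrier (component TC 0). \<epsilon>' Y = \<zero>\<^bsub>M\<^esub>} = boundaries TC 0"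
    proof
      show "{Y \<in> carrier (component TC 0). \<epsilon>' Y = \<zero>\<^bsub>M\<^esub>} \<subseteq> boundaries TC 0"
      proof
        fix Y assume "Y \<in> {Y \<in> carrier (component TC 0). \<epsilon>' Y = \<zero>\<^bsub>M\<^esub>}"
        then have Y: "Y \<in> carrier (component TC 0)" "\<epsilon>' Y = \<zero>\<^bsub>M\<^esub>" by auto
        obtain u where u: "u \<in> carrier (C 0)" "Y = proj 0 u" by (rule TC_cases[OF Y(1)])
        have "\<epsilon> u = \<zero>\<^bsub>M\<^esub>" using Y(2) eps'[OF u(1)] u(2) by simp
        then have "u \<in> boundaries U 0" unfolding ker[symmetric] using u(1) by simp
        then obtain x where x: "x \<in> carrier (C (0 + 1))" "u = bdry U (0 + 1) x"
          unfolding boundaries_def by (rule imageE)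
        have "Y = bdry TC (0 + 1) (proj (0 + 1) x)" unfolding u(2) x(2) TC_bdry[OF x(1)] by simp
        then show "Y \<in> boundaries TC 0"
          unfolding boundaries_def using proj_closed[OF x(1)] by (rule image_eqI)
      qed
      show "boundaries TC 0 \<subseteq> {Y \<in> carrier (component TC 0). \<epsilon>' Y = \<zero>\<^bsub>M\<^esub>}"
      proof
        fix Y assume "Y \<in> boundaries TC 0"
        then obtain Z where Z: "Z \<in> carrier (component TC (0 + 1))" "Y = bdry TC (0 + 1) Z"
          unfolding boundaries_def by (rule imageE)
        obtain u where u: "u \<in> carrier (C (0 + 1))" "Z = proj (0 + 1) u" by (rule TC_cases[OF Z(1)])
        have Y: "Y = proj 0 (bdry U (0 + 1) u)" unfolding Z(2) u(2) TC_bdry[OF u(1)] by simp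
        have "bdry U (0 + 1) u \<in> boundaries U 0" unfolding boundaries_def using u(1) by (rule imageI)
        then have "bdry U (0 + 1) u \<in> carrier (C 0)" "\<epsilon> (bdry U (0 + 1) u) = \<zero>\<^bsub>M\<^esub>"
          unfolding ker[symmetric] by auto
        then show "Y \<in> {Y \<in> carrier (component TC 0). \<epsilon>' Y = \<zero>\<^bsub>M\<^esub>}"
          unfolding Y using eps' proj_closed by simp
      qed
    qed
    have "\<epsilon>' Y \<in> carrier M" if "Y \<in> carrier (component TC 0)" for Y
      using that by (rule TC_cases) (simp add: eps' eps(1)[OF _ _ zero_closed])
    moreover have "\<epsilon>' (Y \<oplus>\<^bsub>component TC 0\<^esub> Z) = \<epsilon>' Y \<oplus>\<^bsub>M\<^esub> \<epsilon>' Z"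
      if YZ: "Y \<in> carrier (component TC 0)" "Z \<in> carrier (component TC 0)" for Y Z
    proof -
      obtain u w where "u \<in> carrier (C 0)" "Y = proj 0 u" "w \<in> carrier (C 0)" "Z = proj 0 w"
        using YZ by (metis TC_cases)
      then show ?thesis by (simp add: TC_add eps' eps(2)[OF _ _ zero_closed])
    qed
    moreover have "\<epsilon>' (s \<odot>\<^bsub>component TC 0\<^esub> Y) = s \<odot>\<^bsub>M\<^esub> \<epsilon>' Y"
      if sY: "s \<in> carrier Rq" "Y \<in> carrier (component TC 0)" for s Y
    proof -
      obtain r u where ru: "r \<in> carrier R" "s = pr r" "u \<in> carrier (C 0)" "Y = proj 0 u"
        using sY by (metis TC_cases pr_surj)
      then show ?thesis by (simp add: TC_smult eps' eps(3)[OF ru(3,3)])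
    qed
    ultimately show "\<epsilon>' \<in> module_hom Rq (component TC 0) M" unfolding module_hom_def by blast
  qed
qed

text \<open>Reduction modulo \<open>f\<close> maps matrix entries from \<open>\<mm>\<close> into its
  image. The images of all elements of \<open>W (n - 1)\<close> may be used, since membership in the
  product asks for some linear combination rather than for coordinates.\<close>

lemma TC_minimal:
  assumes \<mm>: "ideal \<mm> R"
    and minimal: "bdry U n ` carrier (C n) \<subseteq> ideal_times_module R \<mm> (C (n - 1))"
  shows "bdry TC n ` carrier (component TC n) \<subseteq> ideal_times_module Rq (pr ` \<mm>) (component TC (n - 1))"
proof (rule image_subsetI)
  fix Y assume "Y \<in> carrier (component TC n)"
  then obtain u where u: "u \<in> carrier (C n)" "Y = proj n u" by (rule TC_cases)
  let ?x = "bdry U n u" and ?I = "tate_index E (n - 1)"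
  have x: "?x \<in> carrier (C (n - 1))" by (rule bdry_closed[OF u(1)])
  have xm: "?x \<in> ideal_times_module R \<mm> (C (n - 1))" using minimal u(1) by blast
  have c: "cf (n - 1) ?x p \<in> \<mm>" for p
    by (rule ideal_times_module_coord(2)[OF comp_module \<mm> basis[OF order.refl] xm])
  have fin: "finite ?I" and W: "W (n - 1) \<in> ?I \<rightarrow> carrier (C (n - 1))"
    using U.free_basis_finite[OF basis[OF order.refl]] U.free_basis_closed[OF basis[OF order.refl]] by auto
  have "bdry TC n Y = proj (n - 1) (lincomb (C (n - 1)) (W (n - 1)) ?I (cf (n - 1) ?x))"
    unfolding u(2) TC_bdry[OF u(1)] U.lincomb_coord[OF basis[OF order.refl] x] ..
  also have "\<dots> = lincomb (component TC (n - 1)) (\<lambda>p. proj (n - 1) (W (n - 1) p)) ?I (\<lambda>p. pr (cf (n - 1) ?x p))"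
    using cf_closed[OF order.refl x] by (intro proj_lincomb[OF fin W]) auto
  also have "\<dots> \<in> ideal_times_module Rq (pr ` \<mm>) (component TC (n - 1))"
  proof (rule lincomb_in_ideal_times_module[OF TC_module fin])
    show "(\<lambda>p. proj (n - 1) (W (n - 1) p)) \<in> ?I \<rightarrow> carrier (component TC (n - 1))"
      using W proj_closed by auto
    show "pr ` \<mm> \<subseteq> carrier Rq" using ideal.Icarr[OF \<mm>] by auto
    show "(\<lambda>p. pr (cf (n - 1) ?x p)) \<in> ?I \<rightarrow> pr ` \<mm>" using c by auto
  qed
  finally show "bdry TC n Y \<in> ideal_times_module Rq (pr ` \<mm>) (component TC (n - 1))" .
qed

lemma TC_minimal_free_resolution:
  assumes ann: "annihilator R f = PIdl g" "annihilator R g = PIdl f"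
    and \<mm>: "ideal \<mm> R" "\<one> \<notin> PIdl f"
    and M: "module Rq M" and res: "minimal_free_resolution R \<mm> U (restrict_scalars pr M)"
  shows "minimal_free_resolution Rq (pr ` \<mm>) TC M"
proof -
  have U0: "concentrated_ge 0 U" and ac: "\<And>n. n > 0 \<Longrightarrow> cycles U n = boundaries U n"
    and minimal: "\<And>n. bdry U n ` carrier (C n) \<subseteq> ideal_times_module R \<mm> (C (n - 1))"
    using res by (auto simp: minimal_free_resolution_def free_resolution_def)
  obtain \<epsilon> where "\<epsilon> \<in> module_hom R (C 0) (restrict_scalars pr M)"
    and "\<epsilon> ` carrier (C 0) = carrier M"
    and "{x \<in> carrier (C 0). \<epsilon> x = \<zero>\<^bsub>M\<^esub>} = boundaries U 0"
    using res unfolding minimal_free_resolution_def free_resolution_def by auto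
  note aug = TC_augmentation[OF M this]
  have one: "\<one>\<^bsub>Rq\<^esub> \<noteq> \<zero>\<^bsub>Rq\<^esub>"
    using pr_eq_zero_iff[OF one_closed] \<mm>(2) by simp
  have "concentrated_ge 0 TC"
    using U0 by (auto simp: concentrated_ge_def TC_carrier TC_zero)
  moreover have "finite_free_module Rq (component TC n)" for n
    by (rule free_basis_imp_finite_free[OF TC_module one TC_basis])
  ultimately show ?thesis
    unfolding minimal_free_resolution_def free_resolution_def
    using TC_chain_complex TC_acyclic[OF ann ac] aug TC_minimal[OF \<mm>(1) minimal] by blast
qed

end

theorem theorem2p1:
  fixes Q :: "('q, 'x) ring_scheme" and \<nn> :: "'q set" and f g :: 'q
    and M :: "('q set, 'm) module" and U :: "('q, 'u) chain_complex"
  assumes "noetherian_local_ring Q \<nn>"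
    and "f \<in> \<nn> - \<nn> \<cdot>\<^bsub>Q\<^esub> \<nn>" and "g \<in> \<nn> - \<nn> \<cdot>\<^bsub>Q\<^esub> \<nn>"
    and "f \<otimes>\<^bsub>Q\<^esub> g = \<zero>\<^bsub>Q\<^esub>"
    and "module (Q Quot (PIdl\<^bsub>Q\<^esub> f)) M"
    and "finitely_generated_module (Q Quot (PIdl\<^bsub>Q\<^esub> f)) M"
    and "minimal_free_resolution Q \<nn> U (restrict_scalars ((+>\<^bsub>Q\<^esub>) (PIdl\<^bsub>Q\<^esub> f)) M)"
  shows "(\<exists>act. semi_free_dg_module Q (tate Q f g) U act) \<and>
    (annihilator Q f = PIdl\<^bsub>Q\<^esub> g \<and> annihilator Q g = PIdl\<^bsub>Q\<^esub> f \<longrightarrow>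
      (\<forall>act. semi_free_dg_module Q (tate Q f g) U act \<longrightarrow>
        minimal_free_resolution (Q Quot (PIdl\<^bsub>Q\<^esub> f)) ((+>\<^bsub>Q\<^esub>) (PIdl\<^bsub>Q\<^esub> f) ` \<nn>)
          (tensor_complex (tate Q f g) U act
             (ring_complex (Q Quot (PIdl\<^bsub>Q\<^esub> f))) (augmentation_act Q f)) M))"
proof -
  interpret Q: noetherian_local_ring Q \<nn> by fact
  have fg: "f \<in> carrier Q" "g \<in> carrier Q"
    using assms(2,3) ideal.Icarr[OF Q.maximal_ideal] by auto
  have f_ideal: "ideal (PIdl\<^bsub>Q\<^esub> f) Q" by (rule Q.cgenideal_ideal[OF fg(1)])
  have res: "chain_complex Q U" "concentrated_ge 0 U" "\<And>n. finite_free_module Q (component U n)"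
    "\<And>n. n > 0 \<Longrightarrow> cycles U n = boundaries U n"
    "\<And>n. bdry U n ` carrier (component U n) \<subseteq> ideal_times_module Q \<nn> (component U (n - 1))"
    using assms(7) by (auto simp: minimal_free_resolution_def free_resolution_def)
  obtain \<epsilon> where \<epsilon>: "\<epsilon> \<in> module_hom Q (component U 0) (restrict_scalars ((+>\<^bsub>Q\<^esub>) (PIdl\<^bsub>Q\<^esub> f)) M)"
    and ker: "{x \<in> carrier (component U 0). \<epsilon> x = \<zero>\<^bsub>M\<^esub>} = boundaries U 0"
    using assms(7) unfolding minimal_free_resolution_def free_resolution_def by auto
  interpret M: module "Q Quot (PIdl\<^bsub>Q\<^esub> f)" M by fact
  interpret U: module Q "component U 0" by (rule chain_complex.comp_module[OF res(1)])
  \<comment> \<open>As \<open>M\<close> is a module over the quotient ring, \<open>f x\<close> lies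
    in the kernel of the augmentation, which consists of the boundaries.\<close>
  have smult_f: "f \<odot>\<^bsub>component U 0\<^esub> x \<in> boundaries U 0" if x: "x \<in> carrier (component U 0)" for x
  proof -
    have "PIdl\<^bsub>Q\<^esub> f +>\<^bsub>Q\<^esub> f = \<zero>\<^bsub>Q Quot (PIdl\<^bsub>Q\<^esub> f)\<^esub>"
      using Q.Quot_eq_zero_iff[OF f_ideal fg(1)] Q.cgenideal_self[OF fg(1)] by simp
    then have "\<epsilon> (f \<odot>\<^bsub>component U 0\<^esub> x) = \<zero>\<^bsub>M\<^esub>"
      using module_homD(3)[OF \<epsilon> fg(1) x] module_homD(1)[OF \<epsilon> x] by simp
    then show ?thesis unfolding ker[symmetric] using x fg(1) by simp
  qed
  interpret C: minimal_complex Q \<nn> U f g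
    using res smult_f assms(2-4)
    by (intro minimal_complex.intro minimal_complex_axioms.intro Q.noetherian_local_ring_axioms) auto
  \<comment> \<open>This makes the quotient ring nonzero, as needed for finite freeness of its
    modules in terms of sets.\<close>
  have f_proper: "\<one>\<^bsub>Q\<^esub> \<notin> PIdl\<^bsub>Q\<^esub> f"
    using Q.cgenideal_minimal[OF Q.maximal_ideal, of f] Q.one_not_in_maximal assms(2) by blast
  show ?thesis
  proof (intro conjI impI allI)
    show "\<exists>act. semi_free_dg_module Q (tate Q f g) U act" by (rule C.semi_free_exists)
    fix act
    assume ann: "annihilator Q f = PIdl\<^bsub>Q\<^esub> g \<and> annihilator Q g = PIdl\<^bsub>Q\<^esub> f"
      and sf: "semi_free_dg_module Q (tate Q f g) U act"
    \<comment> \<open>From here on the given structure is treated in coordinates, so nothing depends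
      on how the structure of the first part was chosen.\<close>
    obtain E W where EW: "\<And>i. i < 0 \<Longrightarrow> E i = {}" "\<And>N. tate_basis Q U f g N E W"
      "\<And>m n a x. \<lbrakk>a \<in> carrier (tate_comp Q m); x \<in> carrier (component U n)\<rbrakk> \<Longrightarrow>
        act m n a x = tate_act Q U E W m n a x"
      using tate_basis_if_semi_free[OF sf fg assms(4) Q.one_not_zero res(3,2)] by blast
    interpret T: tate_tensor Q U f g E W act
      using res(1) EW by (intro tate_tensor.intro tate_semi_free.intro tate_semi_free_axioms.intro tate_tensor_axioms.intro) auto
    show "minimal_free_resolution (Q Quot (PIdl\<^bsub>Q\<^esub> f)) ((+>\<^bsub>Q\<^esub>) (PIdl\<^bsub>Q\<^esub> f) ` \<nn>)
        (tensor_complex (tate Q f g) U act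
           (ring_complex (Q Quot (PIdl\<^bsub>Q\<^esub> f))) (augmentation_act Q f)) M"
      using ann by (intro T.TC_minimal_free_resolution Q.maximal_ideal f_proper assms(5,7)) auto
  qed
qed

end
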